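(* Let $X$ be an Archimedean vector lattice admitting a minimal topology $\tau$. The following are equivalent: (i) $X$ is universally complete; (ii) $\tau$ is complete; (iii) $\tau$ satisfies the monotone completeness property (MCP); (iv) $\tau$ is Levi; (v) $\tau$ is quasi-complete; (vi) $(X,\tau)$ is boundedly $uo$-complete, in the sense that $\tau$-bounded $uo$-Cauchy nets in $X$ are $uo$-convergent in $X$.
   Context: A locally solid topology on a vector lattice is a linear topology with a base at zero consisting of solid sets. A Hausdorff locally solid topology $\tau$ on $X$ is minimal if there is no strictly coarser Hausdorff locally solid topology on $X$. A vector lattice is universally complete if it is order complete (every non-empty order bounded above set has a supremum) and laterally complete (every set of pairwise disjoint positive elements has a supremum). $\tau$ satisfies MCP if every increasing $\tau$-Cauchy net in $X_+$ is $\tau$-convergent in $X$. $\tau$ is Levi if every $\tau$-bounded increasing net in $X_+$ has a supremum in $X$. $\tau$ is complete if every $\tau$-Cauchy net is $\tau$-convergent, and quasi-complete if every $\tau$-bounded $\tau$-Cauchy net is $\tau$-convergent. A set is $\tau$-bounded if it is absorbed by every $\tau$-neighbourhood of zero. A net $(x_\alpha)$ in $X$ converges in order to $x$, written $x_\alpha\xrightarrow{o}x$, if there is a net $(y_\beta)$ in $X$, possibly over a different index set, with $y_\beta\downarrow 0$ and such that for every $\beta$ there is $\alpha_0$ with $|x_\alpha-x|\le y_\beta$ whenever $\alpha\ge\alpha_0$. A net $(x_\alpha)$ $uo$-converges to $x\in X$ if $|x_\alpha-x|\wedge u\xrightarrow{o}0$ for every $u\in X_+$. It is $uo$-Cauchy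 if the doubly indexed net $(x_\alpha-x_{\alpha'})_{(\alpha,\alpha')}$ $uo$-converges to $0$. *)

theory Defs
  imports "HOL-Analysis.Analysis" "HOL-Library.Lattice_Algebras" "HOL-Library.Lub_Glb"
begin

section \<open>Vector lattices\<close>

class vector_lattice = ordered_real_vector + lattice_ab_group_add_abs

definition archimedean_lattice :: "'a::vector_lattice itself \<Rightarrow> bool" where
  "archimedean_lattice _ \<longleftrightarrow>
     (\<forall>x::'a. 0 \<le> x \<longrightarrow> isGlb UNIV (range (\<lambda>n::nat. (1 / real (Suc n)) *\<^sub>R x)) 0)"

definition order_complete :: "'a::vector_lattice itself \<Rightarrow> bool" where
  "order_complete _ \<longleftrightarrow>
     (\<forall>S::'a set. S \<noteq> {} \<and> (\<exists>u. isUb UNIV S u) \<longrightarrow> (\<exists>s. isLub UNIV S s))"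

text \<open>The empty set has to be excluded: its supremum would be a least element of the whole
  space, which exists only in the zero space.\<close>

definition laterally_complete :: "'a::vector_lattice itself \<Rightarrow> bool" where
  "laterally_complete _ \<longleftrightarrow>
     (\<forall>S::'a set. S \<noteq> {} \<and> (\<forall>x\<in>S. 0 \<le> x) \<and> pairwise (\<lambda>x y. inf x y = 0) S
        \<longrightarrow> (\<exists>s. isLub UNIV S s))"

definition universally_complete :: "'a::vector_lattice itself \<Rightarrow> bool" where
  "universally_complete T \<longleftrightarrow> order_complete T \<and> laterally_complete T"


section \<open>Locally solid topologies\<close>

definition linear_topology :: "'a::real_vector topology \<Rightarrow> bool" where
  "linear_topology \<tau> \<longleftrightarrow>
     topspace \<tau> = UNIV \<and>
     continuous_map (prod_topology \<tau> \<tau>) \<tau> (\<lambda>(x, y). x + y) \<and>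
     continuous_map (prod_topology euclideanreal \<tau>) \<tau> (\<lambda>(c, x). c *\<^sub>R x)"

definition solid :: "'a::vector_lattice set \<Rightarrow> bool" where
  "solid S \<longleftrightarrow> (\<forall>x y. \<bar>x\<bar> \<le> \<bar>y\<bar> \<and> y \<in> S \<longrightarrow> x \<in> S)"

definition locally_solid :: "'a::vector_lattice topology \<Rightarrow> bool" where
  "locally_solid \<tau> \<longleftrightarrow> linear_topology \<tau> \<and> neighbourhood_base_at 0 solid \<tau>"

definition minimal_topology :: "'a::vector_lattice topology \<Rightarrow> bool" where
  "minimal_topology \<tau> \<longleftrightarrow>
     locally_solid \<tau> \<and> Hausdorff_space \<tau> \<and>
     \<not> (\<exists>\<sigma>. locally_solid \<sigma> \<and> Hausdorff_space \<sigma> \<and>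
            (\<forall>U. openin \<sigma> U \<longrightarrow> openin \<tau> U) \<and> \<sigma> \<noteq> \<tau>)"

definition tau_bounded :: "'a::real_vector topology \<Rightarrow> 'a set \<Rightarrow> bool" where
  "tau_bounded \<tau> B \<longleftrightarrow>
     (\<forall>U. openin \<tau> U \<and> 0 \<in> U \<longrightarrow> (\<exists>c>0. B \<subseteq> (\<lambda>x. c *\<^sub>R x) ` U))"


section \<open>Nets\<close>

text \<open>A net \<open>x\<close> is given on a directed index set \<open>A\<close>, preordered by \<open>r\<close> (read \<open>r a b\<close> as
  \<open>a \<le> b\<close>). Its eventual behaviour is that along the filter generated by the tails of \<open>A\<close>.\<close>

definition directed_set :: "'i set \<Rightarrow> ('i \<Rightarrow> 'i \<Rightarrow> bool) \<Rightarrow> bool" where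
  "directed_set A r \<longleftrightarrow>
     A \<noteq> {} \<and> reflp_on A r \<and> transp_on A r \<and> (\<forall>a\<in>A. \<forall>b\<in>A. \<exists>c\<in>A. r a c \<and> r b c)"

definition tails :: "'i set \<Rightarrow> ('i \<Rightarrow> 'i \<Rightarrow> bool) \<Rightarrow> 'i filter" where
  "tails A r = (INF a\<in>A. principal {b\<in>A. r a b})"

lemma eventually_tails:
  assumes "directed_set A r"
  shows "eventually P (tails A r) \<longleftrightarrow> (\<exists>a\<in>A. \<forall>b\<in>A. r a b \<longrightarrow> P b)"
proof -
  have "eventually P (tails A r) \<longleftrightarrow> (\<exists>a\<in>A. eventually P (principal {b\<in>A. r a b}))"
    unfolding tails_def
  proof (rule eventually_INF_base)
    show "A \<noteq> {}" using assms by (simp add: directed_set_def)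
    fix a b assume ab: "a \<in> A" "b \<in> A"
    then obtain c where c: "c \<in> A" "r a c" "r b c"
      using assms unfolding directed_set_def by blast
    have "r a d" "r b d" if "d \<in> A" "r c d" for d
      using assms ab c that unfolding directed_set_def transp_on_def by blast+
    then show "\<exists>c\<in>A. principal {d\<in>A. r c d} \<le>
        inf (principal {d\<in>A. r a d}) (principal {d\<in>A. r b d})"
      using c(1) by (intro bexI[of _ c]) auto
  qed
  then show ?thesis by (auto simp: eventually_principal)
qed

text \<open>The index set of doubly indexed nets such as \<open>x a - x b\<close>.\<close>

definition prod_rel :: "('i \<Rightarrow> 'i \<Rightarrow> bool) \<Rightarrow> 'i \<times> 'i \<Rightarrow> 'i \<times> 'i \<Rightarrow> bool" where
  "prod_rel r p q \<longleftrightarrow> r (fst p) (fst q) \<and> r (snd p) (snd q)"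

lemma directed_set_prod:
  assumes "directed_set A r"
  shows "directed_set (A \<times> A) (prod_rel r)"
proof -
  have "transp_on (A \<times> A) (prod_rel r)"
  proof (rule transp_onI)
    fix p q z
    assume "p \<in> A \<times> A" "q \<in> A \<times> A" "z \<in> A \<times> A" "prod_rel r p q" "prod_rel r q z"
    then show "prod_rel r p z"
      using assms unfolding directed_set_def transp_on_def prod_rel_def mem_Times_iff by blast
  qed
  moreover have "\<exists>c\<in>A \<times> A. prod_rel r p c \<and> prod_rel r q c"
    if "p \<in> A \<times> A" "q \<in> A \<times> A" for p q
  proof -
    obtain c d where "c \<in> A" "r (fst p) c" "r (fst q) c" "d \<in> A" "r (snd p) d" "r (snd q) d"
      using assms \<open>p \<in> A \<times> A\<close> \<open>q \<in> A \<times> A\<close> unfolding directed_set_def mem_Times_iff by meson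
    then show ?thesis by (intro bexI[of _ "(c, d)"]) (auto simp: prod_rel_def)
  qed
  ultimately show ?thesis
    using assms by (auto simp: directed_set_def reflp_on_def prod_rel_def)
qed

definition increasing_net ::
    "'i set \<Rightarrow> ('i \<Rightarrow> 'i \<Rightarrow> bool) \<Rightarrow> ('i \<Rightarrow> 'a::order) \<Rightarrow> bool" where
  "increasing_net A r x \<longleftrightarrow> (\<forall>a\<in>A. \<forall>b\<in>A. r a b \<longrightarrow> x a \<le> x b)"

definition cauchy_net ::
    "'a::real_vector topology \<Rightarrow> 'i set \<Rightarrow> ('i \<Rightarrow> 'i \<Rightarrow> bool) \<Rightarrow> ('i \<Rightarrow> 'a) \<Rightarrow> bool" where
  "cauchy_net \<tau> A r x \<longleftrightarrow> limitin \<tau> (\<lambda>(a, b). x a - x b) 0 (tails (A \<times> A) (prod_rel r))"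

definition net_decreases_to_0 ::
    "'j set \<Rightarrow> ('j \<Rightarrow> 'j \<Rightarrow> bool) \<Rightarrow> ('j \<Rightarrow> 'a::vector_lattice) \<Rightarrow> bool" where
  "net_decreases_to_0 B s y \<longleftrightarrow>
     directed_set B s \<and> (\<forall>a\<in>B. \<forall>b\<in>B. s a b \<longrightarrow> y b \<le> y a) \<and> isGlb UNIV (y ` B) 0"

text \<open>The dominating net may be indexed by any directed set. Indexing it by elements of the
  space is no restriction, see \<open>order_convergesI\<close> below.\<close>

definition order_converges ::
    "('i \<Rightarrow> 'a::vector_lattice) \<Rightarrow> 'a \<Rightarrow> 'i filter \<Rightarrow> bool" where
  "order_converges x l F \<longleftrightarrow>
     (\<exists>(B::'a set) s (y::'a \<Rightarrow> 'a). net_decreases_to_0 B s y \<and>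
        (\<forall>b\<in>B. eventually (\<lambda>a. \<bar>x a - l\<bar> \<le> y b) F))"

lemma order_convergesI:
  fixes B :: "'j set" and y :: "'j \<Rightarrow> 'a::vector_lattice"
  assumes y: "net_decreases_to_0 B s y"
    and ev: "\<And>b. b \<in> B \<Longrightarrow> eventually (\<lambda>a. \<bar>x a - l\<bar> \<le> y b) F"
  shows "order_converges x l F"
proof -
  have B: "directed_set B s" "\<And>a b. a \<in> B \<Longrightarrow> b \<in> B \<Longrightarrow> s a b \<Longrightarrow> y b \<le> y a"
    "isGlb UNIV (y ` B) 0"
    using y by (auto simp: net_decreases_to_0_def)
  have "\<exists>c\<in>B. y c \<le> y a \<and> y c \<le> y b" if "a \<in> B" "b \<in> B" for a b
    using B(1,2) that unfolding directed_set_def by blast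
  then have "directed_set (y ` B) (\<lambda>u v. v \<le> u)"
    using B(1) by (simp add: directed_set_def reflp_on_def transp_on_def)
  then have "net_decreases_to_0 (y ` B) (\<lambda>u v. v \<le> u) id"
    using B(3) by (simp add: net_decreases_to_0_def)
  then show ?thesis
    using ev unfolding order_converges_def
    by (intro exI[of _ "y ` B"] exI[of _ "\<lambda>u v. v \<le> u"] exI[of _ id]) auto
qed

definition uo_converges ::
    "('i \<Rightarrow> 'a::vector_lattice) \<Rightarrow> 'a \<Rightarrow> 'i filter \<Rightarrow> bool" where
  "uo_converges x l F \<longleftrightarrow> (\<forall>u\<ge>0. order_converges (\<lambda>a. inf \<bar>x a - l\<bar> u) 0 F)"

definition uo_cauchy_net ::
    "'i set \<Rightarrow> ('i \<Rightarrow> 'i \<Rightarrow> bool) \<Rightarrow> ('i \<Rightarrow> 'a::vector_lattice) \<Rightarrow> bool" where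
  "uo_cauchy_net A r x \<longleftrightarrow>
     uo_converges (\<lambda>(a, b). x a - x b) 0 (tails (A \<times> A) (prod_rel r))"


section \<open>Completeness properties\<close>

text \<open>These properties quantify over nets indexed by arbitrary directed sets, which HOL cannot
  express by quantification over types. So they are defined relative to a type \<open>'i\<close> containing
  the index sets. The type \<open>'a net_index\<close> is large enough: the lemmas at the end of this theory
  show that each property for \<open>'a net_index\<close> implies it for every index type.\<close>

type_synonym 'a net_index = "'a set \<times> 'a"

definition complete_topology :: "'i itself \<Rightarrow> 'a::vector_lattice topology \<Rightarrow> bool" where
  "complete_topology _ \<tau> \<longleftrightarrow>
     (\<forall>(A::'i set) r x. directed_set A r \<and> cauchy_net \<tau> A r x
        \<longrightarrow> (\<exists>l. limitin \<tau> x l (tails A r)))"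

definition quasi_complete_topology :: "'i itself \<Rightarrow> 'a::vector_lattice topology \<Rightarrow> bool" where
  "quasi_complete_topology _ \<tau> \<longleftrightarrow>
     (\<forall>(A::'i set) r x. directed_set A r \<and> tau_bounded \<tau> (x ` A) \<and> cauchy_net \<tau> A r x
        \<longrightarrow> (\<exists>l. limitin \<tau> x l (tails A r)))"

definition monotone_complete_topology :: "'i itself \<Rightarrow> 'a::vector_lattice topology \<Rightarrow> bool" where
  "monotone_complete_topology _ \<tau> \<longleftrightarrow>
     (\<forall>(A::'i set) r x. directed_set A r \<and> (\<forall>a\<in>A. 0 \<le> x a) \<and> increasing_net A r x \<and>
          cauchy_net \<tau> A r x
        \<longrightarrow> (\<exists>l. limitin \<tau> x l (tails A r)))"

definition levi_topology :: "'i itself \<Rightarrow> 'a::vector_lattice topology \<Rightarrow> bool" where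
  "levi_topology _ \<tau> \<longleftrightarrow>
     (\<forall>(A::'i set) r x. directed_set A r \<and> (\<forall>a\<in>A. 0 \<le> x a) \<and> increasing_net A r x \<and>
          tau_bounded \<tau> (x ` A)
        \<longrightarrow> (\<exists>s. isLub UNIV (x ` A) s))"

definition boundedly_uo_complete :: "'i itself \<Rightarrow> 'a::vector_lattice topology \<Rightarrow> bool" where
  "boundedly_uo_complete _ \<tau> \<longleftrightarrow>
     (\<forall>(A::'i set) r x. directed_set A r \<and> tau_bounded \<tau> (x ` A) \<and> uo_cauchy_net A r x
        \<longrightarrow> (\<exists>l. uo_converges x l (tails A r)))"


section \<open>Independence of the index type\<close>

lemma net_reindex:
  fixes x :: "'i \<Rightarrow> 'a"
  assumes A: "directed_set A r" and R: "reflp R" "transp R"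
    and x: "\<And>a b. a \<in> A \<Longrightarrow> b \<in> A \<Longrightarrow> r a b \<Longrightarrow> R (x a) (x b)"
  obtains B :: "'a net_index set" and s where
    "directed_set B s" "snd ` B = x ` A" "\<And>p q. s p q \<Longrightarrow> R (snd p) (snd q)"
    "filtermap snd (tails B s) = filtermap x (tails A r)"
proof -
  define T where "T a = x ` {b\<in>A. r a b}" for a
  define B where "B = {(T a, x c) | a c. a \<in> A \<and> c \<in> A \<and> r a c}"
  define s where "s p q \<longleftrightarrow> fst q \<subseteq> fst p \<and> R (snd p) (snd q)" for p q :: "'a net_index"
  have refl: "r a a" if "a \<in> A" for a
    using A that by (auto simp: directed_set_def reflp_on_def)
  have trans: "r a c" if "a \<in> A" "b \<in> A" "c \<in> A" "r a b" "r b c" for a b c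
    using A that unfolding directed_set_def transp_on_def by blast
  have dir: "\<exists>c\<in>A. r a c \<and> r b c" if "a \<in> A" "b \<in> A" for a b
    using A that unfolding directed_set_def by blast
  have mono: "T b \<subseteq> T a" if "a \<in> A" "b \<in> A" "r a b" for a b
    using that trans unfolding T_def by blast
  have "\<exists>z\<in>B. s p z \<and> s q z" if pq: "p \<in> B" "q \<in> B" for p q
  proof -
    obtain a c where ac: "a \<in> A" "c \<in> A" "r a c" "p = (T a, x c)"
      using pq(1) by (auto simp: B_def)
    obtain b d where bd: "b \<in> A" "d \<in> A" "r b d" "q = (T b, x d)"
      using pq(2) by (auto simp: B_def)
    obtain e where e: "e \<in> A" "r c e" "r d e"
      using dir ac bd by blast
    have "(T e, x e) \<in> B" using e refl by (auto simp: B_def)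
    moreover have "r a e" "r b e" using ac bd e trans by blast+
    ultimately show ?thesis
      using ac bd e mono x by (intro bexI[of _ "(T e, x e)"]) (simp_all add: s_def)
  qed
  moreover have "B \<noteq> {}"
    using A refl by (fastforce simp: B_def directed_set_def)
  moreover have "reflp_on B s"
    using R(1) by (auto simp: s_def reflp_on_def)
  moreover have "transp_on B s"
    using R(2) unfolding s_def transp_on_def by blast
  ultimately have B: "directed_set B s"
    by (auto simp: directed_set_def)
  have im: "snd ` B = x ` A"
  proof
    show "snd ` B \<subseteq> x ` A" by (auto simp: B_def)
    show "x ` A \<subseteq> snd ` B"
    proof
      fix z assume "z \<in> x ` A"
      then obtain a where "a \<in> A" "z = x a" by auto
      then have "(T a, z) \<in> B" using refl by (auto simp: B_def)
      then show "z \<in> snd ` B" by force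
    qed
  qed
  have in_T: "snd p \<in> fst p" if "p \<in> B" for p
    using that by (auto simp: B_def T_def)
  have "eventually (\<lambda>p. P (snd p)) (tails B s) \<longleftrightarrow> eventually (\<lambda>a. P (x a)) (tails A r)" for P
  proof
    assume "eventually (\<lambda>p. P (snd p)) (tails B s)"
    then obtain p where p: "p \<in> B" "\<And>q. q \<in> B \<Longrightarrow> s p q \<Longrightarrow> P (snd q)"
      unfolding eventually_tails[OF B] by blast
    then obtain a c where ac: "a \<in> A" "c \<in> A" "r a c" "p = (T a, x c)"
      by (auto simp: B_def)
    have "P (x b)" if "b \<in> A" "r c b" for b
    proof -
      have "(T b, x b) \<in> B" using that refl by (auto simp: B_def)
      moreover have "r a b" using ac that trans by blast
      then have "s p (T b, x b)"
        using ac that mono x by (simp add: s_def)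
      ultimately show ?thesis using p(2) by fastforce
    qed
    then show "eventually (\<lambda>a. P (x a)) (tails A r)"
      using ac(2) eventually_tails[OF A] by auto
  next
    assume "eventually (\<lambda>a. P (x a)) (tails A r)"
    then obtain a where a: "a \<in> A" "\<And>b. b \<in> A \<Longrightarrow> r a b \<Longrightarrow> P (x b)"
      using eventually_tails[OF A] by auto
    have "(T a, x a) \<in> B" using a(1) refl by (auto simp: B_def)
    moreover have "P (snd q)" if "q \<in> B" "s (T a, x a) q" for q
      using in_T[OF that(1)] that(2) a(2) by (auto simp: s_def T_def)
    ultimately show "eventually (\<lambda>p. P (snd p)) (tails B s)"
      using eventually_tails[OF B] by blast
  qed
  then have "filtermap snd (tails B s) = filtermap x (tails A r)"
    by (simp add: filter_eq_iff eventually_filtermap)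
  moreover have "R (snd p) (snd q)" if "s p q" for p q
    using that by (simp add: s_def)
  ultimately show thesis using B im that by blast
qed

lemma limitin_filtermap_cong:
  assumes "filtermap x F = filtermap y G"
  shows "limitin \<tau> x l F \<longleftrightarrow> limitin \<tau> y l G"
proof -
  have "eventually (\<lambda>a. P (x a)) F \<longleftrightarrow> eventually (\<lambda>a. P (y a)) G" for P
    using assms by (simp add: filter_eq_iff eventually_filtermap)
  from this[of "\<lambda>v. v \<in> U" for U] show ?thesis by (simp only: limitin_def)
qed

lemma uo_converges_filtermap_cong:
  assumes "filtermap x F = filtermap y G"
  shows "uo_converges x l F \<longleftrightarrow> uo_converges y l G"
proof -
  have "eventually (\<lambda>a. P (x a)) F \<longleftrightarrow> eventually (\<lambda>a. P (y a)) G" for P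
    using assms by (simp add: filter_eq_iff eventually_filtermap)
  from this[of "\<lambda>v. \<bar>inf (\<bar>v - l\<bar>) u - 0\<bar> \<le> w" for u w] show ?thesis
    by (simp only: uo_converges_def order_converges_def)
qed

lemma eventually_tails_prod:
  assumes "directed_set A r"
  shows "eventually (\<lambda>(a, b). P (x a) (x b)) (tails (A \<times> A) (prod_rel r)) \<longleftrightarrow>
    (\<exists>Q. eventually Q (filtermap x (tails A r)) \<and> (\<forall>u v. Q u \<longrightarrow> Q v \<longrightarrow> P u v))"
    (is "?L \<longleftrightarrow> ?R")
proof
  assume ?L
  then obtain a b where ab: "a \<in> A" "b \<in> A"
    and P: "\<And>c d. c \<in> A \<Longrightarrow> d \<in> A \<Longrightarrow> r a c \<Longrightarrow> r b d \<Longrightarrow> P (x c) (x d)"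
    using eventually_tails[OF directed_set_prod[OF assms]] by (auto simp: prod_rel_def)
  obtain e where e: "e \<in> A" "r a e" "r b e"
    using assms ab unfolding directed_set_def by blast
  have up: "r a c" "r b c" if "c \<in> A" "r e c" for c
    using assms ab e that unfolding directed_set_def transp_on_def by blast+
  show ?R
    using e(1) up P
    by (intro exI[of _ "\<lambda>u. u \<in> x ` {c\<in>A. r e c}"])
       (auto simp: eventually_filtermap eventually_tails[OF assms])
next
  assume ?R
  then obtain Q a where "a \<in> A" "\<And>b. b \<in> A \<Longrightarrow> r a b \<Longrightarrow> Q (x b)"
    "\<And>u v. Q u \<Longrightarrow> Q v \<Longrightarrow> P u v"
    unfolding eventually_filtermap eventually_tails[OF assms] by blast
  then show ?L
    unfolding eventually_tails[OF directed_set_prod[OF assms]]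
    by (intro bexI[of _ "(a, a)"]) (auto simp: prod_rel_def)
qed

lemma filtermap_diff_cong:
  assumes "directed_set A r" "directed_set B s"
    and "filtermap x (tails A r) = filtermap y (tails B s)"
  shows "filtermap (\<lambda>(a, b). x a - x b) (tails (A \<times> A) (prod_rel r)) =
    filtermap (\<lambda>(a, b). y a - y b) (tails (B \<times> B) (prod_rel s))"
proof (rule filter_eq_iff[THEN iffD2], rule allI)
  fix P
  have "eventually (\<lambda>(a, b). P (x a - x b)) (tails (A \<times> A) (prod_rel r)) \<longleftrightarrow>
    eventually (\<lambda>(a, b). P (y a - y b)) (tails (B \<times> B) (prod_rel s))"
    using eventually_tails_prod[OF assms(1), of "\<lambda>u v. P (u - v)" x]
      eventually_tails_prod[OF assms(2), of "\<lambda>u v. P (u - v)" y]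
    by (simp only: assms(3))
  then show "eventually P (filtermap (\<lambda>(a, b). x a - x b) (tails (A \<times> A) (prod_rel r))) \<longleftrightarrow>
    eventually P (filtermap (\<lambda>(a, b). y a - y b) (tails (B \<times> B) (prod_rel s)))"
    by (simp only: eventually_filtermap case_prod_unfold)
qed

lemma cauchy_net_cong:
  assumes "directed_set A r" "directed_set B s"
    and "filtermap x (tails A r) = filtermap y (tails B s)"
  shows "cauchy_net \<tau> A r x \<longleftrightarrow> cauchy_net \<tau> B s y"
  unfolding cauchy_net_def by (intro limitin_filtermap_cong filtermap_diff_cong assms)

lemma uo_cauchy_net_cong:
  assumes "directed_set A r" "directed_set B s"
    and "filtermap x (tails A r) = filtermap y (tails B s)"
  shows "uo_cauchy_net A r x \<longleftrightarrow> uo_cauchy_net B s y"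
  unfolding uo_cauchy_net_def by (intro uo_converges_filtermap_cong filtermap_diff_cong assms)

lemma complete_topology_any_index:
  fixes \<tau> :: "'a::vector_lattice topology"
  assumes "complete_topology TYPE('a net_index) \<tau>"
  shows "complete_topology TYPE('i) \<tau>"
  unfolding complete_topology_def
proof (intro allI impI, elim conjE)
  fix A :: "'i set" and r and x :: "'i \<Rightarrow> 'a"
  assume A: "directed_set A r" "cauchy_net \<tau> A r x"
  obtain B :: "'a net_index set" and s where B: "directed_set B s"
    "filtermap snd (tails B s) = filtermap x (tails A r)"
    by (rule net_reindex[OF A(1), of "\<lambda>_ _. True" x]) (auto simp: reflp_def transp_def)
  have "cauchy_net \<tau> B s snd"
    using cauchy_net_cong[OF B(1) A(1) B(2)] A(2) by simp
  then obtain l where "limitin \<tau> snd l (tails B s)"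
    using assms B(1) unfolding complete_topology_def by blast
  then show "\<exists>l. limitin \<tau> x l (tails A r)"
    using limitin_filtermap_cong[OF B(2)] by blast
qed

lemma quasi_complete_topology_any_index:
  fixes \<tau> :: "'a::vector_lattice topology"
  assumes "quasi_complete_topology TYPE('a net_index) \<tau>"
  shows "quasi_complete_topology TYPE('i) \<tau>"
  unfolding quasi_complete_topology_def
proof (intro allI impI, elim conjE)
  fix A :: "'i set" and r and x :: "'i \<Rightarrow> 'a"
  assume A: "directed_set A r" "tau_bounded \<tau> (x ` A)" "cauchy_net \<tau> A r x"
  obtain B :: "'a net_index set" and s where B: "directed_set B s" "snd ` B = x ` A"
    "filtermap snd (tails B s) = filtermap x (tails A r)"
    by (rule net_reindex[OF A(1), of "\<lambda>_ _. True" x]) (auto simp: reflp_def transp_def)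
  have "cauchy_net \<tau> B s snd"
    using cauchy_net_cong[OF B(1) A(1) B(3)] A(3) by simp
  then obtain l where "limitin \<tau> snd l (tails B s)"
    using assms A(2) B(1,2) unfolding quasi_complete_topology_def by metis
  then show "\<exists>l. limitin \<tau> x l (tails A r)"
    using limitin_filtermap_cong[OF B(3)] by blast
qed

lemma monotone_complete_topology_any_index:
  fixes \<tau> :: "'a::vector_lattice topology"
  assumes "monotone_complete_topology TYPE('a net_index) \<tau>"
  shows "monotone_complete_topology TYPE('i) \<tau>"
  unfolding monotone_complete_topology_def
proof (intro allI impI, elim conjE)
  fix A :: "'i set" and r and x :: "'i \<Rightarrow> 'a"
  assume A: "directed_set A r" "\<forall>a\<in>A. 0 \<le> x a" "increasing_net A r x" "cauchy_net \<tau> A r x"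
  obtain B :: "'a net_index set" and s where B: "directed_set B s" "snd ` B = x ` A"
    "filtermap snd (tails B s) = filtermap x (tails A r)" "\<And>p q. s p q \<Longrightarrow> snd p \<le> snd q"
    by (rule net_reindex[OF A(1), of "(\<le>)" x])
      (use A(3) in \<open>auto simp: increasing_net_def reflp_def transp_def\<close>)
  have "increasing_net B s snd" using B(4) by (simp add: increasing_net_def)
  moreover have "cauchy_net \<tau> B s snd"
    using cauchy_net_cong[OF B(1) A(1) B(3)] A(4) by simp
  moreover have "\<forall>p\<in>B. 0 \<le> snd p"
    using A(2) B(2) by (metis imageE imageI)
  ultimately obtain l where "limitin \<tau> snd l (tails B s)"
    using assms B(1) unfolding monotone_complete_topology_def by blast
  then show "\<exists>l. limitin \<tau> x l (tails A r)"
    using limitin_filtermap_cong[OF B(3)] by blast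
qed

lemma levi_topology_any_index:
  fixes \<tau> :: "'a::vector_lattice topology"
  assumes "levi_topology TYPE('a net_index) \<tau>"
  shows "levi_topology TYPE('i) \<tau>"
  unfolding levi_topology_def
proof (intro allI impI, elim conjE)
  fix A :: "'i set" and r and x :: "'i \<Rightarrow> 'a"
  assume A: "directed_set A r" "\<forall>a\<in>A. 0 \<le> x a" "increasing_net A r x" "tau_bounded \<tau> (x ` A)"
  obtain B :: "'a net_index set" and s where B: "directed_set B s" "snd ` B = x ` A"
    "\<And>p q. s p q \<Longrightarrow> snd p \<le> snd q"
    by (rule net_reindex[OF A(1), of "(\<le>)" x])
      (use A(3) in \<open>auto simp: increasing_net_def reflp_def transp_def\<close>)
  have "increasing_net B s snd" using B(3) by (simp add: increasing_net_def)
  moreover have "\<forall>p\<in>B. 0 \<le> snd p"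
    using A(2) B(2) by (metis imageE imageI)
  ultimately show "\<exists>u. isLub UNIV (x ` A) u"
    using assms A(4) B(1,2) unfolding levi_topology_def by metis
qed

lemma boundedly_uo_complete_any_index:
  fixes \<tau> :: "'a::vector_lattice topology"
  assumes "boundedly_uo_complete TYPE('a net_index) \<tau>"
  shows "boundedly_uo_complete TYPE('i) \<tau>"
  unfolding boundedly_uo_complete_def
proof (intro allI impI, elim conjE)
  fix A :: "'i set" and r and x :: "'i \<Rightarrow> 'a"
  assume A: "directed_set A r" "tau_bounded \<tau> (x ` A)" "uo_cauchy_net A r x"
  obtain B :: "'a net_index set" and s where B: "directed_set B s" "snd ` B = x ` A"
    "filtermap snd (tails B s) = filtermap x (tails A r)"
    by (rule net_reindex[OF A(1), of "\<lambda>_ _. True" x]) (auto simp: reflp_def transp_def)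
  have "uo_cauchy_net B s snd"
    using uo_cauchy_net_cong[OF B(1) A(1) B(3)] A(3) by simp
  then obtain l where "uo_converges snd l (tails B s)"
    using assms A(2) B(1,2) unfolding boundedly_uo_complete_def by metis
  then show "\<exists>l. uo_converges x l (tails A r)"
    using uo_converges_filtermap_cong[OF B(3)] by blast
qed

end

theory Submission
  imports Defs
begin

text \<open>
  Two properties of a minimal topology \<open>\<tau>\<close> drive the argument. It is unbounded: a net tends to zero
  as soon as all truncations \<open>inf \<bar>x a\<bar> u\<close> do. And it is Lebesgue: a net decreasing to zero in order
  tends to zero in \<open>\<tau>\<close>. Both come from one observation: if \<open>A\<close> is an upward directed set of positive
  elements and no nonzero element is disjoint from all of \<open>A\<close>, then the sets \<open>{x. inf \<bar>x\<bar> u \<in> W}\<close>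
  with \<open>u \<in> A\<close> and \<open>W\<close> a neighbourhood of zero form a base at zero of a Hausdorff locally solid topology coarser
  than \<open>\<tau>\<close>, hence of \<open>\<tau>\<close> itself (\<open>truncation_determines_nbhd\<close>). Taking all positive elements for
  \<open>A\<close> gives \<open>unbounded\<close>; a suitable order dense ideal gives \<open>lebesgue\<close>. As the space is Archimedean,
  every order bounded increasing net is then \<open>\<tau>\<close>-Cauchy (\<open>upper_bound_minus_directed\<close>).

  Suppose the space is universally complete. A directed set of positive elements without upper bound
  exhausts, by truncation, all multiples of some \<open>v > 0\<close>, because otherwise disjoint pieces of a bound can
  be glued by lateral completeness; this cannot happen for a \<open>\<tau>\<close>-bounded set, so \<open>\<tau>\<close> is Levi
  (\<open>universally_complete_levi\<close>). Order intervals are \<open>\<tau>\<close>-complete by order completeness and the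
  Lebesgue property. So the truncations of a positive Cauchy net converge, their limits have a
  supremum because \<open>\<tau>\<close> is Levi, and this supremum is the limit of the net because \<open>\<tau>\<close> is unbounded
  (\<open>universally_complete_complete\<close>). As uo-convergence implies \<open>\<tau>\<close>-convergence and order intervals
  are \<open>\<tau>\<close>-closed, uo-Cauchy nets then converge in the uo-sense too.

  Conversely, each of the other properties implies the monotone completeness property: increasing
  Cauchy nets are \<open>\<tau>\<close>-bounded and uo-Cauchy, and if they have a supremum, it is their
  \<open>\<tau>\<close>-limit by the Lebesgue property. The monotone completeness property implies
  universal completeness since order bounded increasing nets and the finite sums of a disjoint
  positive set are both Cauchy.
\<close>

section \<open>Arithmetic in vector lattices\<close>

lemma isLub_UNIV_iff: "isLub UNIV S s \<longleftrightarrow> (\<forall>x\<in>S. x \<le> s) \<and> (\<forall>u. (\<forall>x\<in>S. x \<le> u) \<longrightarrow> s \<le> u)"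
  by (auto simp: isLub_def leastP_def isUb_def setle_def setge_def)

lemma isGlb_UNIV_iff: "isGlb UNIV S s \<longleftrightarrow> (\<forall>x\<in>S. s \<le> x) \<and> (\<forall>u. (\<forall>x\<in>S. u \<le> x) \<longrightarrow> u \<le> s)"
  by (auto simp: isGlb_def greatestP_def isLb_def setle_def setge_def)

lemma isUb_UNIV_iff: "isUb UNIV S s \<longleftrightarrow> (\<forall>x\<in>S. x \<le> s)"
  by (auto simp: isUb_def setle_def)

lemma isLub_upper: "isLub UNIV S s \<Longrightarrow> x \<in> S \<Longrightarrow> x \<le> s"
  and isLub_least: "isLub UNIV S s \<Longrightarrow> (\<And>x. x \<in> S \<Longrightarrow> x \<le> u) \<Longrightarrow> s \<le> u"
  unfolding isLub_UNIV_iff by blast+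

lemma isGlb_lower: "isGlb UNIV S s \<Longrightarrow> x \<in> S \<Longrightarrow> s \<le> x"
  and isGlb_greatest: "isGlb UNIV S s \<Longrightarrow> (\<And>x. x \<in> S \<Longrightarrow> u \<le> x) \<Longrightarrow> u \<le> s"
  unfolding isGlb_UNIV_iff by blast+

lemma order_completeD:
  fixes S :: "'a::vector_lattice set"
  assumes "order_complete TYPE('a)" "S \<noteq> {}" "\<And>x. x \<in> S \<Longrightarrow> x \<le> u"
  obtains s where "isLub UNIV S s"
proof -
  have "S \<noteq> {} \<and> (\<exists>u. isUb UNIV S u)" using assms(2,3) unfolding isUb_UNIV_iff by blast
  then show thesis using assms(1) that unfolding order_complete_def by meson
qed

lemma laterally_completeD:
  fixes S :: "'a::vector_lattice set"
  assumes "laterally_complete TYPE('a)" "S \<noteq> {}" "\<And>x. x \<in> S \<Longrightarrow> 0 \<le> x"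
    "pairwise (\<lambda>x y. inf x y = 0) S"
  obtains s where "isLub UNIV S s"
proof -
  have "S \<noteq> {} \<and> (\<forall>x\<in>S. 0 \<le> x) \<and> pairwise (\<lambda>x y. inf x y = 0) S" using assms(2-4) by blast
  then show thesis using assms(1) that unfolding laterally_complete_def by meson
qed

lemma order_complete_glb:
  fixes S :: "'a::vector_lattice set"
  assumes oc: "order_complete TYPE('a)" and S: "S \<noteq> {}" "\<And>x. x \<in> S \<Longrightarrow> l \<le> x"
  obtains s where "isGlb UNIV S s"
proof -
  define L where "L = {w. \<forall>x\<in>S. w \<le> x}"
  obtain y where y: "y \<in> S" using S(1) by blast
  obtain s where s: "isLub UNIV L s"
    by (rule order_completeD[OF oc, of L y]) (use S(2) y in \<open>auto simp: L_def\<close>)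
  have "s \<le> x" if "x \<in> S" for x
    by (rule isLub_least[OF s]) (use that in \<open>auto simp: L_def\<close>)
  moreover have "w \<le> s" if "\<forall>x\<in>S. w \<le> x" for w
    by (rule isLub_upper[OF s]) (use that in \<open>auto simp: L_def\<close>)
  ultimately have "isGlb UNIV S s" unfolding isGlb_UNIV_iff by blast
  then show thesis by (rule that)
qed

lemma inf_add_le:
  fixes a b z :: "'a::vector_lattice"
  assumes "0 \<le> a" "0 \<le> b" "0 \<le> z"
  shows "inf (a + b) z \<le> inf a z + inf b z"
proof -
  have "inf a z + inf b z = inf (inf (a + b) (a + z)) (inf (z + b) (z + z))"
    by (simp add: add_inf_distrib_left add_inf_distrib_right inf_aci)
  moreover have "z \<le> a + z" "z \<le> z + b" "z \<le> z + z" using assms by auto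
  ultimately show ?thesis
    by (auto intro: le_infI1 le_infI2 order_trans[of "inf (a + b) z" z])
qed

lemma inf_scaleR_eq_0:
  fixes a z :: "'a::vector_lattice"
  assumes "0 \<le> a" "0 \<le> z" "inf a z = 0" "0 \<le> c"
  shows "inf (c *\<^sub>R a) z = 0"
proof -
  have *: "inf (real n *\<^sub>R a) z = 0" for n
  proof (induction n)
    case 0
    then show ?case using assms by (simp add: inf_absorb1)
  next
    case (Suc n)
    have nn: "0 \<le> real n *\<^sub>R a" using assms by (simp add: scaleR_nonneg_nonneg)
    have "inf (real (Suc n) *\<^sub>R a) z = inf (real n *\<^sub>R a + a) z"
      by (simp add: scaleR_left_distrib add.commute)
    also have "\<dots> \<le> 0" using inf_add_le[OF nn assms(1,2)] Suc assms by simp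
    finally show ?case using nn assms by (intro order.antisym) (auto simp: scaleR_nonneg_nonneg)
  qed
  obtain n where "c \<le> real n" using real_arch_simple by blast
  then have "c *\<^sub>R a \<le> real n *\<^sub>R a" using assms by (simp add: scaleR_right_mono)
  then have "inf (c *\<^sub>R a) z \<le> inf (real n *\<^sub>R a) z" by (meson inf_mono order_refl)
  then show ?thesis using * assms by (intro order.antisym) (auto simp: scaleR_nonneg_nonneg)
qed

lemma inf_mono_eq_0:
  fixes a b c d :: "'a::vector_lattice"
  assumes "inf c d = 0" "0 \<le> a" "a \<le> c" "0 \<le> b" "b \<le> d"
  shows "inf a b = 0"
  using inf_mono[OF assms(3,5)] assms by (intro order.antisym) auto

lemma le_pprt: "(a::'a::vector_lattice) \<le> pprt a"
  by (simp add: pprt_def)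

lemma pprt_le_iff: "pprt (a::'a::vector_lattice) \<le> b \<longleftrightarrow> a \<le> b \<and> 0 \<le> b"
  by (simp add: pprt_def)

lemma pprt_diff: "pprt (x - y) = (x::'a::vector_lattice) - inf x y"
  by (simp add: pprt_def diff_inf_eq_sup add_sup_distrib_left sup_commute)

lemma inf_pprt_diff_eq_0: "inf (pprt (x - y)) (pprt (y - x)) = (0::'a::vector_lattice)"
proof -
  have "inf (pprt (x - y)) (pprt (y - x)) = inf (x - inf x y) (y - inf x y)"
    unfolding pprt_diff[of x y] pprt_diff[of y x] inf_commute[of y x] by (rule refl)
  also have "\<dots> = 0"
    unfolding diff_conv_add_uminus add_inf_distrib_right[symmetric] by (rule right_minus)
  finally show ?thesis .
qed

lemma abs_le_iff_lattice: "\<bar>a\<bar> \<le> b \<longleftrightarrow> a \<le> b \<and> - a \<le> (b::'a::vector_lattice)"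
  by (simp add: abs_lattice)

lemma isLub_inf:
  fixes s u :: "'a::vector_lattice"
  assumes "isLub UNIV E s"
  shows "isLub UNIV ((\<lambda>e. inf e u) ` E) (inf s u)"
  unfolding isLub_UNIV_iff
proof (intro conjI allI impI ballI)
  have s: "\<And>e. e \<in> E \<Longrightarrow> e \<le> s" "\<And>t. (\<And>e. e \<in> E \<Longrightarrow> e \<le> t) \<Longrightarrow> s \<le> t"
    using assms by (auto simp: isLub_UNIV_iff)
  show "x \<le> inf s u" if "x \<in> (\<lambda>e. inf e u) ` E" for x
    using that s(1) by (auto intro: le_infI1)
  fix t assume t: "\<forall>x\<in>(\<lambda>e. inf e u) ` E. x \<le> t"
  have "e \<le> t + sup s u - u" if "e \<in> E" for e
  proof -
    have "e + u = sup e u + inf e u" by (rule add_eq_inf_sup)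
    also have "\<dots> \<le> sup s u + t"
      using that s(1) t by (intro add_mono sup_mono) auto
    finally show ?thesis by (simp add: algebra_simps le_diff_eq)
  qed
  then have "s \<le> t + sup s u - u" by (rule s(2))
  moreover have "s + u = sup s u + inf s u" by (rule add_eq_inf_sup)
  ultimately have "sup s u + inf s u \<le> sup s u + t" by (simp add: algebra_simps le_diff_eq)
  then show "inf s u \<le> t" by simp
qed

lemma inf_sup_distrib_lattice: "inf (sup a b) u = sup (inf a u) (inf (b::'a::vector_lattice) u)"
proof -
  have "isLub UNIV {a, b} (sup a b)" by (auto simp: isLub_UNIV_iff)
  from isLub_inf[OF this, of u] have "inf (sup a b) u \<le> sup (inf a u) (inf b u)"
    unfolding isLub_UNIV_iff by auto
  then show ?thesis by (intro order.antisym) (auto intro: le_infI1)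
qed

text \<open>Truncating \<open>x\<close> at the level \<open>z + u\<close> loses no information about \<open>\<bar>x - z\<bar>\<close> below \<open>u\<close>.\<close>

lemma inf_abs_le:
  fixes x z u :: "'a::vector_lattice"
  assumes "0 \<le> u"
  shows "inf \<bar>x - z\<bar> u \<le> \<bar>inf x (z + u) - z\<bar>"
proof -
  have e: "inf x (z + u) - z = inf (x - z) u"
    unfolding diff_conv_add_uminus add_inf_distrib_right by simp
  have "inf (- (x - z)) u \<le> - inf (x - z) u" by (meson inf_le1 le_infI1 neg_le_iff_le order_trans)
  then show ?thesis
    unfolding e abs_lattice inf_sup_distrib_lattice by (meson sup_mono order_refl)
qed

lemma abs_inf_diff_le: "\<bar>inf x u - inf y u\<bar> \<le> \<bar>x - (y::'a::vector_lattice)\<bar>"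
proof -
  have *: "inf x u - inf y u \<le> \<bar>x - y\<bar>" for x y :: 'a
  proof -
    have "inf x u \<le> y + \<bar>x - y\<bar>" using abs_ge_self[of "x - y"]
      by (metis add.commute diff_le_eq inf.coboundedI1)
    moreover have "inf x u \<le> u + \<bar>x - y\<bar>"
      by (metis abs_ge_zero add_increasing2 inf.cobounded2)
    ultimately have "inf x u \<le> inf y u + \<bar>x - y\<bar>" by (simp add: add_inf_distrib_right)
    then show ?thesis by (metis add.commute diff_le_eq)
  qed
  have "- (inf x u - inf y u) \<le> \<bar>x - y\<bar>"
    using *[of y x] unfolding minus_diff_eq abs_minus_commute[of x y] .
  then show ?thesis using *[of x y] unfolding abs_le_iff_lattice by blast
qed

lemma abs_diff_inf_le: "\<bar>x - inf y z\<bar> \<le> \<bar>x - y\<bar> + \<bar>x - (z::'a::vector_lattice)\<bar>"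
proof -
  have "x - inf y z = sup (x - y) (x - z)"
    by (simp add: diff_inf_eq_sup add_sup_distrib_left)
  also have "\<dots> \<le> \<bar>x - y\<bar> + \<bar>x - z\<bar>"
    by (simp add: add_increasing2 add_increasing abs_ge_self abs_ge_minus_self)
  finally have 1: "x - inf y z \<le> \<bar>x - y\<bar> + \<bar>x - z\<bar>" .
  have "inf y z - x \<le> y - x" by simp
  also have "\<dots> \<le> \<bar>x - y\<bar> + \<bar>x - z\<bar>"
    using abs_ge_minus_self[of "x - y"] by (simp add: add_increasing2)
  finally show ?thesis using 1 by (simp add: abs_le_iff_lattice)
qed

text \<open>The hypothesis at \<open>n = 0\<close> forces \<open>0 \<le> w\<close>, so no sign condition is needed.\<close>

lemma archimedean_le_0:
  fixes h w :: "'a::vector_lattice"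
  assumes "archimedean_lattice TYPE('a)" and "\<And>n::nat. real n *\<^sub>R h \<le> w"
  shows "h \<le> 0"
proof -
  have "0 \<le> w" using assms(2)[of 0] by simp
  then have "isGlb UNIV (range (\<lambda>n::nat. (1 / real (Suc n)) *\<^sub>R w)) 0"
    using assms(1) by (auto simp: archimedean_lattice_def)
  moreover have "h \<le> (1 / real (Suc n)) *\<^sub>R w" for n
    using scaleR_left_mono[OF assms(2)[of "Suc n"], of "1 / real (Suc n)"] by simp
  ultimately show ?thesis by (auto simp: isGlb_UNIV_iff)
qed

lemma pprt_diff_abs_le: "\<bar>pprt x - pprt y\<bar> \<le> \<bar>x - (y::'a::vector_lattice)\<bar>"
proof -
  have *: "pprt x - pprt y \<le> \<bar>x - y\<bar>" for x y :: 'a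
  proof -
    have "x - y + y \<le> \<bar>x - y\<bar> + pprt y" by (intro add_mono abs_ge_self le_pprt)
    then have "pprt x \<le> \<bar>x - y\<bar> + pprt y" by (simp add: pprt_le_iff add_nonneg_nonneg)
    then show ?thesis by (simp add: diff_le_eq)
  qed
  have "- (pprt x - pprt y) \<le> \<bar>x - y\<bar>"
    using *[of y x] unfolding minus_diff_eq abs_minus_commute[of x y] .
  then show ?thesis using *[of x y] unfolding abs_le_iff_lattice by blast
qed

lemma pprt_minus_pprt: "pprt x - pprt (- x) = (x::'a::vector_lattice)"
  using prts[of x] by (simp add: pprt_neg)

text \<open>On the part of the space where \<open>y\<close> exceeds \<open>n *\<^sub>R u\<close>, the element \<open>u\<close> lies below \<open>y\<close> divided by
  \<open>n\<close>; off that part the left-hand side vanishes.\<close>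

lemma truncation_excess_le:
  fixes u y :: "'a::vector_lattice"
  assumes "0 \<le> u" "0 \<le> y" "0 < n"
  shows "inf (pprt (y - real n *\<^sub>R u)) u \<le> (1 / real n) *\<^sub>R y"
proof -
  define p where "p = inf (pprt (y - real n *\<^sub>R u)) u"
  have p0: "0 \<le> p" using assms(1) by (simp add: p_def)
  have n: "real n *\<^sub>R p \<le> real n *\<^sub>R u" by (intro scaleR_left_mono) (auto simp: p_def)
  have dis: "inf (real n *\<^sub>R pprt (y - real n *\<^sub>R u)) (pprt (real n *\<^sub>R u - y)) = 0"
    by (intro inf_scaleR_eq_0 inf_pprt_diff_eq_0) auto
  have "pprt (real n *\<^sub>R p - y) \<le> real n *\<^sub>R p"
    using p0 assms(2) by (simp add: pprt_le_iff scaleR_nonneg_nonneg)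
  also have "\<dots> \<le> real n *\<^sub>R pprt (y - real n *\<^sub>R u)"
    by (intro scaleR_left_mono) (auto simp: p_def)
  finally have "pprt (real n *\<^sub>R p - y) \<le> 0"
    using n dis by (metis diff_right_mono le_inf_iff pprt_mono)
  then have "real n *\<^sub>R p \<le> y" using order_trans[OF le_pprt] by fastforce
  then have "(1 / real n) *\<^sub>R (real n *\<^sub>R p) \<le> (1 / real n) *\<^sub>R y"
    by (intro scaleR_left_mono) auto
  then show ?thesis using assms(3) by (simp add: p_def)
qed

lemma inf_sum_eq_0:
  fixes f :: "'b \<Rightarrow> 'a::vector_lattice"
  assumes "finite T" "0 \<le> z" "\<And>t. t \<in> T \<Longrightarrow> 0 \<le> f t" "\<And>t. t \<in> T \<Longrightarrow> inf (f t) z = 0"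
  shows "inf (sum f T) z = 0"
  using assms
proof (induction T rule: finite_induct)
  case empty
  then show ?case by (simp add: inf_absorb1)
next
  case (insert t T)
  have "0 \<le> sum f T" by (rule sum_nonneg) (use insert.prems in auto)
  then have "inf (f t + sum f T) z \<le> inf (f t) z + inf (sum f T) z"
    using insert.prems by (intro inf_add_le) auto
  also have "\<dots> = 0" using insert by simp
  finally show ?case
    using insert \<open>0 \<le> sum f T\<close> by (intro order.antisym) auto
qed

lemma sum_disjoint_le:
  fixes T :: "'a::vector_lattice set"
  assumes "finite T" "pairwise (\<lambda>x y. inf x y = 0) T" "\<And>t. t \<in> T \<Longrightarrow> 0 \<le> t"
    "\<And>t. t \<in> T \<Longrightarrow> t \<le> w" "0 \<le> w"
  shows "\<Sum>T \<le> w"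
  using assms
proof (induction T rule: finite_induct)
  case (insert t T)
  have "inf (\<Sum>T) t = 0"
    using insert.prems insert.hyps
    by (intro inf_sum_eq_0) (auto simp: pairwise_insert inf_commute)
  then have "\<Sum>T + t = sup (\<Sum>T) t" using add_eq_inf_sup[of "\<Sum>T" t] by simp
  moreover have "\<Sum>T \<le> w" using insert by (simp add: pairwise_insert)
  moreover have "t \<le> w" using insert.prems by simp
  ultimately show ?case using insert.hyps by (simp add: add.commute)
qed simp

section \<open>Directed index sets\<close>

lemma tails_not_bot: "directed_set A r \<Longrightarrow> tails A r \<noteq> bot"
  unfolding trivial_limit_def
  by (subst eventually_tails) (auto simp: directed_set_def reflp_on_def)

lemma directed_refl: "directed_set A r \<Longrightarrow> a \<in> A \<Longrightarrow> r a a"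
  by (simp add: directed_set_def reflp_on_def)

lemma directed_trans:
  "directed_set A r \<Longrightarrow> r a b \<Longrightarrow> r b c \<Longrightarrow> a \<in> A \<Longrightarrow> b \<in> A \<Longrightarrow> c \<in> A \<Longrightarrow> r a c"
  unfolding directed_set_def transp_on_def by blast

lemma directed_upper:
  assumes "directed_set A r" "a \<in> A" "b \<in> A"
  obtains c where "c \<in> A" "r a c" "r b c"
  using assms unfolding directed_set_def by blast

lemma increasing_net_range_directed:
  assumes A: "directed_set A r" and x: "increasing_net A r x"
    and de: "d \<in> x ` A" "e \<in> x ` A"
  shows "\<exists>f\<in>x ` A. d \<le> f \<and> e \<le> f"
proof -
  obtain a where a: "a \<in> A" "d = x a" using de(1) by blast
  obtain b where b: "b \<in> A" "e = x b" using de(2) by blast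
  obtain c where c: "c \<in> A" "r a c" "r b c" using directed_upper[OF A a(1) b(1)] by blast
  then have "d \<le> x c" "e \<le> x c" using a b x by (auto simp: increasing_net_def)
  then show ?thesis using c(1) by blast
qed

section \<open>Locally solid topologies and their neighbourhoods of zero\<close>

text \<open>A family of solid sets that can serve as a base at zero of a locally solid topology.\<close>

definition solid_base :: "'a::vector_lattice set set \<Rightarrow> bool" where
  "solid_base B \<longleftrightarrow> B \<noteq> {} \<and> (\<forall>V\<in>B. solid V \<and> 0 \<in> V) \<and>
     (\<forall>V\<in>B. \<forall>W\<in>B. \<exists>Z\<in>B. Z \<subseteq> V \<inter> W) \<and>
     (\<forall>V\<in>B. \<exists>W\<in>B. \<forall>x\<in>W. \<forall>y\<in>W. x + y \<in> V) \<and>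
     (\<forall>V\<in>B. \<forall>x. \<exists>c>0. c *\<^sub>R x \<in> V)"

text \<open>The translation-invariant topology with base \<open>B\<close> at zero, described by its open sets.\<close>

definition base_topology :: "'a::vector_lattice set set \<Rightarrow> 'a topology" where
  "base_topology B = topology (\<lambda>U. \<forall>x\<in>U. \<exists>V\<in>B. \<forall>v\<in>V. x + v \<in> U)"

text \<open>The solid neighbourhoods of zero, which need not be open.\<close>

definition solid_nbhds :: "'a::vector_lattice topology \<Rightarrow> 'a set set" where
  "solid_nbhds \<tau> = {V. solid V \<and> (\<exists>U. openin \<tau> U \<and> 0 \<in> U \<and> U \<subseteq> V)}"

lemma solidD: "solid S \<Longrightarrow> \<bar>x\<bar> \<le> \<bar>y\<bar> \<Longrightarrow> y \<in> S \<Longrightarrow> x \<in> S"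
  by (auto simp: solid_def)

lemma solid_leD: "solid S \<Longrightarrow> 0 \<le> x \<Longrightarrow> x \<le> y \<Longrightarrow> y \<in> S \<Longrightarrow> x \<in> S"
  by (erule solidD[of _ _ y]) (auto simp: order_trans)

lemma solid_abs_leD: "solid S \<Longrightarrow> \<bar>x\<bar> \<le> y \<Longrightarrow> y \<in> S \<Longrightarrow> x \<in> S"
  by (erule solidD[of _ _ y]) (auto intro: order_trans[OF _ abs_ge_self])

lemma solid_abs_iff: "solid S \<Longrightarrow> \<bar>x\<bar> \<in> S \<longleftrightarrow> x \<in> S"
  using solidD[of S x "\<bar>x\<bar>"] solidD[of S "\<bar>x\<bar>" x] by auto

lemma abs_scaleR_le:
  fixes x :: "'a::vector_lattice"
  assumes "\<bar>c\<bar> \<le> d"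
  shows "\<bar>c *\<^sub>R x\<bar> \<le> \<bar>d *\<^sub>R x\<bar>"
proof -
  have d: "0 \<le> d" using assms by linarith
  have 1: "c *\<^sub>R x \<le> \<bar>c\<bar> *\<^sub>R \<bar>x\<bar>" for c :: real
  proof (cases "0 \<le> c")
    case True
    then show ?thesis by (simp add: scaleR_left_mono abs_ge_self abs_ge_minus_self)
  next
    case False
    then have "(- c) *\<^sub>R (- x) \<le> (- c) *\<^sub>R \<bar>x\<bar>"
      by (intro scaleR_left_mono) (auto simp: abs_ge_self abs_ge_minus_self)
    then show ?thesis using False by simp
  qed
  have "\<bar>c *\<^sub>R x\<bar> \<le> \<bar>c\<bar> *\<^sub>R \<bar>x\<bar>"
    using 1[of c] 1[of "- c"] by (simp add: abs_le_iff_lattice)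
  also have "\<dots> \<le> d *\<^sub>R \<bar>x\<bar>" using assms by (simp add: scaleR_right_mono)
  also have "\<bar>x\<bar> \<le> (1 / d) *\<^sub>R \<bar>d *\<^sub>R x\<bar>" if "d > 0"
  proof -
    have "(1 / d) *\<^sub>R (d *\<^sub>R x) \<le> (1 / d) *\<^sub>R \<bar>d *\<^sub>R x\<bar>"
      "(1 / d) *\<^sub>R (- (d *\<^sub>R x)) \<le> (1 / d) *\<^sub>R \<bar>d *\<^sub>R x\<bar>"
      using that by (intro scaleR_left_mono abs_ge_self abs_ge_minus_self; simp)+
    then show ?thesis using that by (simp add: abs_le_iff_lattice)
  qed
  then have "d *\<^sub>R \<bar>x\<bar> \<le> \<bar>d *\<^sub>R x\<bar>"
    using scaleR_left_mono[of "\<bar>x\<bar>" "(1 / d) *\<^sub>R \<bar>d *\<^sub>R x\<bar>" d] d by (cases "d = 0") auto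
  finally show ?thesis .
qed

lemma solid_scaleR: "solid S \<Longrightarrow> \<bar>c\<bar> \<le> d \<Longrightarrow> d *\<^sub>R x \<in> S \<Longrightarrow> c *\<^sub>R x \<in> S"
  by (erule solidD[OF _ abs_scaleR_le])

lemma solid_base_scale:
  assumes "solid_base B" "V \<in> B"
  obtains W where "W \<in> B" "\<And>x c. x \<in> W \<Longrightarrow> \<bar>c\<bar> \<le> k \<Longrightarrow> c *\<^sub>R x \<in> V"
proof -
  have *: "\<exists>W\<in>B. \<forall>x\<in>W. real n *\<^sub>R x \<in> V" for n
  proof -
    have "\<exists>W\<in>B. \<forall>x\<in>W. real (2 ^ m) *\<^sub>R x \<in> V" for m
    proof (induction m)
      case 0
      then show ?case using assms by auto
    next
      case (Suc m)
      then obtain W where W: "W \<in> B" "\<forall>x\<in>W. real (2 ^ m) *\<^sub>R x \<in> V" by blast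
      obtain Z where Z: "Z \<in> B" "\<forall>x\<in>Z. \<forall>y\<in>Z. x + y \<in> W"
        using assms(1) W(1) unfolding solid_base_def by meson
      have "real (2 ^ Suc m) *\<^sub>R x = real (2 ^ m) *\<^sub>R (x + x)" for x :: 'a
        by (simp add: scaleR_2[symmetric])
      then show ?case using W Z by (intro bexI[of _ Z]) auto
    qed
    from this[of n] obtain W where W: "W \<in> B" "\<forall>x\<in>W. real (2 ^ n) *\<^sub>R x \<in> V" by blast
    have "real n *\<^sub>R x \<in> V" if "x \<in> W" for x
      using assms W that unfolding solid_base_def
      by (intro solid_scaleR[of V "real n" "real (2 ^ n)" x]) (auto simp: less_imp_le)
    then show ?thesis using W(1) by blast
  qed
  obtain n where n: "k \<le> real n" using real_arch_simple by blast
  obtain W where W: "W \<in> B" "\<forall>x\<in>W. real n *\<^sub>R x \<in> V" using * by blast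
  have "c *\<^sub>R x \<in> V" if "x \<in> W" "\<bar>c\<bar> \<le> k" for c x
    using assms W that n unfolding solid_base_def
    by (intro solid_scaleR[of V c "real n" x]) auto
  then show thesis using W(1) that by blast
qed

context
  fixes B :: "'a::vector_lattice set set"
  assumes B: "solid_base B"
begin

lemma openin_base_topology:
  "openin (base_topology B) U \<longleftrightarrow> (\<forall>x\<in>U. \<exists>V\<in>B. \<forall>v\<in>V. x + v \<in> U)"
proof -
  have "istopology (\<lambda>U. \<forall>x\<in>U. \<exists>V\<in>B. \<forall>v\<in>V. x + v \<in> U)"
    unfolding istopology_def
  proof (intro conjI allI impI ballI)
    fix S T :: "'a set" and x
    assume *: "\<forall>x\<in>S. \<exists>V\<in>B. \<forall>v\<in>V. x + v \<in> S" "\<forall>x\<in>T. \<exists>V\<in>B. \<forall>v\<in>V. x + v \<in> T"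
      "x \<in> S \<inter> T"
    then obtain V W where "V \<in> B" "\<forall>v\<in>V. x + v \<in> S" "W \<in> B" "\<forall>v\<in>W. x + v \<in> T" by blast
    moreover obtain Z where "Z \<in> B" "Z \<subseteq> V \<inter> W"
      using B \<open>V \<in> B\<close> \<open>W \<in> B\<close> unfolding solid_base_def by meson
    ultimately show "\<exists>V\<in>B. \<forall>v\<in>V. x + v \<in> S \<inter> T" by blast
  next
    fix \<K> :: "'a set set" and x
    assume "\<forall>K\<in>\<K>. \<forall>x\<in>K. \<exists>V\<in>B. \<forall>v\<in>V. x + v \<in> K" "x \<in> \<Union>\<K>"
    then show "\<exists>V\<in>B. \<forall>v\<in>V. x + v \<in> \<Union>\<K>" by (meson UnionE UnionI)
  qed
  then show ?thesis by (simp add: base_topology_def)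
qed

lemma topspace_base_topology: "topspace (base_topology B) = UNIV"
proof -
  have "openin (base_topology B) UNIV"
    using B unfolding openin_base_topology solid_base_def by blast
  then show ?thesis using openin_subset by blast
qed

lemma base_topology_nbhd:
  assumes "V \<in> B"
  obtains U where "openin (base_topology B) U" "x \<in> U" "\<And>y. y \<in> U \<Longrightarrow> y - x \<in> V"
proof -
  define U where "U = {y. \<exists>W\<in>B. \<forall>w\<in>W. y - x + w \<in> V}"
  have "\<exists>Z\<in>B. \<forall>z\<in>Z. y + z \<in> U" if "y \<in> U" for y
  proof -
    obtain W where W: "W \<in> B" "\<forall>w\<in>W. y - x + w \<in> V" using \<open>y \<in> U\<close> by (auto simp: U_def)
    obtain Z where Z: "Z \<in> B" "\<forall>a\<in>Z. \<forall>b\<in>Z. a + b \<in> W"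
      using B W(1) unfolding solid_base_def by meson
    have "y + z \<in> U" if "z \<in> Z" for z
    proof -
      have "y + z - x + w \<in> V" if "w \<in> Z" for w
      proof -
        have "y - x + (z + w) \<in> V" using W(2) Z(2) \<open>z \<in> Z\<close> that by blast
        then show ?thesis by (simp add: algebra_simps)
      qed
      then show ?thesis using Z(1) by (auto simp: U_def)
    qed
    then show ?thesis using Z(1) by blast
  qed
  then have "openin (base_topology B) U" by (auto simp: openin_base_topology)
  moreover have "x \<in> U" using assms by (auto simp: U_def)
  moreover have "y - x \<in> V" if "y \<in> U" for y
  proof -
    obtain W where "W \<in> B" "\<forall>w\<in>W. y - x + w \<in> V" using \<open>y \<in> U\<close> by (auto simp: U_def)
    moreover have "0 \<in> W" using B \<open>W \<in> B\<close> by (auto simp: solid_base_def)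
    ultimately show ?thesis by (metis add_0_right)
  qed
  ultimately show thesis using that by blast
qed

lemma linear_topology_base_topology: "linear_topology (base_topology B)"
  unfolding linear_topology_def
proof (intro conjI)
  let ?\<tau> = "base_topology B"
  show "topspace ?\<tau> = UNIV" by (rule topspace_base_topology)
  show "continuous_map (prod_topology ?\<tau> ?\<tau>) ?\<tau> (\<lambda>(x, y). x + y)"
    unfolding continuous_map_def
  proof (intro conjI allI impI)
    fix U assume U: "openin ?\<tau> U"
    show "openin (prod_topology ?\<tau> ?\<tau>)
        {p \<in> topspace (prod_topology ?\<tau> ?\<tau>). (case p of (x, y) \<Rightarrow> x + y) \<in> U}"
      unfolding openin_prod_topology_alt
    proof (intro allI impI)
      fix x y
      assume "(x, y) \<in> {p \<in> topspace (prod_topology ?\<tau> ?\<tau>). (case p of (x, y) \<Rightarrow> x + y) \<in> U}"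
      then have "x + y \<in> U" by simp
      then obtain V where V: "V \<in> B" "\<forall>v\<in>V. x + y + v \<in> U"
        using U by (auto simp: openin_base_topology)
      obtain W where W: "W \<in> B" "\<forall>a\<in>W. \<forall>b\<in>W. a + b \<in> V"
        using B V(1) unfolding solid_base_def by meson
      obtain P Q where P: "openin ?\<tau> P" "x \<in> P" "\<And>z. z \<in> P \<Longrightarrow> z - x \<in> W"
        and Q: "openin ?\<tau> Q" "y \<in> Q" "\<And>z. z \<in> Q \<Longrightarrow> z - y \<in> W"
        using base_topology_nbhd[OF W(1), of x] base_topology_nbhd[OF W(1), of y] by metis
      have "p + q \<in> U" if "p \<in> P" "q \<in> Q" for p q
      proof -
        have "x + y + ((p - x) + (q - y)) \<in> U" using that P(3) Q(3) V(2) W(2) by blast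
        then show ?thesis by simp
      qed
      then show "\<exists>P Q. openin ?\<tau> P \<and> openin ?\<tau> Q \<and> x \<in> P \<and> y \<in> Q \<and>
          P \<times> Q \<subseteq> {p \<in> topspace (prod_topology ?\<tau> ?\<tau>). (case p of (x, y) \<Rightarrow> x + y) \<in> U}"
        using P(1,2) Q(1,2)
        by (intro exI[of _ P] exI[of _ Q]) (auto simp: topspace_base_topology)
    qed
  qed (simp add: topspace_base_topology)
  show "continuous_map (prod_topology euclideanreal ?\<tau>) ?\<tau> (\<lambda>(c, x). c *\<^sub>R x)"
    unfolding continuous_map_def
  proof (intro conjI allI impI)
    fix U assume U: "openin ?\<tau> U"
    show "openin (prod_topology euclideanreal ?\<tau>)
        {p \<in> topspace (prod_topology euclideanreal ?\<tau>). (case p of (c, x) \<Rightarrow> c *\<^sub>R x) \<in> U}"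
      unfolding openin_prod_topology_alt
    proof (intro allI impI)
      fix c x
      assume "(c, x) \<in> {p \<in> topspace (prod_topology euclideanreal ?\<tau>).
        (case p of (c, x) \<Rightarrow> c *\<^sub>R x) \<in> U}"
      then have "c *\<^sub>R x \<in> U" by simp
      then obtain V where V: "V \<in> B" "\<forall>v\<in>V. c *\<^sub>R x + v \<in> U"
        using U by (auto simp: openin_base_topology)
      obtain W where W: "W \<in> B" "\<forall>a\<in>W. \<forall>b\<in>W. a + b \<in> V"
        using B V(1) unfolding solid_base_def by meson
      obtain Z where Z: "Z \<in> B" "\<And>z d. z \<in> Z \<Longrightarrow> \<bar>d\<bar> \<le> \<bar>c\<bar> + 1 \<Longrightarrow> d *\<^sub>R z \<in> W"
        using solid_base_scale[OF B W(1)] by blast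
      obtain e where e: "e > 0" "e *\<^sub>R x \<in> W"
        using B W(1) unfolding solid_base_def by meson
      obtain Q where Q: "openin ?\<tau> Q" "x \<in> Q" "\<And>z. z \<in> Q \<Longrightarrow> z - x \<in> Z"
        using base_topology_nbhd[OF Z(1), of x] by metis
      have "d *\<^sub>R z \<in> U" if "d \<in> ball c (min e 1)" "z \<in> Q" for d z
      proof -
        have "\<bar>d - c\<bar> < e" "\<bar>d - c\<bar> < 1" using that(1) by (auto simp: dist_real_def)
        then have "(d - c) *\<^sub>R x \<in> W" "d *\<^sub>R (z - x) \<in> W"
          using e W(1) B Q(3)[OF that(2)] Z(2)[of "z - x" d]
          by (auto simp: solid_base_def intro!: solid_scaleR[of W "d - c" e x])
        then have "c *\<^sub>R x + ((d - c) *\<^sub>R x + d *\<^sub>R (z - x)) \<in> U" using V(2) W(2) by blast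
        then show ?thesis by (simp add: algebra_simps)
      qed
      then show "\<exists>P Q. openin euclideanreal P \<and> openin ?\<tau> Q \<and> c \<in> P \<and> x \<in> Q \<and>
          P \<times> Q \<subseteq> {p \<in> topspace (prod_topology euclideanreal ?\<tau>).
            (case p of (c, x) \<Rightarrow> c *\<^sub>R x) \<in> U}"
        using Q(1,2) e(1)
        by (intro exI[of _ "ball c (min e 1)"] exI[of _ Q]) (auto simp: topspace_base_topology)
    qed
  qed (simp add: topspace_base_topology)
qed

lemma locally_solid_base_topology: "locally_solid (base_topology B)"
  unfolding locally_solid_def neighbourhood_base_at_def
proof (intro conjI allI impI linear_topology_base_topology)
  fix U assume "openin (base_topology B) U \<and> 0 \<in> U"
  then obtain V where V: "V \<in> B" "\<forall>v\<in>V. v \<in> U"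
    by (auto simp: openin_base_topology)
  obtain P where P: "openin (base_topology B) P" "0 \<in> P" "\<And>y. y \<in> P \<Longrightarrow> y - 0 \<in> V"
    using base_topology_nbhd[OF V(1)] by metis
  show "\<exists>P V. openin (base_topology B) P \<and> solid V \<and> 0 \<in> P \<and> P \<subseteq> V \<and> V \<subseteq> U"
    using V P B by (intro exI[of _ P] exI[of _ V]) (auto simp: solid_base_def)
qed

lemma Hausdorff_base_topology:
  assumes "\<And>x. (\<And>V. V \<in> B \<Longrightarrow> x \<in> V) \<Longrightarrow> x = 0"
  shows "Hausdorff_space (base_topology B)"
  unfolding Hausdorff_space_def
proof (intro allI impI)
  fix x y assume "x \<in> topspace (base_topology B) \<and> y \<in> topspace (base_topology B) \<and> x \<noteq> y"
  then have "x - y \<noteq> 0" by simp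
  then obtain V where V: "V \<in> B" "x - y \<notin> V" using assms by blast
  obtain W where W: "W \<in> B" "\<forall>a\<in>W. \<forall>b\<in>W. a + b \<in> V"
    using B V(1) unfolding solid_base_def by meson
  have neg: "- a \<in> W" if "a \<in> W" for a
    using that B W(1) by (auto simp: solid_base_def intro: solidD[of W "- a" a])
  obtain P Q where P: "openin (base_topology B) P" "x \<in> P" "\<And>z. z \<in> P \<Longrightarrow> z - x \<in> W"
    and Q: "openin (base_topology B) Q" "y \<in> Q" "\<And>z. z \<in> Q \<Longrightarrow> z - y \<in> W"
    using base_topology_nbhd[OF W(1), of x] base_topology_nbhd[OF W(1), of y] by metis
  have "disjnt P Q"
  proof (rule ccontr)
    assume "\<not> disjnt P Q"
    then obtain z where "z \<in> P" "z \<in> Q" by (auto simp: disjnt_def)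
    then have "- (z - x) + (z - y) \<in> V" using P(3) Q(3) W(2) neg by blast
    then show False using V(2) by simp
  qed
  then show "\<exists>P Q. openin (base_topology B) P \<and> openin (base_topology B) Q \<and> x \<in> P \<and> y \<in> Q \<and>
      disjnt P Q"
    using P(1,2) Q(1,2) by blast
qed

end

lemma solid_nbhds_Int:
  assumes "V \<in> solid_nbhds \<tau>" "W \<in> solid_nbhds \<tau>"
  shows "V \<inter> W \<in> solid_nbhds \<tau>"
proof -
  obtain P Q where "openin \<tau> P" "0 \<in> P" "P \<subseteq> V" "openin \<tau> Q" "0 \<in> Q" "Q \<subseteq> W"
    using assms by (auto simp: solid_nbhds_def)
  then have "openin \<tau> (P \<inter> Q) \<and> 0 \<in> P \<inter> Q \<and> P \<inter> Q \<subseteq> V \<inter> W" by auto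
  then show ?thesis using assms unfolding solid_nbhds_def solid_def by blast
qed

context
  fixes \<tau> :: "'a::vector_lattice topology"
  assumes \<tau>: "locally_solid \<tau>"
begin

lemma topspace_locally_solid: "topspace \<tau> = UNIV"
  using \<tau> by (simp add: locally_solid_def linear_topology_def)

lemma openin_translate:
  assumes "openin \<tau> U"
  shows "openin \<tau> {y. x + y \<in> U}"
proof -
  have "continuous_map \<tau> (prod_topology \<tau> \<tau>) (\<lambda>y. (x, y))"
    by (intro continuous_map_pairedI) (auto simp: topspace_locally_solid)
  moreover have "continuous_map (prod_topology \<tau> \<tau>) \<tau> (\<lambda>(x, y). x + y)"
    using \<tau> by (simp add: locally_solid_def linear_topology_def)
  ultimately have "continuous_map \<tau> \<tau> (\<lambda>y. x + y)"
    using continuous_map_compose[of \<tau> "prod_topology \<tau> \<tau>" "\<lambda>y. (x, y)" \<tau> "\<lambda>(x, y). x + y"]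
    by (simp add: o_def)
  from openin_continuous_map_preimage[OF this assms] show ?thesis
    by (simp add: topspace_locally_solid)
qed

lemma solid_nbhdI:
  assumes "openin \<tau> U" "0 \<in> U"
  obtains V where "V \<in> solid_nbhds \<tau>" "V \<subseteq> U"
  using \<tau> assms unfolding locally_solid_def neighbourhood_base_at_def solid_nbhds_def
  by (metis (mono_tags, lifting) mem_Collect_eq)

lemma openin_solid_nbhds_iff:
  "openin \<tau> U \<longleftrightarrow> (\<forall>x\<in>U. \<exists>V\<in>solid_nbhds \<tau>. \<forall>v\<in>V. x + v \<in> U)"
proof
  assume U: "openin \<tau> U"
  show "\<forall>x\<in>U. \<exists>V\<in>solid_nbhds \<tau>. \<forall>v\<in>V. x + v \<in> U"
  proof
    fix x assume "x \<in> U"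
    then have "0 \<in> {y. x + y \<in> U}" by simp
    then show "\<exists>V\<in>solid_nbhds \<tau>. \<forall>v\<in>V. x + v \<in> U"
      by (rule solid_nbhdI[OF openin_translate[OF U, of x]]) blast
  qed
next
  assume *: "\<forall>x\<in>U. \<exists>V\<in>solid_nbhds \<tau>. \<forall>v\<in>V. x + v \<in> U"
  have "\<exists>T. openin \<tau> T \<and> x \<in> T \<and> T \<subseteq> U" if x: "x \<in> U" for x
  proof -
    obtain V P where V: "\<forall>v\<in>V. x + v \<in> U" "openin \<tau> P" "0 \<in> P" "P \<subseteq> V"
      using * x unfolding solid_nbhds_def by auto
    have "openin \<tau> {y. - x + y \<in> P}" by (rule openin_translate[OF V(2)])
    moreover have "x \<in> {y. - x + y \<in> P}" using V(3) by simp
    moreover have "{y. - x + y \<in> P} \<subseteq> U"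
    proof
      fix y assume "y \<in> {y. - x + y \<in> P}"
      then have "x + (- x + y) \<in> U" using V(1,4) by blast
      then show "y \<in> U" by simp
    qed
    ultimately show ?thesis by blast
  qed
  then show "openin \<tau> U" by (subst openin_subopen) blast
qed

lemma solid_base_solid_nbhds: "solid_base (solid_nbhds \<tau>)"
  unfolding solid_base_def
proof (intro conjI ballI allI)
  have "openin \<tau> UNIV" using openin_topspace[of \<tau>] by (simp add: topspace_locally_solid)
  then show "solid_nbhds \<tau> \<noteq> {}" by (auto elim: solid_nbhdI)
next
  fix V assume "V \<in> solid_nbhds \<tau>"
  then show "solid V" "0 \<in> V" by (auto simp: solid_nbhds_def)
next
  fix V W assume VW: "V \<in> solid_nbhds \<tau>" "W \<in> solid_nbhds \<tau>"
  then have "V \<inter> W \<in> solid_nbhds \<tau>" by (rule solid_nbhds_Int)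
  then show "\<exists>Z\<in>solid_nbhds \<tau>. Z \<subseteq> V \<inter> W" by blast
next
  fix V assume "V \<in> solid_nbhds \<tau>"
  then obtain P where P: "openin \<tau> P" "0 \<in> P" "P \<subseteq> V" by (auto simp: solid_nbhds_def)
  have "continuous_map (prod_topology \<tau> \<tau>) \<tau> (\<lambda>(x, y). x + y)"
    using \<tau> by (simp add: locally_solid_def linear_topology_def)
  from openin_continuous_map_preimage[OF this P(1)]
  have "openin (prod_topology \<tau> \<tau>) {p. (case p of (x, y) \<Rightarrow> x + y) \<in> P}"
    by (simp add: topspace_locally_solid)
  moreover have "(0, 0) \<in> {p. (case p of (x, y) \<Rightarrow> x + y) \<in> P}" using P(2) by simp
  ultimately obtain S T where ST: "openin \<tau> S" "openin \<tau> T" "0 \<in> S" "0 \<in> T"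
    "S \<times> T \<subseteq> {p. (case p of (x, y) \<Rightarrow> x + y) \<in> P}"
    unfolding openin_prod_topology_alt by metis
  then have "openin \<tau> (S \<inter> T)" "0 \<in> S \<inter> T" by auto
  then obtain W where "W \<in> solid_nbhds \<tau>" "W \<subseteq> S \<inter> T" by (rule solid_nbhdI)
  then show "\<exists>W\<in>solid_nbhds \<tau>. \<forall>x\<in>W. \<forall>y\<in>W. x + y \<in> V"
    using ST(5) P(3) by (intro bexI[of _ W]) (auto 0 4)
next
  fix V x assume "V \<in> solid_nbhds \<tau>"
  then obtain P where P: "openin \<tau> P" "0 \<in> P" "P \<subseteq> V" by (auto simp: solid_nbhds_def)
  have "continuous_map (prod_topology euclideanreal \<tau>) \<tau> (\<lambda>(c, x). c *\<^sub>R x)"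
    using \<tau> by (simp add: locally_solid_def linear_topology_def)
  from openin_continuous_map_preimage[OF this P(1)]
  have "openin (prod_topology euclideanreal \<tau>) {p. (case p of (c, x) \<Rightarrow> c *\<^sub>R x) \<in> P}"
    by (simp add: topspace_locally_solid)
  moreover have "(0, x) \<in> {p. (case p of (c, x) \<Rightarrow> c *\<^sub>R x) \<in> P}" using P(2) by simp
  ultimately obtain S T where ST: "openin euclideanreal S" "0 \<in> S" "x \<in> T"
    "S \<times> T \<subseteq> {p. (case p of (c, x) \<Rightarrow> c *\<^sub>R x) \<in> P}"
    unfolding openin_prod_topology_alt by metis
  then obtain e where e: "e > 0" "ball 0 e \<subseteq> S" by (auto simp: open_contains_ball)
  then have "(e / 2, x) \<in> S \<times> T" using ST(3) by (auto simp: subset_iff dist_real_def)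
  then have "(e / 2) *\<^sub>R x \<in> V" using ST(4) P(3) by auto
  then show "\<exists>c>0. c *\<^sub>R x \<in> V" using e(1) by (intro exI[of _ "e / 2"]) auto
qed

lemma Hausdorff_solid_nbhds:
  assumes "Hausdorff_space \<tau>" "\<And>V. V \<in> solid_nbhds \<tau> \<Longrightarrow> x \<in> V"
  shows "x = 0"
proof (rule ccontr)
  assume "x \<noteq> 0"
  then obtain U P where "openin \<tau> U" "0 \<in> U" "x \<in> P" "disjnt U P"
    using assms(1) unfolding Hausdorff_space_def topspace_locally_solid
    by (metis UNIV_I)
  then show False using assms(2) solid_nbhdI[of U] by (metis disjnt_iff subsetD)
qed

lemma limitin_solid_nbhds_iff:
  "limitin \<tau> x l F \<longleftrightarrow> (\<forall>V\<in>solid_nbhds \<tau>. eventually (\<lambda>a. x a - l \<in> V) F)"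
proof
  assume l: "limitin \<tau> x l F"
  show "\<forall>V\<in>solid_nbhds \<tau>. eventually (\<lambda>a. x a - l \<in> V) F"
  proof
    fix V assume "V \<in> solid_nbhds \<tau>"
    then obtain P where P: "openin \<tau> P" "0 \<in> P" "P \<subseteq> V" by (auto simp: solid_nbhds_def)
    have "openin \<tau> {y. - l + y \<in> P}" by (rule openin_translate[OF P(1)])
    moreover have "l \<in> {y. - l + y \<in> P}" using P(2) by simp
    ultimately have "eventually (\<lambda>a. x a \<in> {y. - l + y \<in> P}) F"
      using l unfolding limitin_def by blast
    then show "eventually (\<lambda>a. x a - l \<in> V) F"
      by (rule eventually_mono) (use P(3) in auto)
  qed
next
  assume *: "\<forall>V\<in>solid_nbhds \<tau>. eventually (\<lambda>a. x a - l \<in> V) F"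
  show "limitin \<tau> x l F"
    unfolding limitin_def
  proof (intro conjI allI impI)
    fix U assume "openin \<tau> U \<and> l \<in> U"
    then obtain V where "V \<in> solid_nbhds \<tau>" "\<forall>v\<in>V. l + v \<in> U"
      using openin_solid_nbhds_iff by blast
    then have ev: "eventually (\<lambda>a. x a - l \<in> V) F" and U: "\<And>a. x a - l \<in> V \<Longrightarrow> l + (x a - l) \<in> U"
      using * by blast+
    show "eventually (\<lambda>a. x a \<in> U) F" by (rule eventually_mono[OF ev]) (use U in simp)
  qed (simp add: topspace_locally_solid)
qed

lemma cauchy_net_solid_nbhds_iff:
  assumes "directed_set A r"
  shows "cauchy_net \<tau> A r x \<longleftrightarrow>
    (\<forall>V\<in>solid_nbhds \<tau>. \<exists>a\<in>A. \<forall>b\<in>A. \<forall>c\<in>A. r a b \<longrightarrow> r a c \<longrightarrow> x b - x c \<in> V)"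
proof -
  have "eventually (\<lambda>p. (case p of (a, b) \<Rightarrow> x a - x b) - 0 \<in> V) (tails (A \<times> A) (prod_rel r)) \<longleftrightarrow>
      (\<exists>a\<in>A. \<forall>b\<in>A. \<forall>c\<in>A. r a b \<longrightarrow> r a c \<longrightarrow> x b - x c \<in> V)" (is "?L \<longleftrightarrow> ?R") for V
  proof
    assume ?L
    then obtain a b where ab: "a \<in> A" "b \<in> A"
      "\<And>c d. c \<in> A \<Longrightarrow> d \<in> A \<Longrightarrow> r a c \<Longrightarrow> r b d \<Longrightarrow> x c - x d \<in> V"
      unfolding eventually_tails[OF directed_set_prod[OF assms]]
      by (auto simp: prod_rel_def)
    obtain e where e: "e \<in> A" "r a e" "r b e"
      using assms ab unfolding directed_set_def by blast
    have "r a c" "r b c" if "c \<in> A" "r e c" for c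
      using assms ab e that unfolding directed_set_def transp_on_def by blast+
    then show ?R using e ab(3) by blast
  next
    assume ?R
    then obtain a where "a \<in> A" "\<forall>b\<in>A. \<forall>c\<in>A. r a b \<longrightarrow> r a c \<longrightarrow> x b - x c \<in> V" by blast
    then show ?L
      unfolding eventually_tails[OF directed_set_prod[OF assms]]
      by (intro bexI[of _ "(a, a)"]) (auto simp: prod_rel_def)
  qed
  then show ?thesis by (simp add: cauchy_net_def limitin_solid_nbhds_iff)
qed

lemma tau_bounded_solid_nbhds_iff:
  "tau_bounded \<tau> S \<longleftrightarrow> (\<forall>V\<in>solid_nbhds \<tau>. \<exists>c>0. \<forall>x\<in>S. c *\<^sub>R x \<in> V)"
proof
  assume S: "tau_bounded \<tau> S"
  show "\<forall>V\<in>solid_nbhds \<tau>. \<exists>c>0. \<forall>x\<in>S. c *\<^sub>R x \<in> V"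
  proof
    fix V assume "V \<in> solid_nbhds \<tau>"
    then obtain P where P: "openin \<tau> P" "0 \<in> P" "P \<subseteq> V" by (auto simp: solid_nbhds_def)
    then obtain c where c: "c > 0" "S \<subseteq> (\<lambda>x. c *\<^sub>R x) ` P"
      using S unfolding tau_bounded_def by blast
    have "(1 / c) *\<^sub>R x \<in> V" if x: "x \<in> S" for x
    proof -
      obtain p where "p \<in> P" "x = c *\<^sub>R p" using c(2) x by blast
      then show ?thesis using c(1) P(3) by auto
    qed
    then show "\<exists>c>0. \<forall>x\<in>S. c *\<^sub>R x \<in> V" using c(1) by (intro exI[of _ "1 / c"]) auto
  qed
next
  assume *: "\<forall>V\<in>solid_nbhds \<tau>. \<exists>c>0. \<forall>x\<in>S. c *\<^sub>R x \<in> V"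
  show "tau_bounded \<tau> S"
    unfolding tau_bounded_def
  proof (intro allI impI)
    fix U assume "openin \<tau> U \<and> 0 \<in> U"
    then obtain V where V: "V \<in> solid_nbhds \<tau>" "V \<subseteq> U" by (metis solid_nbhdI)
    then obtain c where c: "c > 0" "\<forall>x\<in>S. c *\<^sub>R x \<in> V" using * by blast
    have "x \<in> (\<lambda>x. (1 / c) *\<^sub>R x) ` U" if "x \<in> S" for x
      using c V(2) that by (intro image_eqI[of _ _ "c *\<^sub>R x"]) auto
    then show "\<exists>c>0. S \<subseteq> (\<lambda>x. c *\<^sub>R x) ` U"
      using c(1) by (intro exI[of _ "1 / c"]) auto
  qed
qed

end

text \<open>How minimality is used: any separating solid base consisting of \<open>\<tau>\<close>-neighbourhoods of zero
  generates a Hausdorff locally solid topology coarser than \<open>\<tau>\<close>, hence \<open>\<tau>\<close> itself.\<close>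

lemma minimal_topology_solid_base:
  fixes \<tau> :: "'a::vector_lattice topology"
  assumes \<tau>: "minimal_topology \<tau>" and B: "solid_base B" "B \<subseteq> solid_nbhds \<tau>"
    and sep: "\<And>x. (\<And>V. V \<in> B \<Longrightarrow> x \<in> V) \<Longrightarrow> x = 0"
    and V: "V \<in> solid_nbhds \<tau>"
  obtains W where "W \<in> B" "W \<subseteq> V"
proof -
  have ls: "locally_solid \<tau>" using \<tau> by (simp add: minimal_topology_def)
  have "openin \<tau> U" if "openin (base_topology B) U" for U
    using that B(2) unfolding openin_base_topology[OF B(1)] openin_solid_nbhds_iff[OF ls] by blast
  then have eq: "base_topology B = \<tau>"
    using \<tau> locally_solid_base_topology[OF B(1)] Hausdorff_base_topology[OF B(1) sep]
    unfolding minimal_topology_def by blast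
  obtain P where P: "openin \<tau> P" "0 \<in> P" "P \<subseteq> V" using V by (auto simp: solid_nbhds_def)
  then obtain W where "W \<in> B" "\<forall>w\<in>W. 0 + w \<in> P"
    using openin_base_topology[OF B(1)] eq by metis
  then show thesis using P(3) that by (metis add_0 subset_iff)
qed

section \<open>Minimal topologies are unbounded and Lebesgue\<close>

text \<open>An Archimedean vector lattice with a minimal topology.\<close>

locale minimal_archimedean =
  fixes \<tau> :: "'a::vector_lattice topology"
  assumes archimedean: "archimedean_lattice TYPE('a)"
    and minimal: "minimal_topology \<tau>"
begin

abbreviation \<N> :: "'a set set" where "\<N> \<equiv> solid_nbhds \<tau>"

lemma ls: "locally_solid \<tau>"
  using minimal by (simp add: minimal_topology_def)

lemma nbhds_base: "solid_base \<N>"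
  by (rule solid_base_solid_nbhds[OF ls])

lemma nbhd_solid: "V \<in> \<N> \<Longrightarrow> solid V"
  and nbhd_0: "V \<in> \<N> \<Longrightarrow> 0 \<in> V"
  by (auto simp: solid_nbhds_def)

lemma nbhd_abs_le: "V \<in> \<N> \<Longrightarrow> \<bar>x\<bar> \<le> y \<Longrightarrow> y \<in> V \<Longrightarrow> x \<in> V"
  by (rule solid_abs_leD[OF nbhd_solid])

lemma nbhd_le: "V \<in> \<N> \<Longrightarrow> 0 \<le> x \<Longrightarrow> x \<le> y \<Longrightarrow> y \<in> V \<Longrightarrow> x \<in> V"
  by (rule solid_leD[OF nbhd_solid])

lemma nbhd_abs_iff: "V \<in> \<N> \<Longrightarrow> \<bar>x\<bar> \<in> V \<longleftrightarrow> x \<in> V"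
  by (rule solid_abs_iff[OF nbhd_solid])

lemma nbhd_diff_commute: "V \<in> \<N> \<Longrightarrow> x - y \<in> V \<longleftrightarrow> y - x \<in> V"
  by (metis nbhd_abs_iff abs_minus_commute)

lemma nbhd_half:
  assumes "V \<in> \<N>"
  obtains W where "W \<in> \<N>" "W \<subseteq> V" "\<And>x y. x \<in> W \<Longrightarrow> y \<in> W \<Longrightarrow> x + y \<in> V"
proof -
  obtain W where W: "W \<in> \<N>" "\<forall>x\<in>W. \<forall>y\<in>W. x + y \<in> V"
    using nbhds_base assms unfolding solid_base_def by meson
  then have "W \<subseteq> V" using nbhd_0[OF W(1)] by (metis add_0_right subsetI)
  then show thesis using W that by blast
qed

lemma nbhd_absorb: "V \<in> \<N> \<Longrightarrow> \<exists>c>0. c *\<^sub>R x \<in> V"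
  using nbhds_base unfolding solid_base_def by blast

lemma nbhd_scaleR: "V \<in> \<N> \<Longrightarrow> \<bar>c\<bar> \<le> d \<Longrightarrow> d *\<^sub>R x \<in> V \<Longrightarrow> c *\<^sub>R x \<in> V"
  by (rule solid_scaleR[OF nbhd_solid])

lemma nbhds_separate: "(\<And>V. V \<in> \<N> \<Longrightarrow> x \<in> V) \<Longrightarrow> x = 0"
  using Hausdorff_solid_nbhds[OF ls] minimal by (simp add: minimal_topology_def)

lemmas limitin_iff = limitin_solid_nbhds_iff[OF ls]
lemmas cauchy_iff = cauchy_net_solid_nbhds_iff[OF ls]
lemmas bounded_iff = tau_bounded_solid_nbhds_iff[OF ls]

text \<open>The sets \<open>{x. inf \<bar>x\<bar> u \<in> W}\<close> with \<open>u \<in> A\<close> form a solid base, which is separating because no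
  nonzero element is disjoint from all of \<open>A\<close>. By minimality this base generates \<open>\<tau>\<close>.\<close>

lemma truncation_determines_nbhd:
  assumes A: "A \<noteq> {}" "\<And>a. a \<in> A \<Longrightarrow> 0 \<le> a"
    "\<And>a b. a \<in> A \<Longrightarrow> b \<in> A \<Longrightarrow> \<exists>c\<in>A. a \<le> c \<and> b \<le> c"
    and total: "\<And>z. 0 \<le> z \<Longrightarrow> (\<And>a. a \<in> A \<Longrightarrow> inf z a = 0) \<Longrightarrow> z = 0"
    and V: "V \<in> \<N>"
  obtains u W where "u \<in> A" "W \<in> \<N>" "\<forall>x. inf \<bar>x\<bar> u \<in> W \<longrightarrow> x \<in> V"
proof -
  define K where "K u W = {x :: 'a. inf \<bar>x\<bar> u \<in> W}" for u W
  define B where "B = {K u W | u W. u \<in> A \<and> W \<in> \<N>}"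
  have inB: "K u W \<in> B" if "u \<in> A" "W \<in> \<N>" for u W
    using that by (auto simp: B_def)
  have solid_K: "solid (K u W)" if "u \<in> A" "W \<in> \<N>" for u W
    unfolding solid_def
  proof (intro allI impI, elim conjE)
    fix x y :: 'a assume "\<bar>x\<bar> \<le> \<bar>y\<bar>" "y \<in> K u W"
    then have "inf \<bar>x\<bar> u \<le> inf \<bar>y\<bar> u" "inf \<bar>y\<bar> u \<in> W" by (auto simp: K_def intro: le_infI1)
    moreover have "0 \<le> inf \<bar>x\<bar> u" using A(2)[OF that(1)] by simp
    ultimately have "inf \<bar>x\<bar> u \<in> W" using nbhd_le[OF that(2)] by blast
    then show "x \<in> K u W" by (simp add: K_def)
  qed
  have W_K: "W \<subseteq> K u W" if "u \<in> A" "W \<in> \<N>" for u W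
  proof
    fix x assume "x \<in> W"
    then have "\<bar>x\<bar> \<in> W" using nbhd_abs_iff[OF that(2)] by simp
    moreover have "0 \<le> inf \<bar>x\<bar> u" "inf \<bar>x\<bar> u \<le> \<bar>x\<bar>" using A(2)[OF that(1)] by auto
    ultimately have "inf \<bar>x\<bar> u \<in> W" using nbhd_le[OF that(2)] by blast
    then show "x \<in> K u W" by (simp add: K_def)
  qed
  have base: "solid_base B"
    unfolding solid_base_def
  proof (intro conjI ballI allI)
    show "B \<noteq> {}" using A(1) V by (auto simp: B_def)
  next
    fix S assume "S \<in> B"
    then obtain u W where S: "u \<in> A" "W \<in> \<N>" "S = K u W" by (auto simp: B_def)
    show "solid S" using solid_K S by simp
    show "0 \<in> S" using W_K[OF S(1,2)] nbhd_0[OF S(2)] S(3) by blast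
  next
    fix S T assume "S \<in> B" "T \<in> B"
    then obtain u W v Z where S: "u \<in> A" "W \<in> \<N>" "S = K u W" "v \<in> A" "Z \<in> \<N>" "T = K v Z"
      by (auto simp: B_def)
    obtain c where c: "c \<in> A" "u \<le> c" "v \<le> c" using A(3) S by blast
    have "K c (W \<inter> Z) \<subseteq> S \<inter> T"
    proof
      fix x assume "x \<in> K c (W \<inter> Z)"
      then have "inf \<bar>x\<bar> c \<in> W" "inf \<bar>x\<bar> c \<in> Z" by (auto simp: K_def)
      moreover have "0 \<le> inf \<bar>x\<bar> u" "inf \<bar>x\<bar> u \<le> inf \<bar>x\<bar> c" "0 \<le> inf \<bar>x\<bar> v" "inf \<bar>x\<bar> v \<le> inf \<bar>x\<bar> c"
        using c(2,3) A(2)[OF S(1)] A(2)[OF S(4)] by (auto intro: le_infI2)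
      ultimately have "inf \<bar>x\<bar> u \<in> W" "inf \<bar>x\<bar> v \<in> Z"
        using nbhd_le[OF S(2)] nbhd_le[OF S(5)] by blast+
      then show "x \<in> S \<inter> T" by (simp add: S(3,6) K_def)
    qed
    then show "\<exists>Z\<in>B. Z \<subseteq> S \<inter> T" using inB[OF c(1) solid_nbhds_Int[OF S(2,5)]] by blast
  next
    fix S assume "S \<in> B"
    then obtain u W where S: "u \<in> A" "W \<in> \<N>" "S = K u W" by (auto simp: B_def)
    obtain Z where Z: "Z \<in> \<N>" "\<And>x y. x \<in> Z \<Longrightarrow> y \<in> Z \<Longrightarrow> x + y \<in> W"
      using nbhd_half[OF S(2)] by metis
    have "x + y \<in> S" if "x \<in> K u Z" "y \<in> K u Z" for x y
    proof -
      have "inf \<bar>x\<bar> u + inf \<bar>y\<bar> u \<in> W" using that Z(2) by (simp add: K_def)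
      moreover have "inf \<bar>x + y\<bar> u \<le> inf (\<bar>x\<bar> + \<bar>y\<bar>) u"
        by (intro inf_mono abs_triangle_ineq order_refl)
      then have "inf \<bar>x + y\<bar> u \<le> inf \<bar>x\<bar> u + inf \<bar>y\<bar> u"
        by (rule order_trans[OF _ inf_add_le]) (use A(2)[OF S(1)] in simp_all)
      moreover have "0 \<le> inf \<bar>x + y\<bar> u" using A(2)[OF S(1)] by simp
      ultimately have "inf \<bar>x + y\<bar> u \<in> W" using nbhd_le[OF S(2)] by blast
      then show ?thesis using S(3) by (simp add: K_def)
    qed
    then show "\<exists>T\<in>B. \<forall>x\<in>T. \<forall>y\<in>T. x + y \<in> S" using inB[OF S(1) Z(1)] by blast
    show "\<exists>c>0. c *\<^sub>R x \<in> S" for x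
      using nbhd_absorb[OF S(2), of x] W_K[OF S(1,2)] S(3) by blast
  qed
  have sub: "B \<subseteq> \<N>"
  proof
    fix S assume "S \<in> B"
    then obtain u W where S: "u \<in> A" "W \<in> \<N>" "S = K u W" by (auto simp: B_def)
    obtain P where "openin \<tau> P" "0 \<in> P" "P \<subseteq> W" using S(2) by (auto simp: solid_nbhds_def)
    then show "S \<in> \<N>"
      using solid_K[OF S(1,2)] W_K[OF S(1,2)] S(3) unfolding solid_nbhds_def by blast
  qed
  have sep: "x = 0" if x: "\<And>S. S \<in> B \<Longrightarrow> x \<in> S" for x
  proof -
    have "inf \<bar>x\<bar> u = 0" if "u \<in> A" for u
      using x[OF inB[OF that]] by (intro nbhds_separate) (simp add: K_def)
    then have "\<bar>x\<bar> = 0" using total[of "\<bar>x\<bar>"] abs_ge_zero by blast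
    then show ?thesis by simp
  qed
  obtain S where "S \<in> B" "S \<subseteq> V"
    using minimal_topology_solid_base[OF minimal base sub sep V] by blast
  then obtain u W where "u \<in> A" "W \<in> \<N>" "K u W \<subseteq> V" by (auto simp: B_def)
  then show thesis using that by (auto simp: K_def)
qed

text \<open>Minimal topologies are unbounded: convergence to zero may be tested on the truncations
  \<open>inf \<bar>x\<bar> u\<close>.\<close>

lemma unbounded:
  assumes "V \<in> \<N>"
  obtains u W where "0 \<le> u" "W \<in> \<N>" "\<forall>x. inf \<bar>x\<bar> u \<in> W \<longrightarrow> x \<in> V"
proof (rule truncation_determines_nbhd[of "{u. 0 \<le> u}" V])
  show "\<exists>c\<in>{u. 0 \<le> u}. a \<le> c \<and> b \<le> c" if "a \<in> {u. 0 \<le> u}" "b \<in> {u. 0 \<le> u}" for a b :: 'a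
    using that by (intro bexI[of _ "sup a b"]) (auto intro: le_supI1)
  show "z = 0" if "0 \<le> z" "\<And>a. a \<in> {u. 0 \<le> u} \<Longrightarrow> inf z a = 0" for z :: 'a
    using that(2)[of z] that(1) by simp
qed (use assms that in auto)

text \<open>Minimal topologies are Lebesgue: a downward directed set with infimum zero meets every
  neighbourhood of zero. Fix \<open>y \<in> D\<close> and a small \<open>\<epsilon>\<close>. The elements \<open>pprt (\<epsilon> *\<^sub>R y - d)\<close> with
  \<open>d \<in> D\<close> increase to \<open>\<epsilon> *\<^sub>R y\<close>, so together with the elements disjoint from \<open>y\<close> they generate an
  order dense ideal; truncations by its elements determine \<open>\<tau>\<close>. So \<open>y\<close> is approximated by
  \<open>inf y (n *\<^sub>R u)\<close> for some \<open>u\<close> in that ideal, and on the support of such a \<open>u\<close> the elements of \<open>D\<close>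
  are eventually at most \<open>\<epsilon> *\<^sub>R y\<close>.\<close>

lemma lebesgue:
  assumes D: "D \<noteq> {}" "\<And>d e. d \<in> D \<Longrightarrow> e \<in> D \<Longrightarrow> \<exists>f\<in>D. f \<le> d \<and> f \<le> e"
    and glb: "isGlb UNIV D 0" and V: "V \<in> \<N>"
  obtains d where "d \<in> D" "d \<in> V"
proof -
  have D0: "0 \<le> d" if "d \<in> D" for d using glb that by (simp add: isGlb_UNIV_iff)
  obtain y where y: "y \<in> D" using D(1) by blast
  have y0: "0 \<le> y" by (rule D0[OF y])
  obtain V' where V': "V' \<in> \<N>" "\<And>x z. x \<in> V' \<Longrightarrow> z \<in> V' \<Longrightarrow> x + z \<in> V"
    using nbhd_half[OF V] by metis
  obtain \<epsilon> where \<epsilon>: "\<epsilon> > 0" "\<epsilon> *\<^sub>R y \<in> V'" using nbhd_absorb[OF V'(1)] by blast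
  \<comment> \<open>\<open>A\<close> is cofinal in the positive cone of the order dense ideal described above.\<close>
  define p where "p d = pprt (\<epsilon> *\<^sub>R y - d)" for d
  define A where "A = {real k *\<^sub>R p d + c | k d c. d \<in> D \<and> 0 \<le> c \<and> inf y c = 0}"
  have p0: "0 \<le> p d" for d by (simp add: p_def)
  have memA: "real k *\<^sub>R p d + c \<in> A" if "d \<in> D" "0 \<le> c" "inf y c = 0" for k d c
    using that by (auto simp: A_def)
  have y_0: "inf y 0 = 0" using y0 by (rule inf_absorb2)
  have dirA: "\<exists>c\<in>A. a \<le> c \<and> b \<le> c" if ab: "a \<in> A" "b \<in> A" for a b
  proof -
    obtain k d c k' d' c' where
      a: "a = real k *\<^sub>R p d + c" "d \<in> D" "0 \<le> c" "inf y c = 0" and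
      b: "b = real k' *\<^sub>R p d' + c'" "d' \<in> D" "0 \<le> c'" "inf y c' = 0"
      using ab by (auto simp: A_def)
    obtain e where e: "e \<in> D" "e \<le> d" "e \<le> d'" using D(2) a b by blast
    have pe: "p d \<le> p e" "p d' \<le> p e" using e by (auto simp: p_def)
    have "inf y (c + c') = 0"
      using inf_add_le[OF a(3) b(3) y0] a b y0
      by (intro order.antisym) (auto simp: inf_commute)
    then have "real (k + k') *\<^sub>R p e + (c + c') \<in> A"
      using e(1) add_nonneg_nonneg[OF a(3) b(3)] by (intro memA)
    moreover have "real k *\<^sub>R p d \<le> real (k + k') *\<^sub>R p e" "real k' *\<^sub>R p d' \<le> real (k + k') *\<^sub>R p e"
      using pe p0 by (auto intro: scaleR_mono)
    then have "a \<le> real (k + k') *\<^sub>R p e + (c + c')" "b \<le> real (k + k') *\<^sub>R p e + (c + c')"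
      unfolding a(1) b(1) using a(3) b(3)
      by (intro add_mono; simp)+
    ultimately show ?thesis by blast
  qed
  have neA: "A \<noteq> {}"
  proof -
    have "real 0 *\<^sub>R p y + 0 \<in> A" by (rule memA[OF y order_refl y_0])
    then show ?thesis by blast
  qed
  have posA: "0 \<le> a" if "a \<in> A" for a
    using that p0 by (auto simp: A_def scaleR_nonneg_nonneg)
  have totA: "z = 0" if z: "0 \<le> z" "\<And>a. a \<in> A \<Longrightarrow> inf z a = 0" for z
  proof -
    have "inf (\<epsilon> *\<^sub>R y) z \<le> d" if "d \<in> D" for d
    proof -
      have "real 1 *\<^sub>R p d + 0 \<in> A" by (rule memA[OF that order_refl y_0])
      then have 0: "inf (p d) z = 0" using z(2)[of "p d"] by (simp add: inf_commute)
      have "inf (\<epsilon> *\<^sub>R y) z \<le> inf (p d + d) z"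
        using le_pprt[of "\<epsilon> *\<^sub>R y - d"]
        by (intro inf_mono order_refl) (simp add: p_def diff_le_eq)
      also have "\<dots> \<le> inf (p d) z + inf d z"
        using p0 D0[OF that] z(1) by (rule inf_add_le)
      also have "\<dots> \<le> d" unfolding 0 by simp
      finally show ?thesis .
    qed
    then have "inf (\<epsilon> *\<^sub>R y) z \<le> 0" using glb unfolding isGlb_UNIV_iff by blast
    then have eq0: "inf (\<epsilon> *\<^sub>R y) z = 0"
      using \<epsilon>(1) y0 z(1) by (intro order.antisym) (auto simp: scaleR_nonneg_nonneg)
    have "inf ((1 / \<epsilon>) *\<^sub>R (\<epsilon> *\<^sub>R y)) z = 0"
      by (rule inf_scaleR_eq_0[OF _ z(1) eq0]) (use \<epsilon>(1) y0 in \<open>auto simp: scaleR_nonneg_nonneg\<close>)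
    then have "inf y z = 0" using \<epsilon>(1) by simp
    then have "real 0 *\<^sub>R p y + z \<in> A" by (rule memA[OF y z(1)])
    then show "z = 0" using z(2)[of z] by simp
  qed
  obtain u W where u: "u \<in> A" and W: "W \<in> \<N>" "\<forall>x. inf \<bar>x\<bar> u \<in> W \<longrightarrow> x \<in> V'"
    by (rule truncation_determines_nbhd[OF neA posA dirA totA V'(1)]) blast
  obtain k d c where kdc: "u = real k *\<^sub>R p d + c" "d \<in> D" "0 \<le> c" "inf y c = 0"
    using u by (auto simp: A_def)
  have u0: "0 \<le> u" using kdc p0 by (simp add: scaleR_nonneg_nonneg)
  obtain \<delta> where \<delta>: "\<delta> > 0" "\<delta> *\<^sub>R y \<in> W" using nbhd_absorb[OF W(1)] by blast
  obtain n :: nat where n: "n > 0" "1 / real n < \<delta>"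
    using \<delta>(1) by (metis inverse_eq_divide reals_Archimedean zero_less_Suc)
  have "(1 / real n) *\<^sub>R y \<in> W"
    using nbhd_scaleR[OF W(1) _ \<delta>(2)] n by simp
  then have "inf (pprt (y - real n *\<^sub>R u)) u \<in> W"
    using nbhd_le[OF W(1) _ truncation_excess_le[OF u0 y0 n(1)]] u0 by simp
  then have excess: "pprt (y - real n *\<^sub>R u) \<in> V'" using W(2) by simp
  \<comment> \<open>The excess \<open>q\<close> of \<open>e\<close> over \<open>\<epsilon> *\<^sub>R y\<close> is disjoint from \<open>u\<close>, so \<open>pprt (y - n *\<^sub>R u)\<close> dominates it.\<close>
  obtain e where e: "e \<in> D" "e \<le> d" "e \<le> y" using D(2) kdc(2) y by blast
  define q where "q = pprt (e - \<epsilon> *\<^sub>R y)"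
  have q0: "0 \<le> q" by (simp add: q_def)
  have qy: "q \<le> y"
    using e(3) y0 \<epsilon>(1) by (simp add: q_def pprt_le_iff diff_le_eq add_increasing2 scaleR_nonneg_nonneg)
  have "p d \<le> pprt (\<epsilon> *\<^sub>R y - e)" using e(2) by (simp add: p_def)
  then have "inf (p d) q = 0"
    using p0 q0 inf_mono_eq_0[OF inf_pprt_diff_eq_0[of "\<epsilon> *\<^sub>R y" e], of "p d" q]
    by (simp add: q_def)
  then have "inf (real k *\<^sub>R p d) q = 0" using p0 q0 inf_scaleR_eq_0[of "p d" q "real k"] by simp
  moreover have "inf c q = 0"
    using kdc(3,4) q0 qy inf_mono_eq_0[of c y c q] by (simp add: inf_commute)
  ultimately have "inf u q \<le> 0"
    using inf_add_le[of "real k *\<^sub>R p d" c q] kdc p0 q0 by (simp add: scaleR_nonneg_nonneg)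
  then have "inf u q = 0" using u0 q0 by (intro order.antisym) auto
  then have nuq: "inf (real n *\<^sub>R u) q = 0" using u0 q0 inf_scaleR_eq_0[of u q "real n"] by simp
  have "q = inf y q" using qy by (simp add: inf_absorb2)
  also have "\<dots> \<le> inf (real n *\<^sub>R u + pprt (y - real n *\<^sub>R u)) q"
    using le_pprt[of "y - real n *\<^sub>R u"]
    by (intro inf_mono order_refl) (simp add: diff_le_eq add.commute)
  also have "\<dots> \<le> inf (real n *\<^sub>R u) q + inf (pprt (y - real n *\<^sub>R u)) q"
    using u0 q0 by (intro inf_add_le) (auto simp: scaleR_nonneg_nonneg)
  also have "\<dots> \<le> pprt (y - real n *\<^sub>R u)" by (simp add: nuq)
  finally have "q \<in> V'" using nbhd_le[OF V'(1) q0 _ excess] by simp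
  then have "q + \<epsilon> *\<^sub>R y \<in> V" using V'(2) \<epsilon>(2) by blast
  moreover have "e \<le> q + \<epsilon> *\<^sub>R y" using le_pprt[of "e - \<epsilon> *\<^sub>R y"] by (simp add: q_def diff_le_eq)
  ultimately have "e \<in> V" using nbhd_le[OF V D0[OF e(1)]] by blast
  then show thesis using e(1) that by blast
qed

lemma lebesgue_lub:
  assumes E: "E \<noteq> {}" "\<And>d e. d \<in> E \<Longrightarrow> e \<in> E \<Longrightarrow> \<exists>f\<in>E. d \<le> f \<and> e \<le> f"
    and lub: "isLub UNIV E s" and V: "V \<in> \<N>"
  obtains x where "x \<in> E" "s - x \<in> V"
proof (rule lebesgue[of "(\<lambda>x. s - x) ` E" V])
  show "isGlb UNIV ((\<lambda>x. s - x) ` E) 0"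
    unfolding isGlb_UNIV_iff
  proof (intro conjI allI impI)
    show "\<forall>x\<in>(\<lambda>x. s - x) ` E. 0 \<le> x" using lub by (simp add: isLub_UNIV_iff)
    fix h assume "\<forall>x\<in>(\<lambda>x. s - x) ` E. h \<le> x"
    then have "\<forall>x\<in>E. x \<le> s - h" by (simp add: le_diff_eq add.commute)
    then have "s \<le> s - h" using lub by (simp add: isLub_UNIV_iff)
    then show "h \<le> 0" by (simp add: le_diff_eq)
  qed
  show "\<exists>f\<in>(\<lambda>x. s - x) ` E. f \<le> a \<and> f \<le> b"
    if "a \<in> (\<lambda>x. s - x) ` E" "b \<in> (\<lambda>x. s - x) ` E" for a b
    using that E(2) by (force intro: diff_left_mono)
qed (use E(1) V that in auto)

lemma lebesgue_glb:
  assumes E: "E \<noteq> {}" "\<And>d e. d \<in> E \<Longrightarrow> e \<in> E \<Longrightarrow> \<exists>f\<in>E. f \<le> d \<and> f \<le> e"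
    and glb: "isGlb UNIV E s" and V: "V \<in> \<N>"
  obtains x where "x \<in> E" "x - s \<in> V"
proof (rule lebesgue[of "(\<lambda>x. x - s) ` E" V])
  show "isGlb UNIV ((\<lambda>x. x - s) ` E) 0"
    unfolding isGlb_UNIV_iff
  proof (intro conjI allI impI)
    show "\<forall>x\<in>(\<lambda>x. x - s) ` E. 0 \<le> x" using glb by (simp add: isGlb_UNIV_iff)
    fix h assume "\<forall>x\<in>(\<lambda>x. x - s) ` E. h \<le> x"
    then have "\<forall>x\<in>E. h + s \<le> x" by (simp add: le_diff_eq)
    then have "h + s \<le> s" using glb unfolding isGlb_UNIV_iff by blast
    then show "h \<le> 0" by simp
  qed
  show "\<exists>f\<in>(\<lambda>x. x - s) ` E. f \<le> a \<and> f \<le> b"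
    if "a \<in> (\<lambda>x. x - s) ` E" "b \<in> (\<lambda>x. x - s) ` E" for a b
    using that E(2) by (force intro: diff_right_mono)
qed (use E(1) V that in auto)

text \<open>In an Archimedean space the differences between upper bounds and members of a bounded upward
  directed set decrease to zero, even if the set has no supremum. So such a set is Cauchy.\<close>

lemma upper_bound_minus_directed:
  assumes E: "E \<noteq> {}" "\<And>d e. d \<in> E \<Longrightarrow> e \<in> E \<Longrightarrow> \<exists>f\<in>E. d \<le> f \<and> e \<le> f"
    and ub: "\<And>x. x \<in> E \<Longrightarrow> x \<le> u" and V: "V \<in> \<N>"
  obtains w x where "x \<in> E" "\<And>y. y \<in> E \<Longrightarrow> y \<le> w" "w - x \<in> V"
proof -
  define D where "D = {w - x | w x. x \<in> E \<and> (\<forall>y\<in>E. y \<le> w)}"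
  have glb: "isGlb UNIV D 0"
    unfolding isGlb_UNIV_iff
  proof (intro conjI allI impI)
    show "\<forall>x\<in>D. 0 \<le> x" by (auto simp: D_def)
    fix h assume h: "\<forall>x\<in>D. h \<le> x"
    have step: "\<forall>x\<in>E. x \<le> w - h" if "\<forall>x\<in>E. x \<le> w" for w
      using h that unfolding D_def by (fastforce simp: le_diff_eq add.commute)
    have n: "\<forall>x\<in>E. x \<le> u - real n *\<^sub>R h" for n
    proof (induction n)
      case 0
      then show ?case using ub by simp
    next
      case (Suc n)
      have "u - real (Suc n) *\<^sub>R h = u - real n *\<^sub>R h - h" by (simp add: scaleR_left_distrib)
      then show ?case using step[OF Suc] by (simp only:)
    qed
    obtain x where x: "x \<in> E" using E(1) by blast
    have "real n *\<^sub>R h \<le> u - x" for n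
      using n[of n] x by (simp add: le_diff_eq add.commute)
    then show "h \<le> 0" by (rule archimedean_le_0[OF archimedean])
  qed
  have dir: "\<exists>f\<in>D. f \<le> a \<and> f \<le> b" if "a \<in> D" "b \<in> D" for a b
  proof -
    obtain w x where a: "a = w - x" "x \<in> E" "\<forall>y\<in>E. y \<le> w"
      using \<open>a \<in> D\<close> by (auto simp: D_def)
    obtain w' x' where b: "b = w' - x'" "x' \<in> E" "\<forall>y\<in>E. y \<le> w'"
      using \<open>b \<in> D\<close> by (auto simp: D_def)
    obtain f where f: "f \<in> E" "x \<le> f" "x' \<le> f" using E(2) a b by blast
    have "inf w w' - f \<in> D" unfolding D_def using f(1) a(3) b(3) by (blast intro: le_infI)
    moreover have "inf w w' - f \<le> a" "inf w w' - f \<le> b"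
      unfolding a(1) b(1) by (intro diff_mono inf_le1 inf_le2 f(2,3))+
    ultimately show ?thesis by blast
  qed
  have "D \<noteq> {}" using E(1) ub by (auto simp: D_def)
  then obtain d where "d \<in> D" "d \<in> V" by (rule lebesgue[OF _ dir glb V])
  then show thesis using that by (auto simp: D_def)
qed

end

section \<open>Universally complete spaces are complete\<close>

text \<open>The component \<open>e\<close> of \<open>c\<close> in the band generated by \<open>g\<close>.\<close>

lemma band_component:
  fixes c g :: "'a::vector_lattice"
  assumes oc: "order_complete TYPE('a)" and c: "0 \<le> c" and g: "0 \<le> g"
  obtains e where "0 \<le> e" "e \<le> c" "inf c g \<le> e" "inf (c - e) g = 0"
    "\<And>w. 0 \<le> w \<Longrightarrow> inf g w = 0 \<Longrightarrow> inf e w = 0"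
proof -
  define T where "T = range (\<lambda>k::nat. inf c (real k *\<^sub>R g))"
  obtain e where e: "isLub UNIV T e"
    by (rule order_completeD[OF oc, of T c]) (auto simp: T_def)
  have le_e: "inf c (real k *\<^sub>R g) \<le> e" for k
    by (rule isLub_upper[OF e]) (simp add: T_def)
  have e_le: "e \<le> w" if "\<And>k. inf c (real k *\<^sub>R g) \<le> w" for w
    by (rule isLub_least[OF e]) (auto simp: T_def that)
  have ec: "e \<le> c" by (rule e_le) simp
  define h where "h = inf (c - e) g"
  have "inf c (real k *\<^sub>R g) \<le> e - h" for k
  proof -
    have "inf c (real k *\<^sub>R g) + h \<le> e + (c - e)"
      by (intro add_mono le_e) (simp add: h_def)
    moreover have "inf c (real k *\<^sub>R g) + h \<le> real k *\<^sub>R g + g"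
      by (intro add_mono) (simp_all add: h_def)
    ultimately have "inf c (real k *\<^sub>R g) + h \<le> inf c (real (Suc k) *\<^sub>R g)"
      by (simp add: scaleR_left_distrib add.commute)
    also have "\<dots> \<le> e" by (rule le_e)
    finally show ?thesis by (simp add: le_diff_eq)
  qed
  then have "e \<le> e - h" by (rule e_le)
  then have "h \<le> 0" by (simp add: le_diff_eq)
  moreover have "0 \<le> h" using ec g by (simp add: h_def)
  ultimately have "inf (c - e) g = 0" unfolding h_def by (rule order.antisym)
  moreover have "0 \<le> e" using le_e[of 0] c by (simp add: inf_absorb2)
  moreover have "inf c g \<le> e" using le_e[of 1] by simp
  moreover have "inf e w = 0" if w: "0 \<le> w" "inf g w = 0" for w
  proof -
    have "inf (inf c (real k *\<^sub>R g)) w \<le> 0" for k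
    proof -
      have "inf (inf c (real k *\<^sub>R g)) w \<le> inf (real k *\<^sub>R g) w" by (intro inf_mono) auto
      then show ?thesis using inf_scaleR_eq_0[OF g w(1,2), of "real k"] by simp
    qed
    then have "inf e w \<le> 0" by (intro isLub_least[OF isLub_inf[OF e, of w]]) (auto simp: T_def)
    then show ?thesis using \<open>0 \<le> e\<close> w(1) by (intro order.antisym) auto
  qed
  ultimately show thesis using ec that by blast
qed

text \<open>A set of positive elements is bounded unless its truncations exhaust all multiples of some
  \<open>v > 0\<close>. Call \<open>e\<close> good if every element of \<open>E\<close> is at most \<open>e\<close> on the support of \<open>e\<close>. If no \<open>v > 0\<close>
  is exhausted, there are nonzero good elements in every nonzero band, so the supremum of a maximal
  disjoint family of good elements bounds \<open>E\<close>.\<close>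

lemma universally_complete_bounded:
  fixes E :: "'a::vector_lattice set"
  assumes uc: "universally_complete TYPE('a)" and E: "E \<noteq> {}" "\<And>x. x \<in> E \<Longrightarrow> 0 \<le> x"
    and small: "\<And>v. 0 \<le> v \<Longrightarrow>
      (\<And>n::nat. isLub UNIV ((\<lambda>x. inf x (real n *\<^sub>R v)) ` E) (real n *\<^sub>R v)) \<Longrightarrow> v = 0"
  obtains b where "\<And>x. x \<in> E \<Longrightarrow> x \<le> b"
proof -
  have oc: "order_complete TYPE('a)" and lc: "laterally_complete TYPE('a)"
    using uc by (auto simp: universally_complete_def)
  define good where "good e \<longleftrightarrow> 0 \<le> e \<and> e \<noteq> 0 \<and> (\<forall>x\<in>E. inf (pprt (x - e)) e = 0)" for e
  define \<S> where "\<S> = {S. (\<forall>e\<in>S. good e) \<and> pairwise (\<lambda>x y. inf x y = 0) S}"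
  have "\<exists>M\<in>\<S>. \<forall>X\<in>\<S>. M \<subseteq> X \<longrightarrow> X = M"
  proof (rule subset_Zorn_nonempty)
    show "\<S> \<noteq> {}" by (auto simp: \<S>_def intro: exI[of _ "{}"])
    fix \<C> assume C: "\<C> \<noteq> {}" "subset.chain \<S> \<C>"
    have "pairwise (\<lambda>x y. inf x y = 0) (\<Union>\<C>)"
      using C(2) by (intro pairwise_chain_Union) (auto simp: \<S>_def subset_chain_def chain_subset_def)
    then show "\<Union>\<C> \<in> \<S>" using C(2) by (auto simp: \<S>_def subset_chain_def)
  qed
  then obtain S where S: "\<And>e. e \<in> S \<Longrightarrow> good e" "pairwise (\<lambda>x y. inf x y = 0) S"
    and S_max: "\<And>X. X \<in> \<S> \<Longrightarrow> S \<subseteq> X \<Longrightarrow> X = S"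
    by (auto simp: \<S>_def)
  have S0: "0 \<le> e" if "e \<in> insert 0 S" for e using that S(1) by (auto simp: good_def)
  have "pairwise (\<lambda>x y. inf x y = 0) (insert 0 S)"
    using S(2) S0 by (auto simp: pairwise_insert inf_absorb1 inf_absorb2)
  then obtain b where b: "isLub UNIV (insert 0 S) b"
    using laterally_completeD[OF lc insert_not_empty S0] by blast
  have "x \<le> b" if x: "x \<in> E" for x
  proof -
    define r where "r = pprt (x - b)"
    have r0: "0 \<le> r" by (simp add: r_def)
    have rS: "inf r s = 0" if s: "s \<in> S" for s
    proof -
      have "s \<le> b" using isLub_upper[OF b] s by blast
      then have "r \<le> pprt (x - s)" unfolding r_def by (intro pprt_mono diff_left_mono)
      then show ?thesis
        using S(1)[OF s] x r0 inf_mono_eq_0[of "pprt (x - s)" s r s] by (simp add: good_def)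
    qed
    have "r = 0"
    proof (rule small[OF r0], rule ccontr)
      fix n :: nat
      define c where "c = real n *\<^sub>R r"
      assume not: "\<not> isLub UNIV ((\<lambda>x. inf x (real n *\<^sub>R r)) ` E) (real n *\<^sub>R r)"
      have c0: "0 \<le> c" using r0 by (simp add: c_def scaleR_nonneg_nonneg)
      obtain z where z: "isLub UNIV ((\<lambda>x. inf x c) ` E) z"
        by (rule order_completeD[OF oc, of "(\<lambda>x. inf x c) ` E" c]) (use E(1) in auto)
      have ze: "inf y c \<le> z" if "y \<in> E" for y using isLub_upper[OF z] that by blast
      have zc: "z \<le> c" by (rule isLub_least[OF z]) auto
      have "z \<noteq> c" using z not by (auto simp: c_def)
      have z0: "0 \<le> z" using ze[OF x] E(2)[OF x] c0 by (meson le_inf_iff order_trans)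
      \<comment> \<open>On the support of \<open>g\<close> all of \<open>E\<close> lies below \<open>c\<close>, so the component \<open>e\<close> of \<open>c\<close> there is good.\<close>
      define g where "g = c - z"
      have g: "0 \<le> g" "g \<noteq> 0" "g \<le> c" using zc \<open>z \<noteq> c\<close> z0 by (auto simp: g_def diff_le_eq)
      obtain e where e: "0 \<le> e" "e \<le> c" "inf c g \<le> e" "inf (c - e) g = 0"
        "\<And>w. 0 \<le> w \<Longrightarrow> inf g w = 0 \<Longrightarrow> inf e w = 0"
        using band_component[OF oc c0 g(1)] by metis
      have ge: "g \<le> e" using e(3) g(3) by (simp add: inf_absorb2)
      have "inf (pprt (y - e)) e = 0" if y: "y \<in> E" for y
      proof -
        have "g \<le> pprt (c - y)"
          unfolding g_def pprt_diff inf_commute[of c y] by (rule diff_left_mono[OF ze[OF y]])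
        then have "inf (pprt (y - c)) g = 0"
          using g(1) inf_pprt_diff_eq_0[of y c]
            inf_mono_eq_0[of "pprt (y - c)" "pprt (c - y)" "pprt (y - c)" g] by simp
        then have "inf (pprt (y - c) + (c - e)) g \<le> 0"
          using inf_add_le[of "pprt (y - c)" "c - e" g] e(2,4) g(1) by simp
        moreover have "y - e \<le> pprt (y - c) + (c - e)"
          using add_right_mono[OF le_pprt[of "y - c"], of "c - e"] by simp
        then have "pprt (y - e) \<le> pprt (y - c) + (c - e)"
          unfolding pprt_le_iff using e(2) by (simp add: add_nonneg_nonneg)
        then have "inf (pprt (y - e)) g \<le> inf (pprt (y - c) + (c - e)) g" by (intro inf_mono) auto
        ultimately have "inf (pprt (y - e)) g \<le> 0" by (rule order_trans[rotated])
        then have "inf g (pprt (y - e)) = 0" using g(1) by (intro order.antisym) (auto simp: inf_commute)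
        then have "inf e (pprt (y - e)) = 0" by (intro e(5)) simp
        then show ?thesis by (simp add: inf_commute)
      qed
      then have "good e" using e(1) ge g by (auto simp: good_def)
      moreover have eS: "inf e s = 0" if s: "s \<in> S" for s
      proof -
        have "0 \<le> s" using S(1)[OF s] by (simp add: good_def)
        then have "inf c s = 0" using inf_scaleR_eq_0[OF r0 _ rS[OF s]] by (simp add: c_def)
        then show ?thesis using inf_mono_eq_0[of c s e s] e(1,2) \<open>0 \<le> s\<close> by simp
      qed
      ultimately have "insert e S \<in> \<S>"
        using S by (auto simp: \<S>_def pairwise_insert inf_commute)
      then have "e \<in> S" using S_max by blast
      then show False using eS \<open>good e\<close> by (fastforce simp: good_def)
    qed
    then show ?thesis using le_pprt[of "x - b"] by (simp add: r_def)
  qed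
  then show thesis by (rule that)
qed

context minimal_archimedean
begin

text \<open>Limits preserve order, since the positive cone is \<open>\<tau>\<close>-closed.\<close>

lemma limit_mono:
  assumes F: "F \<noteq> bot" and f: "\<And>V. V \<in> \<N> \<Longrightarrow> eventually (\<lambda>a. f a - l \<in> V) F"
    and g: "\<And>V. V \<in> \<N> \<Longrightarrow> eventually (\<lambda>a. g a - m \<in> V) F"
    and le: "eventually (\<lambda>a. f a \<le> g a) F"
  shows "l \<le> m"
proof -
  have "pprt (l - m) \<in> V" if V: "V \<in> \<N>" for V
  proof -
    obtain W where W: "W \<in> \<N>" "\<And>x y. x \<in> W \<Longrightarrow> y \<in> W \<Longrightarrow> x + y \<in> V"
      using nbhd_half[OF V] by metis
    have "eventually (\<lambda>a. f a - l \<in> W \<and> g a - m \<in> W \<and> f a \<le> g a) F"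
      using f[OF W(1)] g[OF W(1)] le by eventually_elim auto
    then obtain a where a: "f a - l \<in> W" "g a - m \<in> W" "f a \<le> g a"
      using eventually_happens'[OF F] by blast
    have "l - m = (l - f a) + (g a - m) + (f a - g a)" by simp
    also have "\<dots> \<le> \<bar>f a - l\<bar> + \<bar>g a - m\<bar> + 0"
      using a(3) abs_ge_minus_self[of "f a - l"] by (intro add_mono) (auto simp: abs_ge_self)
    finally have "pprt (l - m) \<le> \<bar>f a - l\<bar> + \<bar>g a - m\<bar>" by (simp add: pprt_le_iff)
    moreover have "\<bar>f a - l\<bar> + \<bar>g a - m\<bar> \<in> V" using a W nbhd_abs_iff by simp
    ultimately show ?thesis using nbhd_le[OF V] by simp
  qed
  then have "pprt (l - m) = 0" by (rule nbhds_separate)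
  then show ?thesis using le_pprt[of "l - m"] by simp
qed

text \<open>A multiple \<open>n *\<^sub>R v\<close> that is the supremum of truncations of \<open>E\<close> is approximated by them, and
  boundedness of \<open>E\<close> then puts \<open>v\<close> in every neighbourhood of zero.\<close>

lemma universally_complete_directed_lub:
  assumes uc: "universally_complete TYPE('a)"
    and E: "E \<noteq> {}" "\<And>x. x \<in> E \<Longrightarrow> 0 \<le> x"
    and dir: "\<And>d e. d \<in> E \<Longrightarrow> e \<in> E \<Longrightarrow> \<exists>f\<in>E. d \<le> f \<and> e \<le> f"
    and bdd: "tau_bounded \<tau> E"
  obtains s where "isLub UNIV E s"
proof -
  have small: "v = 0" if v: "0 \<le> v"
    and lub: "\<And>n::nat. isLub UNIV ((\<lambda>x. inf x (real n *\<^sub>R v)) ` E) (real n *\<^sub>R v)" for v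
  proof (rule nbhds_separate)
    fix V assume V: "V \<in> \<N>"
    obtain W where W: "W \<in> \<N>" "\<And>x y. x \<in> W \<Longrightarrow> y \<in> W \<Longrightarrow> x + y \<in> V"
      using nbhd_half[OF V] by metis
    obtain c where c: "c > 0" "\<forall>x\<in>E. c *\<^sub>R x \<in> W" using bdd W(1) by (auto simp: bounded_iff)
    obtain n :: nat where n: "n > 0" "1 / real n < c"
      using c(1) by (metis inverse_eq_divide reals_Archimedean zero_less_Suc)
    define F where "F = (\<lambda>x. inf x (real n *\<^sub>R v)) ` E"
    have "\<exists>f\<in>F. d \<le> f \<and> e \<le> f" if "d \<in> F" "e \<in> F" for d e
    proof -
      obtain x where x: "x \<in> E" "d = inf x (real n *\<^sub>R v)"
        using \<open>d \<in> F\<close> by (auto simp: F_def)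
      obtain y where y: "y \<in> E" "e = inf y (real n *\<^sub>R v)"
        using \<open>e \<in> F\<close> by (auto simp: F_def)
      obtain f where "f \<in> E" "x \<le> f" "y \<le> f" using dir x y by blast
      then show ?thesis
        using x y by (intro bexI[of _ "inf f (real n *\<^sub>R v)"]) (auto simp: F_def intro: le_infI1)
    qed
    moreover have "F \<noteq> {}" using E(1) by (simp add: F_def)
    ultimately obtain y where y: "y \<in> F" "real n *\<^sub>R v - y \<in> W"
      using lebesgue_lub[OF _ _ lub[of n, folded F_def] W(1)] by metis
    obtain x where x: "x \<in> E" "y = inf x (real n *\<^sub>R v)" using y(1) by (auto simp: F_def)
    have y0: "0 \<le> y" using E(2)[OF x(1)] x(2) v by (simp add: scaleR_nonneg_nonneg)
    have "(1 / real n) *\<^sub>R x \<in> W" using nbhd_scaleR[OF W(1), of "1 / real n" c x] c(2) x(1) n by simp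
    moreover have "(1 / real n) *\<^sub>R y \<le> (1 / real n) *\<^sub>R x"
      using x(2) by (intro scaleR_left_mono) auto
    moreover have "0 \<le> (1 / real n) *\<^sub>R y" using y0 by (simp add: scaleR_nonneg_nonneg)
    ultimately have "(1 / real n) *\<^sub>R y \<in> W" using nbhd_le[OF W(1)] by blast
    moreover have "(1 / real n) *\<^sub>R (real n *\<^sub>R v - y) \<in> W"
      using nbhd_scaleR[OF W(1), of "1 / real n" 1 "real n *\<^sub>R v - y"] y(2) n(1) by simp
    ultimately have "(1 / real n) *\<^sub>R y + (1 / real n) *\<^sub>R (real n *\<^sub>R v - y) \<in> V" by (rule W(2))
    then show "v \<in> V" using n(1) by (simp add: scaleR_right_diff_distrib)
  qed
  obtain b where b: "\<And>x. x \<in> E \<Longrightarrow> x \<le> b"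
    using universally_complete_bounded[OF uc E small] by blast
  show thesis
    by (rule order_completeD[OF _ E(1) b that]) (use uc in \<open>auto simp: universally_complete_def\<close>)
qed

lemma universally_complete_levi:
  assumes uc: "universally_complete TYPE('a)"
  shows "levi_topology TYPE('i) \<tau>"
  unfolding levi_topology_def
proof (intro allI impI, elim conjE)
  fix A :: "'i set" and r and x :: "'i \<Rightarrow> 'a"
  assume A: "directed_set A r" and pos: "\<forall>a\<in>A. 0 \<le> x a"
    and inc: "increasing_net A r x" and bdd: "tau_bounded \<tau> (x ` A)"
  note dir = increasing_net_range_directed[OF A inc]
  have "x ` A \<noteq> {}" using A by (simp add: directed_set_def)
  moreover have "0 \<le> y" if "y \<in> x ` A" for y using that pos by blast
  ultimately show "\<exists>s. isLub UNIV (x ` A) s"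
    using universally_complete_directed_lub[OF uc _ _ dir bdd] by blast
qed

text \<open>A normal sequence of solid neighbourhoods plays the part of one continuous pseudometric:
  each term contains all sums of two elements of the next.\<close>

definition normal_seq :: "(nat \<Rightarrow> 'a set) \<Rightarrow> bool" where
  "normal_seq V \<longleftrightarrow> (\<forall>n. V n \<in> \<N> \<and> (\<forall>x\<in>V (Suc n). \<forall>y\<in>V (Suc n). x + y \<in> V n))"

lemma normal_seq_nbhd: "normal_seq V \<Longrightarrow> V n \<in> \<N>"
  and normal_seq_add: "normal_seq V \<Longrightarrow> x \<in> V (Suc n) \<Longrightarrow> y \<in> V (Suc n) \<Longrightarrow> x + y \<in> V n"
  by (auto simp: normal_seq_def)

lemma normal_seq_antimono:
  assumes V: "normal_seq V" and "m \<le> n"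
  shows "V n \<subseteq> V m"
proof -
  have "V (Suc n) \<subseteq> V n" for n
    using normal_seq_add[OF V, of _ n 0] nbhd_0[OF normal_seq_nbhd[OF V]] by auto
  then show ?thesis using \<open>m \<le> n\<close> by (rule lift_Suc_antimono_le)
qed

lemma normal_seq_inter: "normal_seq V \<Longrightarrow> normal_seq W \<Longrightarrow> normal_seq (\<lambda>n. V n \<inter> W n)"
  by (auto simp: normal_seq_def solid_nbhds_Int)

lemma normal_seq_exists:
  assumes "U \<in> \<N>"
  obtains V where "normal_seq V" "V 0 = U"
proof -
  have "\<exists>V. \<forall>n. (V n \<in> \<N> \<and> (n = 0 \<longrightarrow> V n = U)) \<and> (\<forall>x\<in>V (Suc n). \<forall>y\<in>V (Suc n). x + y \<in> V n)"
  proof (rule dependent_nat_choice)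
    show "\<exists>x. x \<in> \<N> \<and> (0 = (0::nat) \<longrightarrow> x = U)" using assms by blast
    fix V and n :: nat assume "V \<in> \<N> \<and> (n = 0 \<longrightarrow> V = U)"
    then show "\<exists>W. (W \<in> \<N> \<and> (Suc n = 0 \<longrightarrow> W = U)) \<and> (\<forall>x\<in>W. \<forall>y\<in>W. x + y \<in> V)"
      using nbhd_half[of V] by (metis nat.distinct(1))
  qed
  then show thesis using that unfolding normal_seq_def by blast
qed

lemma normal_seq_sum:
  assumes V: "normal_seq V" and d: "\<And>n. d n \<in> V n"
  shows "(\<Sum>i<k. d (Suc n + i)) \<in> V n"
proof (induction k arbitrary: n)
  case 0
  then show ?case using nbhd_0[OF normal_seq_nbhd[OF V]] by simp
next
  case (Suc k)
  have "(\<Sum>i<Suc k. d (Suc n + i)) = d (Suc n) + (\<Sum>i<k. d (Suc (Suc n) + i))"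
    by (subst sum.lessThan_Suc_shift) simp
  then show ?case using normal_seq_add[OF V d Suc] by simp
qed

text \<open>The limit of a sequence that is Cauchy for a single normal sequence is its limit superior: \<open>s n k\<close>
  is the supremum of \<open>y n, \<dots>, y (n + k)\<close>, and \<open>t n\<close> that of the tail from \<open>n\<close> on. The summability
  built into normal sequences keeps \<open>t n\<close> close to \<open>y n\<close>.\<close>

lemma order_bounded_cauchy_seq:
  assumes oc: "order_complete TYPE('a)" and V: "normal_seq V"
    and y: "\<And>n. 0 \<le> y n" "\<And>n. y n \<le> u" "\<And>n m. n \<le> m \<Longrightarrow> y m - y n \<in> V n"
  obtains z where "0 \<le> z" "z \<le> u" "\<And>n. y (n + 3) - z \<in> V n"
proof -
  define s where "s n k = rec_nat (y n) (\<lambda>k a. sup a (y (n + Suc k))) k" for n k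
  have s_0: "s n 0 = y n" and s_Suc: "s n (Suc k) = sup (s n k) (y (n + Suc k))" for n k
    by (simp_all add: s_def)
  have y_le_s: "y (n + k) \<le> s n k" for n k by (cases k) (simp_all add: s_0 s_Suc)
  have s_le: "s n k \<le> w" if "\<And>m. n \<le> m \<Longrightarrow> y m \<le> w" for n k w
    by (induction k) (simp_all add: s_0 s_Suc that)
  have s_mono: "s n k \<le> s n l" if "k \<le> l" for n k l
    using that by (induction rule: dec_induct) (auto simp: s_Suc intro: le_supI1)
  have s_bound: "s n k - y n \<le> (\<Sum>i<k. \<bar>y (Suc (n + i)) - y (n + i)\<bar>)" for n k
  proof (induction k)
    case (Suc k)
    let ?d = "\<lambda>i. \<bar>y (Suc (n + i)) - y (n + i)\<bar>"
    have "y (n + Suc k) - y n = (\<Sum>i<Suc k. y (Suc (n + i)) - y (n + i))"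
      using sum_lessThan_telescope[of "\<lambda>i. y (n + i)" "Suc k"] by simp
    also have "\<dots> \<le> (\<Sum>i<Suc k. ?d i)" by (intro sum_mono abs_ge_self)
    finally have "y (n + Suc k) \<le> (\<Sum>i<Suc k. ?d i) + y n" by (simp add: diff_le_eq)
    moreover have "(\<Sum>i<k. ?d i) \<le> (\<Sum>i<Suc k. ?d i)" by (simp add: add_increasing2)
    then have "s n k - y n \<le> (\<Sum>i<Suc k. ?d i)" by (rule order_trans[OF Suc])
    then have "s n k \<le> (\<Sum>i<Suc k. ?d i) + y n" by (simp only: diff_le_eq)
    ultimately show ?case unfolding s_Suc diff_le_eq by (rule sup_least[rotated])
  qed (simp add: s_0)
  have s_V: "s (Suc n) k - y (Suc n) \<in> V n" for n k
  proof -
    have "\<bar>y (Suc n) - y n\<bar> \<in> V n" for n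
      using y(3)[of n "Suc n"] nbhd_abs_iff[OF normal_seq_nbhd[OF V]] by simp
    from normal_seq_sum[OF V this]
    have "(\<Sum>i<k. \<bar>y (Suc (Suc n + i)) - y (Suc n + i)\<bar>) \<in> V n" .
    moreover have "0 \<le> s (Suc n) k - y (Suc n)" using s_mono[of 0 k "Suc n"] by (simp add: s_0)
    ultimately show ?thesis using nbhd_le[OF normal_seq_nbhd[OF V]] s_bound by blast
  qed
  have "\<exists>t. isLub UNIV (range (s n)) t" for n
    by (rule order_completeD[OF oc, of "range (s n)" u]) (use s_le[of n u] y(2) in auto)
  then obtain t where t: "\<And>n. isLub UNIV (range (s n)) (t n)" by metis
  have y_le_t: "y m \<le> t n" if "n \<le> m" for m n
  proof -
    have "s n (m - n) \<le> t n" by (rule isLub_upper[OF t]) simp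
    then show ?thesis using y_le_s[of n "m - n"] that by simp
  qed
  have t_le: "t n \<le> w" if "\<And>m. n \<le> m \<Longrightarrow> y m \<le> w" for n w
    by (rule isLub_least[OF t[of n]]) (use s_le[of n w] that in auto)
  have t_mono: "t m \<le> t n" if "n \<le> m" for m n using that by (intro t_le y_le_t) simp
  have t_V: "t (n + 2) - y (n + 2) \<in> V n" for n
  proof -
    have dir: "\<exists>f\<in>range (s (n + 2)). d \<le> f \<and> e \<le> f"
      if de: "d \<in> range (s (n + 2))" "e \<in> range (s (n + 2))" for d e
    proof -
      obtain k l where "d = s (n + 2) k" "e = s (n + 2) l" using de by auto
      then show ?thesis using s_mono by (intro bexI[of _ "s (n + 2) (max k l)"]) auto
    qed
    obtain x where "x \<in> range (s (n + 2))" "t (n + 2) - x \<in> V (Suc n)"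
      by (rule lebesgue_lub[OF _ dir t normal_seq_nbhd[OF V]]) auto
    then obtain k where "t (n + 2) - s (n + 2) k \<in> V (Suc n)" by blast
    moreover have "s (n + 2) k - y (n + 2) \<in> V (Suc n)" using s_V[of "Suc n" k] by simp
    ultimately have "(t (n + 2) - s (n + 2) k) + (s (n + 2) k - y (n + 2)) \<in> V n"
      by (rule normal_seq_add[OF V])
    then show ?thesis by simp
  qed
  have t0: "0 \<le> t n" for n using y_le_t[of n n] y(1)[of n] by simp
  obtain z where z: "isGlb UNIV (range t) z"
    using order_complete_glb[OF oc, of "range t" 0] t0 by blast
  have z_le: "z \<le> t n" for n by (rule isGlb_lower[OF z]) simp
  have z0: "0 \<le> z" by (rule isGlb_greatest[OF z]) (use t0 in auto)
  have zu: "z \<le> u" using z_le[of 0] t_le[of 0 u] y(2) by (meson order_trans)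
  have "y (n + 3) - z \<in> V n" for n
  proof -
    have dir: "\<exists>f\<in>range t. f \<le> d \<and> f \<le> e" if de: "d \<in> range t" "e \<in> range t" for d e
    proof -
      obtain k l where "d = t k" "e = t l" using de by auto
      then show ?thesis using t_mono by (intro bexI[of _ "t (max k l)"]) auto
    qed
    obtain x where "x \<in> range t" "x - z \<in> V (n + 2)"
      by (rule lebesgue_glb[OF _ dir z normal_seq_nbhd[OF V]]) auto
    then obtain k where k: "t k - z \<in> V (n + 2)" by blast
    define m where "m = max k (n + 2)"
    have m: "k \<le> m + 2" "n + 2 \<le> m" by (auto simp: m_def)
    have "t (m + 2) - z \<in> V (n + 2)"
      using nbhd_le[OF normal_seq_nbhd[OF V] _ _ k] z_le t_mono[OF m(1)]
      by (simp add: diff_right_mono)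
    then have 1: "z - t (m + 2) \<in> V (n + 2)"
      using nbhd_diff_commute[OF normal_seq_nbhd[OF V]] by blast
    have 2: "t (m + 2) - y (m + 2) \<in> V (n + 2)"
      using t_V[of m] normal_seq_antimono[OF V m(2)] by blast
    have 3: "y (m + 2) - y (n + 3) \<in> V (Suc n)"
      using y(3)[of "n + 3" "m + 2"] m(2) normal_seq_antimono[OF V, of "Suc n" "n + 3"] by auto
    have "(z - t (m + 2)) + (t (m + 2) - y (m + 2)) \<in> V (Suc n)"
      by (rule normal_seq_add[OF V]) (use 1 2 in simp_all)
    then have "(z - t (m + 2)) + (t (m + 2) - y (m + 2)) + (y (m + 2) - y (n + 3)) \<in> V n"
      using 3 by (rule normal_seq_add[OF V])
    then have "z - y (n + 3) \<in> V n" by simp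
    then show ?thesis using nbhd_diff_commute[OF normal_seq_nbhd[OF V]] by blast
  qed
  then show thesis using z0 zu that by blast
qed

lemma eventually_cauchy:
  assumes A: "directed_set A r" and x: "cauchy_net \<tau> A r x" and V: "V \<in> \<N>"
  obtains a where "a \<in> A" "\<And>b c. b \<in> A \<Longrightarrow> c \<in> A \<Longrightarrow> r a b \<Longrightarrow> r a c \<Longrightarrow> x b - x c \<in> V"
  using x V unfolding cauchy_iff[OF A] by blast

lemma cauchy_net_comp:
  assumes A: "directed_set A r" and x: "cauchy_net \<tau> A r x"
    and f: "\<And>v w. \<bar>f v - f w\<bar> \<le> \<bar>v - w\<bar>"
  shows "cauchy_net \<tau> A r (\<lambda>a. f (x a))"
  unfolding cauchy_iff[OF A]
proof
  fix V assume V: "V \<in> \<N>"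
  obtain a where a: "a \<in> A" "\<And>b c. b \<in> A \<Longrightarrow> c \<in> A \<Longrightarrow> r a b \<Longrightarrow> r a c \<Longrightarrow> x b - x c \<in> V"
    using eventually_cauchy[OF A x V] by blast
  then show "\<exists>a\<in>A. \<forall>b\<in>A. \<forall>c\<in>A. r a b \<longrightarrow> r a c \<longrightarrow> f (x b) - f (x c) \<in> V"
    using solidD[OF nbhd_solid[OF V] f] by blast
qed

lemma cauchy_normal_seq_limit:
  assumes oc: "order_complete TYPE('a)" and A: "directed_set A r"
    and x: "cauchy_net \<tau> A r x" "\<And>a. a \<in> A \<Longrightarrow> 0 \<le> x a" "\<And>a. a \<in> A \<Longrightarrow> x a \<le> u"
    and V: "normal_seq V"
  obtains z where "0 \<le> z" "z \<le> u" "\<And>n. eventually (\<lambda>a. x a - z \<in> V n) (tails A r)"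
proof -
  have "\<exists>\<alpha>. \<forall>n. (\<alpha> n \<in> A \<and> (\<forall>b\<in>A. \<forall>c\<in>A. r (\<alpha> n) b \<longrightarrow> r (\<alpha> n) c \<longrightarrow> x b - x c \<in> V n))
      \<and> r (\<alpha> n) (\<alpha> (Suc n))"
  proof (rule dependent_nat_choice)
    show "\<exists>a. a \<in> A \<and> (\<forall>b\<in>A. \<forall>c\<in>A. r a b \<longrightarrow> r a c \<longrightarrow> x b - x c \<in> V 0)"
      using eventually_cauchy[OF A x(1) normal_seq_nbhd[OF V]] by metis
    fix a n
    assume a: "a \<in> A \<and> (\<forall>b\<in>A. \<forall>c\<in>A. r a b \<longrightarrow> r a c \<longrightarrow> x b - x c \<in> V n)"
    obtain e where e: "e \<in> A"
      "\<And>b c. b \<in> A \<Longrightarrow> c \<in> A \<Longrightarrow> r e b \<Longrightarrow> r e c \<Longrightarrow> x b - x c \<in> V (Suc n)"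
      using eventually_cauchy[OF A x(1) normal_seq_nbhd[OF V]] by metis
    obtain d where d: "d \<in> A" "r a d" "r e d" using directed_upper[OF A] a e(1) by metis
    have "x b - x c \<in> V (Suc n)" if "b \<in> A" "c \<in> A" "r d b" "r d c" for b c
      using that d e directed_trans[OF A] by metis
    then show "\<exists>d. (d \<in> A \<and> (\<forall>b\<in>A. \<forall>c\<in>A. r d b \<longrightarrow> r d c \<longrightarrow> x b - x c \<in> V (Suc n))) \<and> r a d"
      using d by blast
  qed
  then obtain \<alpha> where \<alpha>: "\<And>n. \<alpha> n \<in> A"
    "\<And>n b c. b \<in> A \<Longrightarrow> c \<in> A \<Longrightarrow> r (\<alpha> n) b \<Longrightarrow> r (\<alpha> n) c \<Longrightarrow> x b - x c \<in> V n"
    "\<And>n. r (\<alpha> n) (\<alpha> (Suc n))"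
    by blast
  have mono: "r (\<alpha> n) (\<alpha> m)" if "n \<le> m" for n m
    using that
  proof (induction rule: dec_induct)
    case base
    then show ?case using directed_refl[OF A \<alpha>(1)] .
  next
    case (step m)
    show ?case by (rule directed_trans[OF A step.IH \<alpha>(3) \<alpha>(1) \<alpha>(1) \<alpha>(1)])
  qed
  have diff: "x (\<alpha> m) - x (\<alpha> n) \<in> V n" if "n \<le> m" for n m
    by (rule \<alpha>(2)) (use \<alpha>(1) mono that in auto)
  obtain z where z: "0 \<le> z" "z \<le> u" "\<And>n. x (\<alpha> (n + 3)) - z \<in> V n"
    using order_bounded_cauchy_seq[OF oc V, of "\<lambda>n. x (\<alpha> n)" u] x(2,3)[OF \<alpha>(1)] diff by metis
  have "eventually (\<lambda>a. x a - z \<in> V n) (tails A r)" for n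
    unfolding eventually_tails[OF A]
  proof (intro bexI[of _ "\<alpha> (Suc n + 3)"] ballI impI \<alpha>(1))
    fix b assume b: "b \<in> A" "r (\<alpha> (Suc n + 3)) b"
    have "x b - x (\<alpha> (Suc n + 3)) \<in> V (Suc n + 3)"
      by (rule \<alpha>(2)) (use b \<alpha>(1) directed_refl[OF A] in auto)
    then have 1: "x b - x (\<alpha> (Suc n + 3)) \<in> V (Suc n)"
      using normal_seq_antimono[OF V, of "Suc n" "Suc n + 3"] by auto
    have "(x b - x (\<alpha> (Suc n + 3))) + (x (\<alpha> (Suc n + 3)) - z) \<in> V n"
      by (rule normal_seq_add[OF V 1 z(3)])
    then show "x b - z \<in> V n" by simp
  qed
  then show thesis using z(1,2) that by blast
qed

text \<open>Order intervals of an order complete space are \<open>\<tau>\<close>-complete. For a normal sequence \<open>V\<close> let \<open>L V\<close>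
  be the set of its limits in \<open>{0..u}\<close>. It is nonempty, closed and stable under \<open>inf\<close>, so it has a least
  element \<open>m V\<close>. Refining \<open>V\<close> shrinks \<open>L V\<close> and increases \<open>m V\<close>, and the supremum of all \<open>m V\<close> lies in
  every \<open>L V\<close>: it is a limit for \<open>\<tau>\<close>.\<close>

lemma order_bounded_cauchy_net:
  assumes oc: "order_complete TYPE('a)" and A: "directed_set A r"
    and x: "cauchy_net \<tau> A r x" "\<And>a. a \<in> A \<Longrightarrow> 0 \<le> x a" "\<And>a. a \<in> A \<Longrightarrow> x a \<le> u"
  obtains z where "0 \<le> z" "z \<le> u" "\<And>V. V \<in> \<N> \<Longrightarrow> eventually (\<lambda>a. x a - z \<in> V) (tails A r)"
proof -
  define L where
    "L V = {z. 0 \<le> z \<and> z \<le> u \<and> (\<forall>n. eventually (\<lambda>a. x a - z \<in> V n) (tails A r))}"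
    for V :: "nat \<Rightarrow> 'a set"
  have L_add: "eventually (\<lambda>a. x a - w \<in> V n) (tails A r)"
    if V: "normal_seq V" and z: "eventually (\<lambda>a. x a - z \<in> V (Suc n)) (tails A r)"
      and w: "z - w \<in> V (Suc n)" for V z w n
    using z
  proof eventually_elim
    case (elim a)
    have "(x a - z) + (z - w) \<in> V n" by (rule normal_seq_add[OF V elim w])
    then show ?case by simp
  qed
  have least: "\<exists>m. m \<in> L V \<and> (\<forall>z\<in>L V. m \<le> z)" if V: "normal_seq V" for V
  proof -
    have ne: "L V \<noteq> {}"
      using cauchy_normal_seq_limit[OF oc A x V] unfolding L_def by blast
    have dir: "\<exists>f\<in>L V. f \<le> z \<and> f \<le> w" if zw: "z \<in> L V" "w \<in> L V" for z w
    proof (intro bexI[of _ "inf z w"] conjI inf_le1 inf_le2)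
      have "eventually (\<lambda>a. x a - inf z w \<in> V n) (tails A r)" for n
      proof -
        have "eventually (\<lambda>a. x a - z \<in> V (Suc n)) (tails A r)"
          "eventually (\<lambda>a. x a - w \<in> V (Suc n)) (tails A r)"
          using zw by (auto simp: L_def)
        then show ?thesis
        proof eventually_elim
          case (elim a)
          then have "\<bar>x a - z\<bar> + \<bar>x a - w\<bar> \<in> V n"
            by (intro normal_seq_add[OF V]) (simp_all add: nbhd_abs_iff[OF normal_seq_nbhd[OF V]])
          then show ?case by (rule nbhd_abs_le[OF normal_seq_nbhd[OF V] abs_diff_inf_le])
        qed
      qed
      then show "inf z w \<in> L V" using zw by (auto simp: L_def le_infI1)
    qed
    have pos: "0 \<le> z" "z \<le> u" if "z \<in> L V" for z using that by (auto simp: L_def)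
    obtain m where m: "isGlb UNIV (L V) m" using order_complete_glb[OF oc ne pos(1)] by blast
    have "0 \<le> m" by (rule isGlb_greatest[OF m pos(1)])
    moreover have "m \<le> u" using ne isGlb_lower[OF m] pos(2) by (meson ex_in_conv order_trans)
    moreover have "eventually (\<lambda>a. x a - m \<in> V n) (tails A r)" for n
    proof -
      obtain z where z: "z \<in> L V" "z - m \<in> V (Suc n)"
        by (rule lebesgue_glb[OF ne dir m normal_seq_nbhd[OF V]])
      show ?thesis by (rule L_add[OF V _ z(2)]) (use z(1) in \<open>simp add: L_def\<close>)
    qed
    ultimately have "m \<in> L V" by (simp add: L_def)
    then show ?thesis using isGlb_lower[OF m] by blast
  qed
  define m where "m V = (SOME m. m \<in> L V \<and> (\<forall>z\<in>L V. m \<le> z))" for V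
  have m: "m V \<in> L V" "\<And>z. z \<in> L V \<Longrightarrow> m V \<le> z" if "normal_seq V" for V
    using someI_ex[OF least[OF that]] by (auto simp: m_def)
  have L_mono: "L (\<lambda>n. V n \<inter> W n) \<subseteq> L V" "L (\<lambda>n. V n \<inter> W n) \<subseteq> L W" for V W
    unfolding L_def by (auto elim: eventually_mono)
  define M where "M = {m V | V. normal_seq V}"
  have up: "m V \<le> m (\<lambda>n. V n \<inter> W n)" "m W \<le> m (\<lambda>n. V n \<inter> W n)" "m (\<lambda>n. V n \<inter> W n) \<in> M"
    "m (\<lambda>n. V n \<inter> W n) \<in> L W"
    if "normal_seq V" "normal_seq W" for V W
    using m[OF that(1)] m[OF that(2)] m[OF normal_seq_inter[OF that]] L_mono[of V W]
      normal_seq_inter[OF that] by (auto simp: M_def)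
  have dir: "\<exists>f\<in>M. d \<le> f \<and> e \<le> f" if "d \<in> M" "e \<in> M" for d e
  proof -
    obtain V where V: "normal_seq V" "d = m V" using \<open>d \<in> M\<close> by (auto simp: M_def)
    obtain W where W: "normal_seq W" "e = m W" using \<open>e \<in> M\<close> by (auto simp: M_def)
    show ?thesis using up[OF V(1) W(1)] V(2) W(2) by blast
  qed
  have M_bound: "0 \<le> d" "d \<le> u" if "d \<in> M" for d
    using that m(1) by (auto simp: M_def L_def)
  have seq: "\<exists>V. normal_seq V \<and> V 0 = U" if "U \<in> \<N>" for U
    using normal_seq_exists[OF that] by blast
  have "UNIV \<in> \<N>" using topspace_locally_solid[OF ls] openin_topspace[of \<tau>]
    by (auto simp: solid_nbhds_def solid_def)
  then have ne: "M \<noteq> {}" using seq by (auto simp: M_def)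
  obtain z where z: "isLub UNIV M z" by (rule order_completeD[OF oc ne M_bound(2)])
  have "0 \<le> z" using ne M_bound(1) isLub_upper[OF z] by (meson ex_in_conv order_trans)
  moreover have "z \<le> u" by (rule isLub_least[OF z M_bound(2)])
  moreover have "eventually (\<lambda>a. x a - z \<in> U) (tails A r)" if U: "U \<in> \<N>" for U
  proof -
    obtain W where W: "normal_seq W" "W 0 = U" using seq[OF U] by blast
    obtain d where d: "d \<in> M" "z - d \<in> W (Suc 0)"
      by (rule lebesgue_lub[OF ne dir z normal_seq_nbhd[OF W(1)]])
    obtain V where V: "normal_seq V" "d = m V" using d(1) by (auto simp: M_def)
    define e where "e = m (\<lambda>n. V n \<inter> W n)"
    have e: "d \<le> e" "e \<in> M" "e \<in> L W" using up[OF V(1) W(1)] V(2) by (auto simp: e_def)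
    have "z - e \<in> W (Suc 0)"
      by (rule nbhd_le[OF normal_seq_nbhd[OF W(1)] _ _ d(2)])
        (use isLub_upper[OF z e(2)] e(1) in \<open>auto intro: diff_left_mono\<close>)
    then have ez: "e - z \<in> W (Suc 0)"
      using nbhd_diff_commute[OF normal_seq_nbhd[OF W(1)]] by blast
    have "eventually (\<lambda>a. x a - z \<in> W 0) (tails A r)"
      by (rule L_add[OF W(1) _ ez]) (use e(3) in \<open>simp add: L_def\<close>)
    then show ?thesis using W(2) by simp
  qed
  ultimately show thesis by (rule that)
qed

text \<open>The truncations at \<open>u\<close> of the net converge, to \<open>f u\<close> say. The values \<open>f u\<close> form a \<open>\<tau>\<close>-bounded
  directed set, whose supremum \<open>z\<close> satisfies \<open>f (z + u) = z\<close>. So \<open>inf (x a) (z + u)\<close> converges to \<open>z\<close>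
  for every \<open>u\<close>, which by unboundedness is convergence of the net itself.\<close>

lemma universally_complete_positive_cauchy:
  assumes uc: "universally_complete TYPE('a)" and A: "directed_set A r"
    and x: "cauchy_net \<tau> A r x" "\<And>a. a \<in> A \<Longrightarrow> 0 \<le> x a"
  shows "\<exists>z. limitin \<tau> x z (tails A r)"
proof -
  let ?F = "tails A r"
  have oc: "order_complete TYPE('a)" using uc by (simp add: universally_complete_def)
  note F = tails_not_bot[OF A]
  have inA: "eventually (\<lambda>a. a \<in> A) ?F"
    using A by (auto simp: eventually_tails directed_set_def)
  have "\<exists>z. 0 \<le> z \<and> z \<le> u \<and> (\<forall>V\<in>\<N>. eventually (\<lambda>a. inf (x a) u - z \<in> V) ?F)"
    if u: "0 \<le> u" for u
    using order_bounded_cauchy_net[OF oc A cauchy_net_comp[OF A x(1) abs_inf_diff_le[of _ u]], of u]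
      x(2) u by (metis inf_le2 le_inf_iff)
  then obtain f where f0: "\<And>u. 0 \<le> u \<Longrightarrow> 0 \<le> f u" and fu: "\<And>u. 0 \<le> u \<Longrightarrow> f u \<le> u"
    and f: "\<And>u V. 0 \<le> u \<Longrightarrow> V \<in> \<N> \<Longrightarrow> eventually (\<lambda>a. inf (x a) u - f u \<in> V) ?F"
    by metis
  have f_mono: "f u \<le> f v" if "0 \<le> u" "u \<le> v" for u v
  proof (rule limit_mono[OF F f f, of u v])
    show "eventually (\<lambda>a. inf (x a) u \<le> inf (x a) v) ?F"
      using that by (intro always_eventually allI inf_mono order_refl)
  qed (use that in auto)
  have f_trunc: "inf (f v) u \<le> f u" if u: "0 \<le> u" "u \<le> v" for u v
  proof (rule limit_mono[OF F _ f[OF u(1)], of "\<lambda>a. inf (inf (x a) v) u"])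
    fix V assume V: "V \<in> \<N>"
    show "eventually (\<lambda>a. inf (inf (x a) v) u - inf (f v) u \<in> V) ?F"
      using f[OF order_trans[OF u] V]
      by eventually_elim (rule solidD[OF nbhd_solid[OF V] abs_inf_diff_le])
  qed (auto intro!: always_eventually simp: u(2) inf_absorb2 inf_assoc)
  define E where "E = f ` {u. 0 \<le> u}"
  have "tau_bounded \<tau> E"
    unfolding bounded_iff
  proof
    fix V assume V: "V \<in> \<N>"
    obtain W where W: "W \<in> \<N>" "\<And>x y. x \<in> W \<Longrightarrow> y \<in> W \<Longrightarrow> x + y \<in> V"
      using nbhd_half[OF V] by metis
    obtain Z where Z: "Z \<in> \<N>" "\<And>x y. x \<in> Z \<Longrightarrow> y \<in> Z \<Longrightarrow> x + y \<in> W"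
      using nbhd_half[OF W(1)] by metis
    obtain a where a: "a \<in> A"
      "\<And>b c. b \<in> A \<Longrightarrow> c \<in> A \<Longrightarrow> r a b \<Longrightarrow> r a c \<Longrightarrow> x b - x c \<in> Z"
      using eventually_cauchy[OF A x(1) Z(1)] by blast
    obtain c where c: "c > 0" "c *\<^sub>R x a \<in> W" using nbhd_absorb[OF W(1)] by blast
    define d where "d = min c 1"
    have d: "0 < d" "d \<le> c" "d \<le> 1" using c(1) by (auto simp: d_def)
    have "d *\<^sub>R f u \<in> V" if u: "0 \<le> u" for u
    proof -
      have "eventually (\<lambda>b. b \<in> A \<and> r a b) ?F"
        using a(1) unfolding eventually_tails[OF A] by blast
      then have "eventually (\<lambda>b. inf (x b) u - f u \<in> Z \<and> b \<in> A \<and> r a b) ?F"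
        using f[OF u Z(1)] by eventually_elim auto
      then obtain b where b: "inf (x b) u - f u \<in> Z" "b \<in> A" "r a b"
        using eventually_happens'[OF F] by blast
      have "x b - x a \<in> Z" using a b directed_refl[OF A a(1)] by blast
      then have "\<bar>inf (x b) u - f u\<bar> + \<bar>x b - x a\<bar> \<in> W"
        using b(1) by (intro Z(2)) (simp_all add: nbhd_abs_iff[OF Z(1)])
      then have "1 *\<^sub>R (\<bar>inf (x b) u - f u\<bar> + \<bar>x b - x a\<bar>) \<in> W" by simp
      then have "d *\<^sub>R (\<bar>inf (x b) u - f u\<bar> + \<bar>x b - x a\<bar>) \<in> W"
        by (rule nbhd_scaleR[OF W(1), rotated]) (use d in simp)
      moreover have "d *\<^sub>R x a \<in> W" by (rule nbhd_scaleR[OF W(1) _ c(2)]) (use d in simp)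
      ultimately have
        "d *\<^sub>R (\<bar>inf (x b) u - f u\<bar> + \<bar>x b - x a\<bar>) + d *\<^sub>R x a \<in> V" by (rule W(2))
      moreover have "f u \<le> (\<bar>inf (x b) u - f u\<bar> + \<bar>x b - x a\<bar>) + x a"
      proof -
        have "f u = - (inf (x b) u - f u) + inf (x b) u" by (simp only: minus_diff_eq diff_add_cancel)
        also have "\<dots> \<le> \<bar>inf (x b) u - f u\<bar> + ((x b - x a) + x a)"
          by (intro add_mono abs_ge_minus_self) simp
        also have "\<dots> \<le> \<bar>inf (x b) u - f u\<bar> + (\<bar>x b - x a\<bar> + x a)"
          by (intro add_mono abs_ge_self order_refl)
        finally show ?thesis by (simp only: add.assoc)
      qed
      then have "d *\<^sub>R f u \<le> d *\<^sub>R ((\<bar>inf (x b) u - f u\<bar> + \<bar>x b - x a\<bar>) + x a)"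
        using d(1) by (intro scaleR_left_mono) auto
      moreover have "0 \<le> d *\<^sub>R f u" using f0[OF u] d(1) by (simp add: scaleR_nonneg_nonneg)
      ultimately show ?thesis using nbhd_le[OF V] by (simp only: scaleR_right_distrib)
    qed
    then show "\<exists>c>0. \<forall>x\<in>E. c *\<^sub>R x \<in> V" using d(1) by (auto simp: E_def)
  qed
  moreover have "\<exists>g\<in>E. d \<le> g \<and> e \<le> g" if de: "d \<in> E" "e \<in> E" for d e
  proof -
    obtain u where u: "0 \<le> u" "d = f u" using de(1) by (auto simp: E_def)
    obtain v where v: "0 \<le> v" "e = f v" using de(2) by (auto simp: E_def)
    have s: "0 \<le> sup u v" using u(1) by (rule le_supI1)
    have "d \<le> f (sup u v)" "e \<le> f (sup u v)" using f_mono u v by auto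
    then show ?thesis using s by (auto simp: E_def)
  qed
  moreover have "E \<noteq> {}" by (auto simp: E_def)
  moreover have "0 \<le> e" if "e \<in> E" for e using that f0 by (auto simp: E_def)
  ultimately obtain z where z: "isLub UNIV E z"
    using universally_complete_directed_lub[OF uc, of E] by blast
  have fz: "f u \<le> z" if "0 \<le> u" for u
    by (rule isLub_upper[OF z]) (use that in \<open>auto simp: E_def\<close>)
  have z0: "0 \<le> z" using fz[of 0] f0[of 0] by simp
  have f_eq: "f (z + u) = z" if u: "0 \<le> u" for u
  proof (rule order.antisym)
    have w: "0 \<le> z + u" using z0 u by simp
    show "f (z + u) \<le> z" by (rule fz[OF w])
    have "inf z (z + u) \<le> f (z + u)"
    proof (rule isLub_least[OF isLub_inf[OF z]])
      fix y assume "y \<in> (\<lambda>e. inf e (z + u)) ` E"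
      then obtain v where v: "0 \<le> v" "y = inf (f v) (z + u)" by (auto simp: E_def)
      have "y \<le> inf (f (sup v (z + u))) (z + u)"
        unfolding v(2) by (intro inf_mono f_mono) (use v(1) in auto)
      also have "\<dots> \<le> f (z + u)" by (rule f_trunc[OF w]) simp
      finally show "y \<le> f (z + u)" .
    qed
    then show "z \<le> f (z + u)" using u by (simp add: inf_absorb1)
  qed
  have "eventually (\<lambda>a. x a - z \<in> V) ?F" if V: "V \<in> \<N>" for V
  proof -
    obtain u W where u: "0 \<le> u" and W: "W \<in> \<N>" "\<forall>x. inf \<bar>x\<bar> u \<in> W \<longrightarrow> x \<in> V"
      using unbounded[OF V] by blast
    have "0 \<le> z + u" using z0 u by simp
    from f[OF this W(1)] have "eventually (\<lambda>a. inf (x a) (z + u) - z \<in> W) ?F"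
      by (simp only: f_eq[OF u])
    then show ?thesis
    proof eventually_elim
      case (elim a)
      then have "\<bar>inf (x a) (z + u) - z\<bar> \<in> W" by (simp only: nbhd_abs_iff[OF W(1)])
      then have "inf \<bar>x a - z\<bar> u \<in> W"
        by (rule nbhd_le[OF W(1) _ inf_abs_le[OF u], rotated]) (use u in simp)
      then show ?case using W(2) by blast
    qed
  qed
  then show ?thesis unfolding limitin_iff by blast
qed

lemma universally_complete_complete:
  assumes uc: "universally_complete TYPE('a)"
  shows "complete_topology TYPE('i) \<tau>"
  unfolding complete_topology_def
proof (intro allI impI, elim conjE)
  fix A :: "'i set" and r and x :: "'i \<Rightarrow> 'a"
  assume A: "directed_set A r" and x: "cauchy_net \<tau> A r x"
  have neg: "\<bar>pprt (- v) - pprt (- w)\<bar> \<le> \<bar>v - w\<bar>" for v w :: 'a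
    using pprt_diff_abs_le[of "- v" "- w"] abs_minus_commute[of v w] by simp
  obtain p where p: "limitin \<tau> (\<lambda>a. pprt (x a)) p (tails A r)"
    using universally_complete_positive_cauchy[OF uc A cauchy_net_comp[OF A x pprt_diff_abs_le]]
    by auto
  obtain q where q: "limitin \<tau> (\<lambda>a. pprt (- x a)) q (tails A r)"
    using universally_complete_positive_cauchy[OF uc A cauchy_net_comp[OF A x neg]] by auto
  have "eventually (\<lambda>a. x a - (p - q) \<in> V) (tails A r)" if V: "V \<in> \<N>" for V
  proof -
    obtain W where W: "W \<in> \<N>" "\<And>x y. x \<in> W \<Longrightarrow> y \<in> W \<Longrightarrow> x + y \<in> V"
      using nbhd_half[OF V] by metis
    have "eventually (\<lambda>a. pprt (x a) - p \<in> W) (tails A r)"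
      "eventually (\<lambda>a. pprt (- x a) - q \<in> W) (tails A r)"
      using p q W(1) unfolding limitin_iff by auto
    then show ?thesis
    proof eventually_elim
      case (elim a)
      then have "(pprt (x a) - p) + (q - pprt (- x a)) \<in> V"
        using W(2) nbhd_diff_commute[OF W(1)] by blast
      moreover have "(pprt (x a) - p) + (q - pprt (- x a)) = (pprt (x a) - pprt (- x a)) - (p - q)"
        by (simp only: diff_conv_add_uminus minus_add_distrib minus_minus ac_simps)
      ultimately show ?case by (simp only: pprt_minus_pprt)
    qed
  qed
  then show "\<exists>l. limitin \<tau> x l (tails A r)" unfolding limitin_iff by blast
qed

end

section \<open>Monotone completeness and universal completeness\<close>

context minimal_archimedean
begin

lemma monotone_limit_isLub:
  assumes A: "directed_set A r" and x: "increasing_net A r x" and l: "limitin \<tau> x l (tails A r)"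
  shows "isLub UNIV (x ` A) l"
  unfolding isLub_UNIV_iff
proof (intro conjI ballI allI impI)
  have l: "eventually (\<lambda>a. x a - l \<in> V) (tails A r)" if "V \<in> \<N>" for V
    using l that unfolding limitin_iff by blast
  have const: "eventually (\<lambda>a. c - c \<in> V) (tails A r)" if "V \<in> \<N>" for V and c :: 'a
    using nbhd_0[OF that] by simp
  fix y assume "y \<in> x ` A"
  then obtain a where a: "a \<in> A" "y = x a" by blast
  show "y \<le> l"
  proof (rule limit_mono[OF tails_not_bot[OF A] const l])
    show "eventually (\<lambda>b. y \<le> x b) (tails A r)"
      using a x unfolding eventually_tails[OF A] increasing_net_def by blast
  qed
next
  have l: "eventually (\<lambda>a. x a - l \<in> V) (tails A r)" if "V \<in> \<N>" for V
    using l that unfolding limitin_iff by blast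
  have const: "eventually (\<lambda>a. c - c \<in> V) (tails A r)" if "V \<in> \<N>" for V and c :: 'a
    using nbhd_0[OF that] by simp
  fix w assume w: "\<forall>y\<in>x ` A. y \<le> w"
  show "l \<le> w"
  proof (rule limit_mono[OF tails_not_bot[OF A] l const])
    show "eventually (\<lambda>b. x b \<le> w) (tails A r)"
      using w A unfolding eventually_tails[OF A] directed_set_def by blast
  qed
qed

lemma monotone_complete_lub:
  fixes E :: "'a set"
  assumes mcp: "monotone_complete_topology TYPE('a net_index) \<tau>"
    and E: "E \<noteq> {}" "\<And>x. x \<in> E \<Longrightarrow> 0 \<le> x"
    and dir: "\<And>d e. d \<in> E \<Longrightarrow> e \<in> E \<Longrightarrow> \<exists>f\<in>E. d \<le> f \<and> e \<le> f"
    and cauchy: "\<And>V. V \<in> \<N> \<Longrightarrow> \<exists>x\<in>E. \<forall>y\<in>E. x \<le> y \<longrightarrow> y - x \<in> V"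
  obtains s where "isLub UNIV E s"
proof -
  have A: "directed_set E (\<le>)"
    using E(1) dir by (auto simp: directed_set_def reflp_on_def transp_on_def)
  have inc: "increasing_net E (\<le>) (\<lambda>x. x)" by (simp add: increasing_net_def)
  have cau: "cauchy_net \<tau> E (\<le>) (\<lambda>x. x)"
    unfolding cauchy_iff[OF A]
  proof
    fix V assume V: "V \<in> \<N>"
    obtain W where W: "W \<in> \<N>" "\<And>x y. x \<in> W \<Longrightarrow> y \<in> W \<Longrightarrow> x + y \<in> V"
      using nbhd_half[OF V] by metis
    obtain x where x: "x \<in> E" "\<forall>y\<in>E. x \<le> y \<longrightarrow> y - x \<in> W" using cauchy[OF W(1)] by blast
    have "y - z \<in> V" if "y \<in> E" "z \<in> E" "x \<le> y" "x \<le> z" for y z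
    proof -
      have "(y - x) + (x - z) \<in> V"
        by (rule W(2)) (use x that nbhd_diff_commute[OF W(1)] in auto)
      then show ?thesis by simp
    qed
    then show "\<exists>a\<in>E. \<forall>b\<in>E. \<forall>c\<in>E. a \<le> b \<longrightarrow> a \<le> c \<longrightarrow> b - c \<in> V" using x(1) by blast
  qed
  have "monotone_complete_topology TYPE('a) \<tau>"
    by (rule monotone_complete_topology_any_index[OF mcp])
  then obtain l where "limitin \<tau> (\<lambda>x. x) l (tails E (\<le>))"
    using A E(2) inc cau unfolding monotone_complete_topology_def by meson
  from monotone_limit_isLub[OF A inc this] show thesis using that by simp
qed

lemma monotone_complete_order_complete:
  assumes mcp: "monotone_complete_topology TYPE('a net_index) \<tau>"
  shows "order_complete TYPE('a)"
  unfolding order_complete_def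
proof (intro allI impI, elim conjE exE)
  fix S :: "'a set" and u assume "S \<noteq> {}" "isUb UNIV S u"
  then obtain s where s: "s \<in> S" and u: "\<And>x. x \<in> S \<Longrightarrow> x \<le> u" by (auto simp: isUb_UNIV_iff)
  \<comment> \<open>The translates by \<open>- s\<close> of the elements above \<open>s\<close> and below all upper bounds of \<open>S\<close>.
      Unlike \<open>S\<close> they form a directed set.\<close>
  define E where "E = {y. 0 \<le> y \<and> (\<forall>w. (\<forall>x\<in>S. x \<le> w) \<longrightarrow> y + s \<le> w)}"
  have E_ne: "E \<noteq> {}" using s by (auto simp: E_def intro!: exI[of _ 0])
  have E_dir: "\<exists>f\<in>E. d \<le> f \<and> e \<le> f" if "d \<in> E" "e \<in> E" for d e
    using that by (intro bexI[of _ "sup d e"]) (auto simp: E_def add_sup_distrib_right le_supI1)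
  have E_ub: "y \<le> u - s" if "y \<in> E" for y using that u by (auto simp: E_def le_diff_eq)
  obtain t where t: "isLub UNIV E t"
  proof (rule monotone_complete_lub[OF mcp E_ne _ E_dir])
    fix V assume V: "V \<in> \<N>"
    obtain w x where wx: "x \<in> E" "\<And>y. y \<in> E \<Longrightarrow> y \<le> w" "w - x \<in> V"
      using upper_bound_minus_directed[OF E_ne E_dir E_ub V] by blast
    have "y - x \<in> V" if "y \<in> E" "x \<le> y" for y
      by (rule nbhd_le[OF V _ _ wx(3)]) (use wx(2) that in \<open>auto intro: diff_right_mono\<close>)
    then show "\<exists>x\<in>E. \<forall>y\<in>E. x \<le> y \<longrightarrow> y - x \<in> V" using wx(1) by blast
  qed (auto simp: E_def)
  have "x \<le> t + s" if x: "x \<in> S" for x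
  proof -
    have "sup x s - s \<in> E" using x s by (auto simp: E_def)
    from isLub_upper[OF t this] have "sup x s \<le> t + s" by (simp only: diff_le_eq)
    then show ?thesis by simp
  qed
  moreover have "t + s \<le> w" if w: "\<forall>x\<in>S. x \<le> w" for w
  proof -
    have "t \<le> w - s" by (rule isLub_least[OF t]) (use w in \<open>auto simp: E_def le_diff_eq\<close>)
    then show ?thesis by (simp only: le_diff_eq)
  qed
  ultimately show "\<exists>t. isLub UNIV S t" unfolding isLub_UNIV_iff by blast
qed

text \<open>The finite sums \<open>\<Sum>T\<close> of a disjoint set form an increasing net with the same upper bounds. By
  disjointness its increments, truncated at \<open>u\<close>, are increments of the order bounded net \<open>inf (\<Sum>T) u\<close>;
  so it is Cauchy since \<open>\<tau>\<close> is unbounded.\<close>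

lemma monotone_complete_laterally_complete:
  assumes mcp: "monotone_complete_topology TYPE('a net_index) \<tau>"
  shows "laterally_complete TYPE('a)"
  unfolding laterally_complete_def
proof (intro allI impI, elim conjE)
  fix S :: "'a set" assume S: "S \<noteq> {}" "\<forall>x\<in>S. 0 \<le> x" "pairwise (\<lambda>x y. inf x y = 0) S"
  define E where "E = {\<Sum>T | T. finite T \<and> T \<subseteq> S}"
  have mono: "\<Sum>T \<le> \<Sum>T'" if "T \<subseteq> T'" "finite T'" "T' \<subseteq> S" for T T' :: "'a set"
    by (rule sum_mono2) (use that S(2) in auto)
  have E_ne: "E \<noteq> {}" by (auto simp: E_def)
  have E_pos: "0 \<le> y" if "y \<in> E" for y
    using that S(2) by (auto simp: E_def intro!: sum_nonneg)
  have union: "\<Sum>(T \<union> T') \<in> E" "\<Sum>T \<le> \<Sum>(T \<union> T')" "\<Sum>T' \<le> \<Sum>(T \<union> T')"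
    if "finite T" "T \<subseteq> S" "finite T'" "T' \<subseteq> S" for T T'
    using that by (auto simp: E_def intro!: mono)
  have E_dir: "\<exists>f\<in>E. d \<le> f \<and> e \<le> f" if "d \<in> E" "e \<in> E" for d e
  proof -
    obtain T where T: "finite T" "T \<subseteq> S" "d = \<Sum>T" using \<open>d \<in> E\<close> by (auto simp: E_def)
    obtain T' where T': "finite T'" "T' \<subseteq> S" "e = \<Sum>T'" using \<open>e \<in> E\<close> by (auto simp: E_def)
    show ?thesis using union[OF T(1,2) T'(1,2)] T(3) T'(3) by blast
  qed
  obtain t where t: "isLub UNIV E t"
  proof (rule monotone_complete_lub[OF mcp E_ne E_pos E_dir])
    fix V assume V: "V \<in> \<N>"
    obtain u W where u: "0 \<le> u" and W: "W \<in> \<N>" "\<forall>x. inf \<bar>x\<bar> u \<in> W \<longrightarrow> x \<in> V"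
      using unbounded[OF V] by blast
    define E' where "E' = (\<lambda>y. inf y u) ` E"
    have E'_ne: "E' \<noteq> {}" using E_ne by (simp add: E'_def)
    have E'_dir: "\<exists>f\<in>E'. d \<le> f \<and> e \<le> f" if "d \<in> E'" "e \<in> E'" for d e
    proof -
      obtain x where x: "x \<in> E" "d = inf x u" using \<open>d \<in> E'\<close> by (auto simp: E'_def)
      obtain y where y: "y \<in> E" "e = inf y u" using \<open>e \<in> E'\<close> by (auto simp: E'_def)
      obtain f where "f \<in> E" "x \<le> f" "y \<le> f" using E_dir x(1) y(1) by blast
      then show ?thesis
        using x y by (intro bexI[of _ "inf f u"]) (auto simp: E'_def intro: le_infI1)
    qed
    have E'_ub: "y \<le> u" if "y \<in> E'" for y using that by (auto simp: E'_def)
    obtain w x' where wx: "x' \<in> E'" "\<And>y. y \<in> E' \<Longrightarrow> y \<le> w" "w - x' \<in> W"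
      using upper_bound_minus_directed[OF E'_ne E'_dir E'_ub W(1)] by blast
    obtain T where T: "finite T" "T \<subseteq> S" "x' = inf (\<Sum>T) u" using wx(1) by (auto simp: E'_def E_def)
    have "y - \<Sum>T \<in> V" if y: "y \<in> E" "\<Sum>T \<le> y" for y
    proof -
      obtain T' where T': "finite T'" "T' \<subseteq> S" "y = \<Sum>T'" using y(1) by (auto simp: E_def)
      define d where "d = \<Sum>(T' - T)"
      have d0: "0 \<le> d" using T' S(2) by (auto simp: d_def intro!: sum_nonneg)
      have T0: "0 \<le> \<Sum>T" using T S(2) by (auto intro!: sum_nonneg)
      have un: "\<Sum>(T \<union> T') = \<Sum>T + d"
      proof -
        have "\<Sum>(T \<union> (T' - T)) = \<Sum>T + d"
          unfolding d_def by (rule sum.union_disjoint) (use T T' in auto)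
        then show ?thesis by simp
      qed
      have "inf (\<Sum>T) d = 0"
        unfolding inf_commute[of "\<Sum>T"] d_def
      proof (rule inf_sum_eq_0)
        fix t assume t: "t \<in> T' - T"
        have "inf (\<Sum>T) t = 0"
        proof (rule inf_sum_eq_0)
          fix s assume "s \<in> T"
          then have "s \<in> S" "t \<in> S" "s \<noteq> t" using T(2) T'(2) t by auto
          then show "inf s t = 0" by (rule pairwiseD[OF S(3)])
        qed (use T T' S(2) t in auto)
        then show "inf t (\<Sum>T) = 0" by (simp add: inf_commute)
      qed (use T' S(2) T0 in auto)
      then have "\<Sum>(T \<union> T') = sup (\<Sum>T) d" using un add_eq_inf_sup[of "\<Sum>T" d] by simp
      moreover have "inf (inf (\<Sum>T) u) (inf d u) = 0"
        by (rule inf_mono_eq_0[OF \<open>inf (\<Sum>T) d = 0\<close>]) (use T0 d0 u in auto)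
      then have "sup (inf (\<Sum>T) u) (inf d u) = inf (\<Sum>T) u + inf d u"
        using add_eq_inf_sup[of "inf (\<Sum>T) u" "inf d u"] by simp
      ultimately have eq: "inf (\<Sum>(T \<union> T')) u = x' + inf d u"
        by (simp only: inf_sup_distrib_lattice T(3))
      have "inf (\<Sum>(T \<union> T')) u \<le> w"
        using union(1)[OF T(1,2) T'(1,2)] by (intro wx(2)) (simp add: E'_def)
      then have dw: "inf d u \<le> w - x'" unfolding eq by (simp only: le_diff_eq add.commute)
      have "inf d u \<in> W" by (rule nbhd_le[OF W(1) _ dw wx(3)]) (use d0 u in simp)
      then have "d \<in> V" using W(2) d0 by simp
      have "y \<le> d + \<Sum>T" using union(3)[OF T(1,2) T'(1,2)] T'(3) un by (simp add: add.commute)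
      then have "y - \<Sum>T \<le> d" by (simp only: diff_le_eq)
      moreover have "0 \<le> y - \<Sum>T" using y(2) by simp
      ultimately show ?thesis using nbhd_le[OF V] \<open>d \<in> V\<close> by blast
    qed
    moreover have "\<Sum>T \<in> E" using T(1,2) by (auto simp: E_def)
    ultimately show "\<exists>x\<in>E. \<forall>y\<in>E. x \<le> y \<longrightarrow> y - x \<in> V" by blast
  qed
  have "x \<le> t" if "x \<in> S" for x
  proof -
    have "\<Sum>{x} \<in> E" unfolding E_def using that by blast
    then show ?thesis using isLub_upper[OF t] by simp
  qed
  moreover have "t \<le> w" if w: "\<forall>x\<in>S. x \<le> w" for w
  proof (rule isLub_least[OF t])
    fix y assume "y \<in> E"
    then obtain T where T: "finite T" "T \<subseteq> S" "y = \<Sum>T" by (auto simp: E_def)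
    have "0 \<le> w" using S(1,2) w by (meson ex_in_conv order_trans)
    then show "y \<le> w"
      unfolding T(3) using T(1,2) S(2,3) w
      by (intro sum_disjoint_le) (auto intro: pairwise_subset)
  qed
  ultimately show "\<exists>s. isLub UNIV S s" unfolding isLub_UNIV_iff by blast
qed

lemma monotone_complete_universally_complete:
  "monotone_complete_topology TYPE('a net_index) \<tau> \<Longrightarrow> universally_complete TYPE('a)"
  by (simp add: universally_complete_def monotone_complete_order_complete
      monotone_complete_laterally_complete)

section \<open>Increasing Cauchy nets and unbounded order convergence\<close>

lemma increasing_cauchy_bounded:
  assumes A: "directed_set A r" and pos: "\<forall>a\<in>A. 0 \<le> x a"
    and inc: "increasing_net A r x" and x: "cauchy_net \<tau> A r x"
  shows "tau_bounded \<tau> (x ` A)"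
  unfolding bounded_iff
proof
  fix V assume V: "V \<in> \<N>"
  obtain W where W: "W \<in> \<N>" "\<And>x y. x \<in> W \<Longrightarrow> y \<in> W \<Longrightarrow> x + y \<in> V"
    using nbhd_half[OF V] by metis
  obtain a where a: "a \<in> A" "\<And>b c. b \<in> A \<Longrightarrow> c \<in> A \<Longrightarrow> r a b \<Longrightarrow> r a c \<Longrightarrow> x b - x c \<in> W"
    using eventually_cauchy[OF A x W(1)] by blast
  obtain c where c: "c > 0" "c *\<^sub>R x a \<in> W" using nbhd_absorb[OF W(1)] by blast
  define d where "d = min c 1"
  have d: "0 < d" "d \<le> c" "d \<le> 1" using c(1) by (auto simp: d_def)
  have "d *\<^sub>R x b \<in> V" if b: "b \<in> A" for b
  proof -
    obtain e where e: "e \<in> A" "r a e" "r b e" using directed_upper[OF A a(1) b] by blast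
    have "1 *\<^sub>R (x e - x a) \<in> W" using a e directed_refl[OF A a(1)] by simp
    then have "d *\<^sub>R (x e - x a) \<in> W"
      by (rule nbhd_scaleR[OF W(1), rotated]) (use d in simp)
    moreover have "d *\<^sub>R x a \<in> W" by (rule nbhd_scaleR[OF W(1) _ c(2)]) (use d in simp)
    ultimately have "d *\<^sub>R (x e - x a) + d *\<^sub>R x a \<in> V" by (rule W(2))
    then have "d *\<^sub>R x e \<in> V" by (simp add: scaleR_right_diff_distrib)
    moreover have "d *\<^sub>R x b \<le> d *\<^sub>R x e"
      using inc b e d(1) by (intro scaleR_left_mono) (auto simp: increasing_net_def)
    moreover have "0 \<le> d *\<^sub>R x b" using pos b d(1) by (simp add: scaleR_nonneg_nonneg)
    ultimately show ?thesis using nbhd_le[OF V] by blast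
  qed
  then show "\<exists>c>0. \<forall>y\<in>x ` A. c *\<^sub>R y \<in> V" using d(1) by blast
qed

lemma quasi_complete_monotone_complete:
  "quasi_complete_topology TYPE('i) \<tau> \<Longrightarrow> monotone_complete_topology TYPE('i) \<tau>"
  unfolding quasi_complete_topology_def monotone_complete_topology_def
  using increasing_cauchy_bounded by blast

lemma levi_monotone_complete:
  assumes levi: "levi_topology TYPE('i) \<tau>"
  shows "monotone_complete_topology TYPE('i) \<tau>"
  unfolding monotone_complete_topology_def
proof (intro allI impI, elim conjE)
  fix A :: "'i set" and r and x :: "'i \<Rightarrow> 'a"
  assume A: "directed_set A r" and pos: "\<forall>a\<in>A. 0 \<le> x a"
    and inc: "increasing_net A r x" and x: "cauchy_net \<tau> A r x"
  obtain s where s: "isLub UNIV (x ` A) s"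
    using levi A pos inc increasing_cauchy_bounded[OF A pos inc x]
    unfolding levi_topology_def by blast
  have ne: "x ` A \<noteq> {}" using A by (simp add: directed_set_def)
  note dir = increasing_net_range_directed[OF A inc]
  have "eventually (\<lambda>a. x a - s \<in> V) (tails A r)" if V: "V \<in> \<N>" for V
  proof -
    obtain y where "y \<in> x ` A" "s - y \<in> V" by (rule lebesgue_lub[OF ne dir s V])
    then obtain a where a: "a \<in> A" "s - x a \<in> V" by blast
    have "x b - s \<in> V" if b: "b \<in> A" "r a b" for b
    proof -
      have "x b \<le> s" using isLub_upper[OF s] b(1) by blast
      moreover have "x a \<le> x b" using inc a(1) b by (auto simp: increasing_net_def)
      ultimately have "s - x b \<in> V"
        by (intro nbhd_le[OF V _ _ a(2)]) (auto intro: diff_left_mono)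
      then show ?thesis using nbhd_diff_commute[OF V] by blast
    qed
    then show ?thesis using a(1) unfolding eventually_tails[OF A] by blast
  qed
  then show "\<exists>l. limitin \<tau> x l (tails A r)" unfolding limitin_iff by blast
qed

text \<open>Lebesgue and unbounded together: order convergence of each truncation gives \<open>\<tau>\<close>-convergence of
  the truncations, hence of the net.\<close>

lemma uo_converges_limitin:
  assumes "uo_converges x l F"
  shows "limitin \<tau> x l F"
  unfolding limitin_iff
proof
  fix V assume V: "V \<in> \<N>"
  obtain u W where u: "0 \<le> u" and W: "W \<in> \<N>" "\<forall>x. inf \<bar>x\<bar> u \<in> W \<longrightarrow> x \<in> V"
    using unbounded[OF V] by blast
  have "order_converges (\<lambda>a. inf \<bar>x a - l\<bar> u) 0 F"
    using assms u by (simp add: uo_converges_def)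
  then obtain B :: "'a set" and s y where y: "net_decreases_to_0 B s y"
    and ev: "\<And>b. b \<in> B \<Longrightarrow> eventually (\<lambda>a. \<bar>inf \<bar>x a - l\<bar> u - 0\<bar> \<le> y b) F"
    unfolding order_converges_def by blast
  have B: "directed_set B s" "isGlb UNIV (y ` B) 0"
    and mono: "\<And>a b. a \<in> B \<Longrightarrow> b \<in> B \<Longrightarrow> s a b \<Longrightarrow> y b \<le> y a"
    using y by (auto simp: net_decreases_to_0_def)
  have dir: "\<exists>f\<in>y ` B. f \<le> d \<and> f \<le> e" if "d \<in> y ` B" "e \<in> y ` B" for d e
  proof -
    obtain a where a: "a \<in> B" "d = y a" using \<open>d \<in> y ` B\<close> by blast
    obtain b where b: "b \<in> B" "e = y b" using \<open>e \<in> y ` B\<close> by blast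
    obtain c where "c \<in> B" "s a c" "s b c" using directed_upper[OF B(1) a(1) b(1)] by blast
    then show ?thesis using a b mono by blast
  qed
  have ne: "y ` B \<noteq> {}" using B(1) by (simp add: directed_set_def)
  obtain d where "d \<in> y ` B" "d \<in> W" by (rule lebesgue[OF ne dir B(2) W(1)])
  then obtain b where b: "b \<in> B" "y b \<in> W" by blast
  show "eventually (\<lambda>a. x a - l \<in> V) F"
    using ev[OF b(1)]
  proof eventually_elim
    case (elim a)
    have "inf \<bar>x a - l\<bar> u \<in> W" by (rule nbhd_abs_le[OF W(1) _ b(2)]) (use elim in simp)
    then show ?case using W(2) by blast
  qed
qed

text \<open>An increasing \<open>\<tau>\<close>-Cauchy net is uo-Cauchy: the eventual upper bounds \<open>G\<close> of the truncated
  differences have infimum zero, because \<open>G\<close> contains all upper bounds of each set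
  \<open>{inf (x b - x a) u | b. r a b}\<close>, and for large \<open>a\<close> such a bound can be chosen near zero.\<close>

lemma boundedly_uo_complete_monotone_complete:
  assumes uo: "boundedly_uo_complete TYPE('i) \<tau>"
  shows "monotone_complete_topology TYPE('i) \<tau>"
  unfolding monotone_complete_topology_def
proof (intro allI impI, elim conjE)
  fix A :: "'i set" and r and x :: "'i \<Rightarrow> 'a"
  assume A: "directed_set A r" and pos: "\<forall>a\<in>A. 0 \<le> x a"
    and inc: "increasing_net A r x" and x: "cauchy_net \<tau> A r x"
  let ?F = "tails (A \<times> A) (prod_rel r)"
  note AA = directed_set_prod[OF A]
  have incD: "x a \<le> x b" if "a \<in> A" "b \<in> A" "r a b" for a b
    using inc that by (auto simp: increasing_net_def)
  have "uo_cauchy_net A r x"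
    unfolding uo_cauchy_net_def uo_converges_def
  proof (intro allI impI)
    fix u :: 'a assume u: "0 \<le> u"
    define G where "G = {g. eventually (\<lambda>p. inf \<bar>x (fst p) - x (snd p)\<bar> u \<le> g) ?F}"
    have "u \<in> G" by (simp add: G_def)
    have "inf g h \<in> G" if "g \<in> G" "h \<in> G" for g h
      using that unfolding G_def by (auto elim: eventually_elim2)
    then have "\<exists>c\<in>G. c \<le> g \<and> c \<le> h" if "g \<in> G" "h \<in> G" for g h
      using that by (intro bexI[of _ "inf g h"]) auto
    then have G: "directed_set G (\<lambda>g h. h \<le> g)"
      using \<open>u \<in> G\<close> by (auto simp: directed_set_def reflp_on_def transp_on_def)
    have G_pos: "0 \<le> g" if "g \<in> G" for g
    proof -
      have "eventually (\<lambda>p. inf \<bar>x (fst p) - x (snd p)\<bar> u \<le> g) ?F" using that by (simp add: G_def)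
      then obtain p where "inf \<bar>x (fst p) - x (snd p)\<bar> u \<le> g"
        using eventually_happens'[OF tails_not_bot[OF AA]] by blast
      moreover have "0 \<le> inf \<bar>x (fst p) - x (snd p)\<bar> u" using u by simp
      ultimately show ?thesis by (rule order_trans[rotated])
    qed
    have "h \<le> 0" if h: "\<And>g. g \<in> G \<Longrightarrow> h \<le> g" for h
    proof -
      have "pprt h \<in> V" if V: "V \<in> \<N>" for V
      proof -
        obtain W where W: "W \<in> \<N>" "\<And>x y. x \<in> W \<Longrightarrow> y \<in> W \<Longrightarrow> x + y \<in> V"
          using nbhd_half[OF V] by metis
        obtain a where a: "a \<in> A"
          "\<And>b c. b \<in> A \<Longrightarrow> c \<in> A \<Longrightarrow> r a b \<Longrightarrow> r a c \<Longrightarrow> x b - x c \<in> W"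
          using eventually_cauchy[OF A x W(1)] by blast
        define E where "E = {inf (x b - x a) u | b. b \<in> A \<and> r a b}"
        have E_ne: "E \<noteq> {}" using a(1) directed_refl[OF A a(1)] by (auto simp: E_def)
        have E_ub: "y \<le> u" if "y \<in> E" for y using that by (auto simp: E_def)
        have E_dir: "\<exists>f\<in>E. d \<le> f \<and> e \<le> f" if "d \<in> E" "e \<in> E" for d e
        proof -
          obtain b where b: "b \<in> A" "r a b" "d = inf (x b - x a) u"
            using \<open>d \<in> E\<close> by (auto simp: E_def)
          obtain c where c: "c \<in> A" "r a c" "e = inf (x c - x a) u"
            using \<open>e \<in> E\<close> by (auto simp: E_def)
          obtain f where f: "f \<in> A" "r b f" "r c f" using directed_upper[OF A b(1) c(1)] by blast
          have "r a f" using directed_trans[OF A b(2) f(2)] a(1) b(1) f(1) by blast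
          then have "inf (x f - x a) u \<in> E" using f(1) by (auto simp: E_def)
          moreover have "d \<le> inf (x f - x a) u"
            unfolding b(3) by (intro inf_mono diff_right_mono incD order_refl b(1) f)
          moreover have "e \<le> inf (x f - x a) u"
            unfolding c(3) by (intro inf_mono diff_right_mono incD order_refl c(1) f)
          ultimately show ?thesis by blast
        qed
        obtain w y where wy: "y \<in> E" "\<And>e. e \<in> E \<Longrightarrow> e \<le> w" "w - y \<in> W"
          using upper_bound_minus_directed[OF E_ne E_dir E_ub W(1)] by blast
        obtain b where b: "b \<in> A" "r a b" "y = inf (x b - x a) u" using wy(1) by (auto simp: E_def)
        have y0: "0 \<le> y" using b incD[OF a(1)] u by simp
        have "x b - x a \<in> W" using a b directed_refl[OF A a(1)] by blast
        then have "y \<in> W" by (rule nbhd_le[OF W(1) y0, rotated]) (simp add: b(3))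
        then have "(w - y) + y \<in> V" using wy(3) W(2) by blast
        then have "w \<in> V" by simp
        have "w \<in> G"
          unfolding G_def mem_Collect_eq eventually_tails[OF AA]
        proof (intro bexI[of _ "(a, a)"] ballI impI)
          fix p assume p: "p \<in> A \<times> A" "prod_rel r (a, a) p"
          then have p': "fst p \<in> A" "snd p \<in> A" "r a (fst p)" "r a (snd p)"
            by (auto simp: prod_rel_def)
          obtain f where f: "f \<in> A" "r (fst p) f" "r (snd p) f"
            using directed_upper[OF A p'(1,2)] by blast
          have raf: "r a f" using directed_trans[OF A p'(3) f(2)] a(1) p'(1) f(1) by blast
          have "x (fst p) - x (snd p) \<le> x f - x a" "x (snd p) - x (fst p) \<le> x f - x a"
            by (intro diff_mono incD a(1) p' f)+
          then have "\<bar>x (fst p) - x (snd p)\<bar> \<le> x f - x a" by (simp add: abs_le_iff_lattice)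
          then have "inf \<bar>x (fst p) - x (snd p)\<bar> u \<le> inf (x f - x a) u"
            by (intro inf_mono order_refl)
          also have "\<dots> \<le> w" by (rule wy(2)) (use f(1) raf in \<open>auto simp: E_def\<close>)
          finally show "inf \<bar>x (fst p) - x (snd p)\<bar> u \<le> w" .
        qed (use a(1) in simp)
        then have "pprt h \<le> w" unfolding pprt_le_iff using h G_pos by blast
        then show ?thesis using nbhd_le[OF V] \<open>w \<in> V\<close> by simp
      qed
      then have "pprt h = 0" by (rule nbhds_separate)
      then show ?thesis using le_pprt[of h] by simp
    qed
    then have "isGlb UNIV (id ` G) 0" using G_pos unfolding isGlb_UNIV_iff by auto
    then have dec: "net_decreases_to_0 G (\<lambda>g h. h \<le> g) id"
      using G by (simp add: net_decreases_to_0_def)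
    show "order_converges (\<lambda>p. inf \<bar>(case p of (a, b) \<Rightarrow> x a - x b) - 0\<bar> u) 0 ?F"
    proof (rule order_convergesI[OF dec])
      fix g assume "g \<in> G"
      then have "eventually (\<lambda>p. inf \<bar>x (fst p) - x (snd p)\<bar> u \<le> g) ?F" by (simp add: G_def)
      then show "eventually (\<lambda>p. \<bar>inf \<bar>(case p of (a, b) \<Rightarrow> x a - x b) - 0\<bar> u - 0\<bar> \<le> id g) ?F"
        by eventually_elim (use u in \<open>simp add: case_prod_unfold\<close>)
    qed
  qed
  then obtain l where "uo_converges x l (tails A r)"
    using uo A increasing_cauchy_bounded[OF A pos inc x] unfolding boundedly_uo_complete_def by blast
  then show "\<exists>l. limitin \<tau> x l (tails A r)" using uo_converges_limitin by blast
qed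

text \<open>A uo-Cauchy net is \<open>\<tau>\<close>-Cauchy and so has a \<open>\<tau>\<close>-limit. Since order intervals are \<open>\<tau>\<close>-closed, the
  elements dominating the truncated differences also dominate those from the limit.\<close>

lemma universally_complete_boundedly_uo_complete:
  assumes uc: "universally_complete TYPE('a)"
  shows "boundedly_uo_complete TYPE('i) \<tau>"
  unfolding boundedly_uo_complete_def
proof (intro allI impI, elim conjE)
  fix A :: "'i set" and r and x :: "'i \<Rightarrow> 'a"
  assume A: "directed_set A r" and x: "uo_cauchy_net A r x"
  have "cauchy_net \<tau> A r x"
    using x uo_converges_limitin unfolding uo_cauchy_net_def cauchy_net_def by blast
  then obtain l where l: "limitin \<tau> x l (tails A r)"
    using universally_complete_complete[OF uc, where 'i = 'i] A
    unfolding complete_topology_def by blast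
  have "uo_converges x l (tails A r)"
    unfolding uo_converges_def
  proof (intro allI impI)
    fix u :: 'a assume u: "0 \<le> u"
    let ?F = "tails (A \<times> A) (prod_rel r)"
    have "order_converges (\<lambda>p. inf \<bar>(case p of (a, b) \<Rightarrow> x a - x b) - 0\<bar> u) 0 ?F"
      using x u by (simp add: uo_cauchy_net_def uo_converges_def)
    then obtain B :: "'a set" and s y where y: "net_decreases_to_0 B s y"
      and ev: "\<And>b. b \<in> B \<Longrightarrow>
        eventually (\<lambda>p. \<bar>inf \<bar>(case p of (a, b) \<Rightarrow> x a - x b) - 0\<bar> u - 0\<bar> \<le> y b) ?F"
      unfolding order_converges_def by blast
    show "order_converges (\<lambda>a. inf \<bar>x a - l\<bar> u) 0 (tails A r)"
    proof (rule order_convergesI[OF y])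
      fix b assume "b \<in> B"
      from ev[OF this] obtain p where p: "p \<in> A \<times> A" and
        le: "\<And>q. q \<in> A \<times> A \<Longrightarrow> prod_rel r p q \<Longrightarrow>
          \<bar>inf \<bar>(case q of (a, b) \<Rightarrow> x a - x b) - 0\<bar> u - 0\<bar> \<le> y b"
        unfolding eventually_tails[OF directed_set_prod[OF A]] by blast
      have "\<bar>inf \<bar>x a - l\<bar> u - 0\<bar> \<le> y b" if a: "a \<in> A" "r (fst p) a" for a
      proof -
        have "inf \<bar>x a - l\<bar> u \<le> y b"
        proof (rule limit_mono[OF tails_not_bot[OF A]])
          show "eventually (\<lambda>c. inf \<bar>x a - x c\<bar> u - inf \<bar>x a - l\<bar> u \<in> V) (tails A r)"
            if V: "V \<in> \<N>" for V
          proof -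
            have "eventually (\<lambda>c. x c - l \<in> V) (tails A r)" using l V unfolding limitin_iff by blast
            then show ?thesis
            proof eventually_elim
              case (elim c)
              have "\<bar>\<bar>x a - x c\<bar> - \<bar>x a - l\<bar>\<bar> \<le> \<bar>(x a - x c) - (x a - l)\<bar>"
                by (rule abs_triangle_ineq3)
              also have "(x a - x c) - (x a - l) = - (x c - l)" by simp
              finally have "\<bar>\<bar>x a - x c\<bar> - \<bar>x a - l\<bar>\<bar> \<le> \<bar>x c - l\<bar>" by (simp only: abs_minus_cancel)
              then have "\<bar>inf \<bar>x a - x c\<bar> u - inf \<bar>x a - l\<bar> u\<bar> \<le> \<bar>x c - l\<bar>"
                by (rule order_trans[OF abs_inf_diff_le])
              then show ?case by (rule solidD[OF nbhd_solid[OF V] _ elim])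
            qed
          qed
          show "eventually (\<lambda>c. y b - y b \<in> V) (tails A r)" if "V \<in> \<N>" for V
            using nbhd_0[OF that] by simp
          show "eventually (\<lambda>c. inf \<bar>x a - x c\<bar> u \<le> y b) (tails A r)"
            unfolding eventually_tails[OF A]
          proof (intro bexI[of _ "snd p"] ballI impI)
            fix c assume c: "c \<in> A" "r (snd p) c"
            show "inf \<bar>x a - x c\<bar> u \<le> y b"
              using le[of "(a, c)"] a c u by (simp add: prod_rel_def)
          qed (use p in auto)
        qed
        then show ?thesis using u by simp
      qed
      then show "eventually (\<lambda>a. \<bar>inf \<bar>x a - l\<bar> u - 0\<bar> \<le> y b) (tails A r)"
        using p unfolding eventually_tails[OF A] by (intro bexI[of _ "fst p"]) auto
    qed
  qed
  then show "\<exists>l. uo_converges x l (tails A r)" by blast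
qed

end

theorem theorem3p27:
  fixes \<tau> :: "'a::vector_lattice topology"
  assumes "archimedean_lattice TYPE('a)"
    and "minimal_topology \<tau>"
  shows "(universally_complete TYPE('a) \<longleftrightarrow> complete_topology TYPE('a net_index) \<tau>) \<and>
    (universally_complete TYPE('a) \<longleftrightarrow> monotone_complete_topology TYPE('a net_index) \<tau>) \<and>
    (universally_complete TYPE('a) \<longleftrightarrow> levi_topology TYPE('a net_index) \<tau>) \<and>
    (universally_complete TYPE('a) \<longleftrightarrow> quasi_complete_topology TYPE('a net_index) \<tau>) \<and>
    (universally_complete TYPE('a) \<longleftrightarrow> boundedly_uo_complete TYPE('a net_index) \<tau>)"
proof -
  interpret minimal_archimedean \<tau> using assms by unfold_locales
  let ?UC = "universally_complete TYPE('a)"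
  let ?MCP = "monotone_complete_topology TYPE('a net_index) \<tau>"
  have complete: "?UC \<Longrightarrow> complete_topology TYPE('a net_index) \<tau>"
    by (rule universally_complete_complete)
  have quasi: "complete_topology TYPE('a net_index) \<tau> \<Longrightarrow> quasi_complete_topology TYPE('a net_index) \<tau>"
    unfolding complete_topology_def quasi_complete_topology_def by blast
  have mcp: "quasi_complete_topology TYPE('a net_index) \<tau> \<Longrightarrow> ?MCP"
    by (rule quasi_complete_monotone_complete)
  have uc: "?MCP \<Longrightarrow> ?UC" by (rule monotone_complete_universally_complete)
  have "?UC \<longleftrightarrow> levi_topology TYPE('a net_index) \<tau>"
    using universally_complete_levi levi_monotone_complete uc by blast
  moreover have "?UC \<longleftrightarrow> boundedly_uo_complete TYPE('a net_index) \<tau>"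
    using universally_complete_boundedly_uo_complete boundedly_uo_complete_monotone_complete uc
    by blast
  ultimately show ?thesis using complete quasi mcp uc by blast
qed

end
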